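(* Let $\mathcal C$ be a modular category over an algebraically closed field $k$ of characteristic zero, and let $A_{\mathcal C}=(A_{\mathcal C}(i,j))_{i,j\in \mathrm{Irr}(\mathcal C)}$ be the matrix with entries $$A_{\mathcal C}(i,j)=\frac{S_{ij}}{d_id_j}.$$ Then $A_{\mathcal C}$ is multiplicative-block-rank-one if and only if $\mathcal C$ is pointed.
   Context: Modular data. A modular category $\mathcal C$ over $k$ is a ribbon fusion category (braiding $c$, twist $\theta$, spherical trace $\operatorname{tr}$) with representatives $V_i$ of the simple isomorphism classes, $i\in I=\mathrm{Irr}(\mathcal C)$ (a finite set), $V_0=\mathbf 1$, such that the unnormalized $S$-matrix $S_{ij}=\operatorname{tr}_{V_i\otimes V_j}(c_{V_j,V_i}\circ c_{V_i,V_j})$ is invertible; $d_i=S_{0i}$ is the quantum dimension of $V_i$ and is nonzero. $\mathcal C$ is pointed if every simple object is invertible. Matrix conditions. Let $A=(A_{ij})_{i,j\in I}$ be a square matrix with entries in a field, and $\operatorname{supp}(A)=\{(i,j):A_{ij}\ne0\}$. $A$ has rectangular support if there are pairwise disjoint nonempty row sets $R_1,\dots,R_s\subseteq I$ and pairwise disjoint nonempty column sets $C_1,\dots,C_s\subseteq I$ ($s\ge0$) with $\operatorname{supp}(A)=\bigsqcup_{p=1}^sR_p\times C_p$. $A$ is block-rank-one if it has rectangular support and each nonzero support block $A|_{R_p\times C_p}$ has rank one. For $r\ge1$, $A^{\circ r}=(A_{ij}^r)_{i,j}$ is the $r$-th Hadamard power. $A$ is multiplicative-block-rank-one if $A^{\circ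 r}$ is block-rank-one for some $r\ge1$. *)

theory Defs
  imports "HOL-Analysis.Analysis"
begin

section \<open>Support and rank conditions on square matrices\<close>

definition matrix_supp :: "'k::field^'i^'i \<Rightarrow> ('i \<times> 'i) set" where
  "matrix_supp A = {(i, j). A $ i $ j \<noteq> 0}"

definition rectangular_decomposition ::
    "'k::field^'i^'i \<Rightarrow> nat \<Rightarrow> (nat \<Rightarrow> 'i set) \<Rightarrow> (nat \<Rightarrow> 'i set) \<Rightarrow> bool" where
  "rectangular_decomposition A s R C \<longleftrightarrow>
     (\<forall>p<s. R p \<noteq> {}) \<and> (\<forall>p<s. C p \<noteq> {}) \<and>
     disjoint_family_on R {..<s} \<and> disjoint_family_on C {..<s} \<and>
     matrix_supp A = (\<Union>p<s. R p \<times> C p)"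

text \<open>
  The block \<open>A|\<^bsub>R \<times> C\<^esub>\<close>, padded with zero rows and columns to the full index type; the padding
  does not affect the rank.
\<close>
definition matrix_block :: "'k::field^'i^'i \<Rightarrow> 'i set \<Rightarrow> 'i set \<Rightarrow> 'k^'i^'i" where
  "matrix_block A R C = (\<chi> i j. if i \<in> R \<and> j \<in> C then A $ i $ j else 0)"

text \<open>
  The existence of a decomposition says that \<open>A\<close> has rectangular support (\<open>s = 0\<close> for \<open>A = 0\<close>). Its
  blocks are unique up to their order, so it does not matter that the rank condition is placed under
  the same existential quantifier.
\<close>
definition block_rank_one :: "'k::field^'i^'i \<Rightarrow> bool" where
  "block_rank_one A \<longleftrightarrow>
     (\<exists>s R C. rectangular_decomposition A s R C \<and> (\<forall>p<s. rank (matrix_block A (R p) (C p)) = 1))"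

definition hadamard_power :: "'k::field^'i^'i \<Rightarrow> nat \<Rightarrow> 'k^'i^'i" where
  "hadamard_power A r = (\<chi> i j. (A $ i $ j) ^ r)"

definition multiplicative_block_rank_one :: "'k::field^'i^'i \<Rightarrow> bool" where
  "multiplicative_block_rank_one A \<longleftrightarrow> (\<exists>r\<ge>1. block_rank_one (hadamard_power A r))"


section \<open>Ribbon fusion categories\<close>

text \<open>
  Operations are total functions on the underlying types; the axioms only constrain them on objects
  in \<open>Obj\<close> and on composable (respectively parallel) morphisms. \<open>g \<cdot> f\<close> is ``\<open>g\<close> after \<open>f\<close>''.
  The structural morphisms have the following types:
  \<open>assoc X Y Z : (X \<otimes> Y) \<otimes> Z \<rightarrow> X \<otimes> (Y \<otimes> Z)\<close>, \<open>lunit X : \<one> \<otimes> X \<rightarrow> X\<close>, \<open>runit X : X \<otimes> \<one> \<rightarrow> X\<close>,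
  \<open>ev X : X\<^sup>* \<otimes> X \<rightarrow> \<one>\<close>, \<open>coev X : \<one> \<rightarrow> X \<otimes> X\<^sup>*\<close>, \<open>braid X Y : X \<otimes> Y \<rightarrow> Y \<otimes> X\<close>, \<open>twist X : X \<rightarrow> X\<close>.
\<close>
record ('o, 'm, 'k) ribbon_data =
  Obj :: "'o set"
  Hom :: "'o \<Rightarrow> 'o \<Rightarrow> 'm set"
  ident :: "'o \<Rightarrow> 'm"
  compM :: "'m \<Rightarrow> 'm \<Rightarrow> 'm"  (infixr \<open>\<cdot>\<index>\<close> 55)
  zeroM :: "'o \<Rightarrow> 'o \<Rightarrow> 'm"
  addM :: "'m \<Rightarrow> 'm \<Rightarrow> 'm"  (infixl \<open>\<oplus>\<index>\<close> 53)
  smulM :: "'k \<Rightarrow> 'm \<Rightarrow> 'm"  (infixr \<open>\<odot>\<index>\<close> 65)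
  tensorO :: "'o \<Rightarrow> 'o \<Rightarrow> 'o"  (infixl \<open>\<otimes>\<index>\<close> 70)
  tensorM :: "'m \<Rightarrow> 'm \<Rightarrow> 'm"  (infixl \<open>\<otimes>\<^sub>m\<index>\<close> 70)
  unitO :: "'o"  (\<open>\<one>\<index>\<close>)
  assoc :: "'o \<Rightarrow> 'o \<Rightarrow> 'o \<Rightarrow> 'm"
  lunit :: "'o \<Rightarrow> 'm"
  runit :: "'o \<Rightarrow> 'm"
  dual :: "'o \<Rightarrow> 'o"
  ev :: "'o \<Rightarrow> 'm"
  coev :: "'o \<Rightarrow> 'm"
  braid :: "'o \<Rightarrow> 'o \<Rightarrow> 'm"
  twist :: "'o \<Rightarrow> 'm"

definition inverse_pair :: "('o, 'm, 'k, 'z) ribbon_data_scheme \<Rightarrow> 'o \<Rightarrow> 'o \<Rightarrow> 'm \<Rightarrow> 'm \<Rightarrow> bool" where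
  "inverse_pair C X Y f g \<longleftrightarrow>
     f \<in> Hom C X Y \<and> g \<in> Hom C Y X \<and> g \<cdot> f = ident C X \<and> f \<cdot> g = ident C Y"
  for C (structure)

definition iso_in :: "('o, 'm, 'k, 'z) ribbon_data_scheme \<Rightarrow> 'o \<Rightarrow> 'o \<Rightarrow> 'm \<Rightarrow> bool" where
  "iso_in C X Y f \<longleftrightarrow> (\<exists>g. inverse_pair C X Y f g)"

definition isomorphic :: "('o, 'm, 'k, 'z) ribbon_data_scheme \<Rightarrow> 'o \<Rightarrow> 'o \<Rightarrow> bool" where
  "isomorphic C X Y \<longleftrightarrow> (\<exists>f. iso_in C X Y f)"

text \<open>Meaningful only if \<open>f\<close> is an isomorphism; hom-sets will be assumed to be disjoint.\<close>
definition inv_mor :: "('o, 'm, 'k, 'z) ribbon_data_scheme \<Rightarrow> 'm \<Rightarrow> 'm" where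
  "inv_mor C f = (THE g. \<exists>X\<in>Obj C. \<exists>Y\<in>Obj C. inverse_pair C X Y f g)"

definition mono_in :: "('o, 'm, 'k, 'z) ribbon_data_scheme \<Rightarrow> 'o \<Rightarrow> 'o \<Rightarrow> 'm \<Rightarrow> bool" where
  "mono_in C X Y f \<longleftrightarrow> f \<in> Hom C X Y \<and>
     (\<forall>W\<in>Obj C. \<forall>g\<in>Hom C W X. \<forall>h\<in>Hom C W X. f \<cdot> g = f \<cdot> h \<longrightarrow> g = h)"
  for C (structure)

definition epi_in :: "('o, 'm, 'k, 'z) ribbon_data_scheme \<Rightarrow> 'o \<Rightarrow> 'o \<Rightarrow> 'm \<Rightarrow> bool" where
  "epi_in C X Y f \<longleftrightarrow> f \<in> Hom C X Y \<and>
     (\<forall>W\<in>Obj C. \<forall>g\<in>Hom C Y W. \<forall>h\<in>Hom C Y W. g \<cdot> f = h \<cdot> f \<longrightarrow> g = h)"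
  for C (structure)

definition is_kernel :: "('o, 'm, 'k, 'z) ribbon_data_scheme \<Rightarrow> 'o \<Rightarrow> 'o \<Rightarrow> 'o \<Rightarrow> 'm \<Rightarrow> 'm \<Rightarrow> bool" where
  \<comment> \<open>\<open>u : K \<rightarrow> X\<close> is a kernel of \<open>f : X \<rightarrow> Y\<close>\<close>
  "is_kernel C K X Y u f \<longleftrightarrow> u \<in> Hom C K X \<and> f \<in> Hom C X Y \<and> f \<cdot> u = zeroM C K Y \<and>
     (\<forall>W\<in>Obj C. \<forall>h\<in>Hom C W X. f \<cdot> h = zeroM C W Y \<longrightarrow> (\<exists>!v. v \<in> Hom C W K \<and> u \<cdot> v = h))"
  for C (structure)

definition is_cokernel :: "('o, 'm, 'k, 'z) ribbon_data_scheme \<Rightarrow> 'o \<Rightarrow> 'o \<Rightarrow> 'o \<Rightarrow> 'm \<Rightarrow> 'm \<Rightarrow> bool" where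
  \<comment> \<open>\<open>q : Y \<rightarrow> Q\<close> is a cokernel of \<open>f : X \<rightarrow> Y\<close>\<close>
  "is_cokernel C X Y Q f q \<longleftrightarrow> f \<in> Hom C X Y \<and> q \<in> Hom C Y Q \<and> q \<cdot> f = zeroM C X Q \<and>
     (\<forall>W\<in>Obj C. \<forall>h\<in>Hom C Y W. h \<cdot> f = zeroM C X W \<longrightarrow> (\<exists>!v. v \<in> Hom C Q W \<and> v \<cdot> q = h))"
  for C (structure)

definition zero_object :: "('o, 'm, 'k, 'z) ribbon_data_scheme \<Rightarrow> 'o \<Rightarrow> bool" where
  "zero_object C Z \<longleftrightarrow> Z \<in> Obj C \<and> (\<forall>X\<in>Obj C. (\<exists>!f. f \<in> Hom C X Z) \<and> (\<exists>!f. f \<in> Hom C Z X))"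

definition biproduct :: "('o, 'm, 'k, 'z) ribbon_data_scheme \<Rightarrow> 'o \<Rightarrow> 'o \<Rightarrow> 'o \<Rightarrow> bool" where
  \<comment> \<open>\<open>Y\<close> is a direct sum of \<open>A\<close> and \<open>B\<close>\<close>
  "biproduct C A B Y \<longleftrightarrow>
     (\<exists>i\<in>Hom C A Y. \<exists>j\<in>Hom C B Y. \<exists>p\<in>Hom C Y A. \<exists>q\<in>Hom C Y B.
        p \<cdot> i = ident C A \<and> q \<cdot> j = ident C B \<and> p \<cdot> j = zeroM C B A \<and> q \<cdot> i = zeroM C A B \<and>
        (i \<cdot> p) \<oplus> (j \<cdot> q) = ident C Y)"
  for C (structure)

definition simple_object :: "('o, 'm, 'k, 'z) ribbon_data_scheme \<Rightarrow> 'o \<Rightarrow> bool" where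
  "simple_object C X \<longleftrightarrow> X \<in> Obj C \<and> \<not> zero_object C X \<and>
     (\<forall>Y\<in>Obj C. \<forall>f. mono_in C Y X f \<longrightarrow> zero_object C Y \<or> iso_in C Y X f)"

inductive sum_of_simples :: "('o, 'm, 'k, 'z) ribbon_data_scheme \<Rightarrow> 'o \<Rightarrow> bool" for C where
  empty: "zero_object C X \<Longrightarrow> sum_of_simples C X"
| add: "\<lbrakk>simple_object C S; sum_of_simples C X; Y \<in> Obj C; biproduct C S X Y\<rbrakk> \<Longrightarrow> sum_of_simples C Y"

inductive_set hom_span :: "('o, 'm, 'k, 'z) ribbon_data_scheme \<Rightarrow> 'o \<Rightarrow> 'o \<Rightarrow> 'm set \<Rightarrow> 'm set"
  for C X Y B where
  zero: "zeroM C X Y \<in> hom_span C X Y B"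
| add: "\<lbrakk>b \<in> B; f \<in> hom_span C X Y B\<rbrakk> \<Longrightarrow> addM C (smulM C a b) f \<in> hom_span C X Y B"

locale linear_category =
  fixes C :: "('o, 'm, 'k::field) ribbon_data" (structure)
  assumes hom_disjoint:
      "\<lbrakk>X \<in> Obj C; Y \<in> Obj C; X' \<in> Obj C; Y' \<in> Obj C; f \<in> Hom C X Y; f \<in> Hom C X' Y'\<rbrakk>
        \<Longrightarrow> X = X' \<and> Y = Y'"
    and ident_hom: "X \<in> Obj C \<Longrightarrow> ident C X \<in> Hom C X X"
    and comp_hom: "\<lbrakk>X \<in> Obj C; Y \<in> Obj C; Z \<in> Obj C; g \<in> Hom C Y Z; f \<in> Hom C X Y\<rbrakk>
        \<Longrightarrow> g \<cdot> f \<in> Hom C X Z"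
    and ident_left: "\<lbrakk>X \<in> Obj C; Y \<in> Obj C; f \<in> Hom C X Y\<rbrakk> \<Longrightarrow> ident C Y \<cdot> f = f"
    and ident_right: "\<lbrakk>X \<in> Obj C; Y \<in> Obj C; f \<in> Hom C X Y\<rbrakk> \<Longrightarrow> f \<cdot> ident C X = f"
    and comp_assoc: "\<lbrakk>W \<in> Obj C; X \<in> Obj C; Y \<in> Obj C; Z \<in> Obj C;
          h \<in> Hom C Y Z; g \<in> Hom C X Y; f \<in> Hom C W X\<rbrakk> \<Longrightarrow> (h \<cdot> g) \<cdot> f = h \<cdot> (g \<cdot> f)"
    and zeroM_hom: "\<lbrakk>X \<in> Obj C; Y \<in> Obj C\<rbrakk> \<Longrightarrow> zeroM C X Y \<in> Hom C X Y"
    and addM_hom: "\<lbrakk>X \<in> Obj C; Y \<in> Obj C; f \<in> Hom C X Y; g \<in> Hom C X Y\<rbrakk> \<Longrightarrow> f \<oplus> g \<in> Hom C X Y"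
    and smulM_hom: "\<lbrakk>X \<in> Obj C; Y \<in> Obj C; f \<in> Hom C X Y\<rbrakk> \<Longrightarrow> a \<odot> f \<in> Hom C X Y"
    and addM_assoc: "\<lbrakk>X \<in> Obj C; Y \<in> Obj C; f \<in> Hom C X Y; g \<in> Hom C X Y; h \<in> Hom C X Y\<rbrakk>
        \<Longrightarrow> (f \<oplus> g) \<oplus> h = f \<oplus> (g \<oplus> h)"
    and addM_comm: "\<lbrakk>X \<in> Obj C; Y \<in> Obj C; f \<in> Hom C X Y; g \<in> Hom C X Y\<rbrakk> \<Longrightarrow> f \<oplus> g = g \<oplus> f"
    and addM_zero: "\<lbrakk>X \<in> Obj C; Y \<in> Obj C; f \<in> Hom C X Y\<rbrakk> \<Longrightarrow> f \<oplus> zeroM C X Y = f"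
    and addM_neg: "\<lbrakk>X \<in> Obj C; Y \<in> Obj C; f \<in> Hom C X Y\<rbrakk> \<Longrightarrow> \<exists>g\<in>Hom C X Y. f \<oplus> g = zeroM C X Y"
    and smulM_addM: "\<lbrakk>X \<in> Obj C; Y \<in> Obj C; f \<in> Hom C X Y; g \<in> Hom C X Y\<rbrakk>
        \<Longrightarrow> a \<odot> (f \<oplus> g) = (a \<odot> f) \<oplus> (a \<odot> g)"
    and smulM_plus: "\<lbrakk>X \<in> Obj C; Y \<in> Obj C; f \<in> Hom C X Y\<rbrakk> \<Longrightarrow> (a + b) \<odot> f = (a \<odot> f) \<oplus> (b \<odot> f)"
    and smulM_times: "\<lbrakk>X \<in> Obj C; Y \<in> Obj C; f \<in> Hom C X Y\<rbrakk> \<Longrightarrow> (a * b) \<odot> f = a \<odot> (b \<odot> f)"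
    and smulM_one: "\<lbrakk>X \<in> Obj C; Y \<in> Obj C; f \<in> Hom C X Y\<rbrakk> \<Longrightarrow> 1 \<odot> f = f"
    and comp_addM_left: "\<lbrakk>X \<in> Obj C; Y \<in> Obj C; Z \<in> Obj C;
          g \<in> Hom C Y Z; g' \<in> Hom C Y Z; f \<in> Hom C X Y\<rbrakk> \<Longrightarrow> (g \<oplus> g') \<cdot> f = (g \<cdot> f) \<oplus> (g' \<cdot> f)"
    and comp_addM_right: "\<lbrakk>X \<in> Obj C; Y \<in> Obj C; Z \<in> Obj C;
          g \<in> Hom C Y Z; f \<in> Hom C X Y; f' \<in> Hom C X Y\<rbrakk> \<Longrightarrow> g \<cdot> (f \<oplus> f') = (g \<cdot> f) \<oplus> (g \<cdot> f')"
    and comp_smulM_left: "\<lbrakk>X \<in> Obj C; Y \<in> Obj C; Z \<in> Obj C; g \<in> Hom C Y Z; f \<in> Hom C X Y\<rbrakk>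
        \<Longrightarrow> (a \<odot> g) \<cdot> f = a \<odot> (g \<cdot> f)"
    and comp_smulM_right: "\<lbrakk>X \<in> Obj C; Y \<in> Obj C; Z \<in> Obj C; g \<in> Hom C Y Z; f \<in> Hom C X Y\<rbrakk>
        \<Longrightarrow> g \<cdot> (a \<odot> f) = a \<odot> (g \<cdot> f)"
    and hom_finite_dim: "\<lbrakk>X \<in> Obj C; Y \<in> Obj C\<rbrakk>
        \<Longrightarrow> \<exists>B. finite B \<and> B \<subseteq> Hom C X Y \<and> hom_span C X Y B = Hom C X Y"

locale semisimple_abelian_category = linear_category +
  assumes ex_zero_object: "\<exists>Z. zero_object C Z"
    and ex_biproduct: "\<lbrakk>X \<in> Obj C; Y \<in> Obj C\<rbrakk> \<Longrightarrow> \<exists>Z\<in>Obj C. biproduct C X Y Z"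
    and ex_kernel: "\<lbrakk>X \<in> Obj C; Y \<in> Obj C; f \<in> Hom C X Y\<rbrakk> \<Longrightarrow> \<exists>K\<in>Obj C. \<exists>u. is_kernel C K X Y u f"
    and ex_cokernel: "\<lbrakk>X \<in> Obj C; Y \<in> Obj C; f \<in> Hom C X Y\<rbrakk> \<Longrightarrow> \<exists>Q\<in>Obj C. \<exists>q. is_cokernel C X Y Q f q"
    and mono_is_kernel: "\<lbrakk>X \<in> Obj C; Y \<in> Obj C; mono_in C X Y f\<rbrakk>
        \<Longrightarrow> \<exists>Z\<in>Obj C. \<exists>g. is_kernel C X Y Z f g"
    and epi_is_cokernel: "\<lbrakk>X \<in> Obj C; Y \<in> Obj C; epi_in C X Y f\<rbrakk>
        \<Longrightarrow> \<exists>W\<in>Obj C. \<exists>g. is_cokernel C W X Y g f"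
    and semisimple: "X \<in> Obj C \<Longrightarrow> sum_of_simples C X"

locale monoidal_linear_category = linear_category +
  assumes tensorO_obj: "\<lbrakk>X \<in> Obj C; Y \<in> Obj C\<rbrakk> \<Longrightarrow> X \<otimes> Y \<in> Obj C"
    and unitO_obj: "\<one> \<in> Obj C"
    and tensorM_hom: "\<lbrakk>X \<in> Obj C; Y \<in> Obj C; X' \<in> Obj C; Y' \<in> Obj C; f \<in> Hom C X Y; g \<in> Hom C X' Y'\<rbrakk>
        \<Longrightarrow> f \<otimes>\<^sub>m g \<in> Hom C (X \<otimes> X') (Y \<otimes> Y')"
    and tensorM_ident: "\<lbrakk>X \<in> Obj C; Y \<in> Obj C\<rbrakk> \<Longrightarrow> ident C X \<otimes>\<^sub>m ident C Y = ident C (X \<otimes> Y)"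
    and tensorM_comp: "\<lbrakk>X \<in> Obj C; Y \<in> Obj C; Z \<in> Obj C; X' \<in> Obj C; Y' \<in> Obj C; Z' \<in> Obj C;
          f \<in> Hom C X Y; g \<in> Hom C Y Z; f' \<in> Hom C X' Y'; g' \<in> Hom C Y' Z'\<rbrakk>
        \<Longrightarrow> (g \<cdot> f) \<otimes>\<^sub>m (g' \<cdot> f') = (g \<otimes>\<^sub>m g') \<cdot> (f \<otimes>\<^sub>m f')"
    and tensorM_addM_left: "\<lbrakk>X \<in> Obj C; Y \<in> Obj C; X' \<in> Obj C; Y' \<in> Obj C;
          f \<in> Hom C X Y; f' \<in> Hom C X Y; g \<in> Hom C X' Y'\<rbrakk>
        \<Longrightarrow> (f \<oplus> f') \<otimes>\<^sub>m g = (f \<otimes>\<^sub>m g) \<oplus> (f' \<otimes>\<^sub>m g)"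
    and tensorM_addM_right: "\<lbrakk>X \<in> Obj C; Y \<in> Obj C; X' \<in> Obj C; Y' \<in> Obj C;
          f \<in> Hom C X Y; g \<in> Hom C X' Y'; g' \<in> Hom C X' Y'\<rbrakk>
        \<Longrightarrow> f \<otimes>\<^sub>m (g \<oplus> g') = (f \<otimes>\<^sub>m g) \<oplus> (f \<otimes>\<^sub>m g')"
    and tensorM_smulM_left: "\<lbrakk>X \<in> Obj C; Y \<in> Obj C; X' \<in> Obj C; Y' \<in> Obj C;
          f \<in> Hom C X Y; g \<in> Hom C X' Y'\<rbrakk> \<Longrightarrow> (a \<odot> f) \<otimes>\<^sub>m g = a \<odot> (f \<otimes>\<^sub>m g)"
    and tensorM_smulM_right: "\<lbrakk>X \<in> Obj C; Y \<in> Obj C; X' \<in> Obj C; Y' \<in> Obj C;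
          f \<in> Hom C X Y; g \<in> Hom C X' Y'\<rbrakk> \<Longrightarrow> f \<otimes>\<^sub>m (a \<odot> g) = a \<odot> (f \<otimes>\<^sub>m g)"
    and assoc_iso: "\<lbrakk>X \<in> Obj C; Y \<in> Obj C; Z \<in> Obj C\<rbrakk>
        \<Longrightarrow> iso_in C ((X \<otimes> Y) \<otimes> Z) (X \<otimes> (Y \<otimes> Z)) (assoc C X Y Z)"
    and assoc_natural: "\<lbrakk>X \<in> Obj C; Y \<in> Obj C; Z \<in> Obj C; X' \<in> Obj C; Y' \<in> Obj C; Z' \<in> Obj C;
          f \<in> Hom C X X'; g \<in> Hom C Y Y'; h \<in> Hom C Z Z'\<rbrakk>
        \<Longrightarrow> assoc C X' Y' Z' \<cdot> ((f \<otimes>\<^sub>m g) \<otimes>\<^sub>m h) = (f \<otimes>\<^sub>m (g \<otimes>\<^sub>m h)) \<cdot> assoc C X Y Z"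
    and lunit_iso: "X \<in> Obj C \<Longrightarrow> iso_in C (\<one> \<otimes> X) X (lunit C X)"
    and lunit_natural: "\<lbrakk>X \<in> Obj C; Y \<in> Obj C; f \<in> Hom C X Y\<rbrakk>
        \<Longrightarrow> lunit C Y \<cdot> (ident C \<one> \<otimes>\<^sub>m f) = f \<cdot> lunit C X"
    and runit_iso: "X \<in> Obj C \<Longrightarrow> iso_in C (X \<otimes> \<one>) X (runit C X)"
    and runit_natural: "\<lbrakk>X \<in> Obj C; Y \<in> Obj C; f \<in> Hom C X Y\<rbrakk>
        \<Longrightarrow> runit C Y \<cdot> (f \<otimes>\<^sub>m ident C \<one>) = f \<cdot> runit C X"
    and pentagon: "\<lbrakk>W \<in> Obj C; X \<in> Obj C; Y \<in> Obj C; Z \<in> Obj C\<rbrakk>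
        \<Longrightarrow> assoc C W X (Y \<otimes> Z) \<cdot> assoc C (W \<otimes> X) Y Z
          = (ident C W \<otimes>\<^sub>m assoc C X Y Z) \<cdot> assoc C W (X \<otimes> Y) Z \<cdot> (assoc C W X Y \<otimes>\<^sub>m ident C Z)"
    and triangle: "\<lbrakk>X \<in> Obj C; Y \<in> Obj C\<rbrakk>
        \<Longrightarrow> (ident C X \<otimes>\<^sub>m lunit C Y) \<cdot> assoc C X \<one> Y = runit C X \<otimes>\<^sub>m ident C Y"

text \<open>
  A fusion category. Finiteness of the set of simple isomorphism classes is not part of this locale;
  it is enforced below, where that set is indexed by a finite type. Only left duals are
  postulated; in the presence of a braiding they are right duals as well.
\<close>
locale fusion_category = semisimple_abelian_category + monoidal_linear_category +
  assumes end_unit: "Hom C \<one> \<one> = range (\<lambda>a. a \<odot> ident C \<one>)"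
    and unit_nonzero: "\<not> zero_object C \<one>"
    and dual_obj: "X \<in> Obj C \<Longrightarrow> dual C X \<in> Obj C"
    and ev_hom: "X \<in> Obj C \<Longrightarrow> ev C X \<in> Hom C (dual C X \<otimes> X) \<one>"
    and coev_hom: "X \<in> Obj C \<Longrightarrow> coev C X \<in> Hom C \<one> (X \<otimes> dual C X)"
    and zigzag: "X \<in> Obj C \<Longrightarrow>
        runit C X \<cdot> (ident C X \<otimes>\<^sub>m ev C X) \<cdot> assoc C X (dual C X) X \<cdot> (coev C X \<otimes>\<^sub>m ident C X)
          \<cdot> inv_mor C (lunit C X) = ident C X"
    and zigzag_dual: "X \<in> Obj C \<Longrightarrow>
        lunit C (dual C X) \<cdot> (ev C X \<otimes>\<^sub>m ident C (dual C X)) \<cdot> inv_mor C (assoc C (dual C X) X (dual C X))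
          \<cdot> (ident C (dual C X) \<otimes>\<^sub>m coev C X) \<cdot> inv_mor C (runit C (dual C X)) = ident C (dual C X)"

text \<open>
  The two hexagon axioms, the balancing axiom for the twist, and self-duality of the twist in the form
  \<open>(\<theta>\<^sub>X \<otimes> id) \<cdot> coev\<^sub>X = (id \<otimes> \<theta>\<^bsub>X\<^sup>*\<^esub>) \<cdot> coev\<^sub>X\<close>, which says that \<open>\<theta>\<^bsub>X\<^sup>*\<^esub>\<close> is the dual morphism of \<open>\<theta>\<^sub>X\<close>.
\<close>
locale ribbon_fusion_category = fusion_category +
  assumes braid_iso: "\<lbrakk>X \<in> Obj C; Y \<in> Obj C\<rbrakk> \<Longrightarrow> iso_in C (X \<otimes> Y) (Y \<otimes> X) (braid C X Y)"
    and braid_natural: "\<lbrakk>X \<in> Obj C; Y \<in> Obj C; X' \<in> Obj C; Y' \<in> Obj C; f \<in> Hom C X X'; g \<in> Hom C Y Y'\<rbrakk>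
        \<Longrightarrow> braid C X' Y' \<cdot> (f \<otimes>\<^sub>m g) = (g \<otimes>\<^sub>m f) \<cdot> braid C X Y"
    and hexagon1: "\<lbrakk>X \<in> Obj C; Y \<in> Obj C; Z \<in> Obj C\<rbrakk>
        \<Longrightarrow> assoc C Y Z X \<cdot> braid C X (Y \<otimes> Z) \<cdot> assoc C X Y Z
          = (ident C Y \<otimes>\<^sub>m braid C X Z) \<cdot> assoc C Y X Z \<cdot> (braid C X Y \<otimes>\<^sub>m ident C Z)"
    and hexagon2: "\<lbrakk>X \<in> Obj C; Y \<in> Obj C; Z \<in> Obj C\<rbrakk>
        \<Longrightarrow> inv_mor C (assoc C Z X Y) \<cdot> braid C (X \<otimes> Y) Z \<cdot> inv_mor C (assoc C X Y Z)
          = (braid C X Z \<otimes>\<^sub>m ident C Y) \<cdot> inv_mor C (assoc C X Z Y) \<cdot> (ident C X \<otimes>\<^sub>m braid C Y Z)"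
    and twist_iso: "X \<in> Obj C \<Longrightarrow> iso_in C X X (twist C X)"
    and twist_natural: "\<lbrakk>X \<in> Obj C; Y \<in> Obj C; f \<in> Hom C X Y\<rbrakk> \<Longrightarrow> twist C Y \<cdot> f = f \<cdot> twist C X"
    and twist_tensor: "\<lbrakk>X \<in> Obj C; Y \<in> Obj C\<rbrakk>
        \<Longrightarrow> twist C (X \<otimes> Y) = braid C Y X \<cdot> braid C X Y \<cdot> (twist C X \<otimes>\<^sub>m twist C Y)"
    and twist_dual: "X \<in> Obj C \<Longrightarrow>
        (twist C X \<otimes>\<^sub>m ident C (dual C X)) \<cdot> coev C X = (ident C X \<otimes>\<^sub>m twist C (dual C X)) \<cdot> coev C X"


section \<open>Trace, S-matrix and modularity\<close>

definition end_unit_scalar :: "('o, 'm, 'k::field, 'z) ribbon_data_scheme \<Rightarrow> 'm \<Rightarrow> 'k" where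
  "end_unit_scalar C f = (THE a. f = smulM C a (ident C (unitO C)))"

text \<open>
  The canonical (spherical) trace of a ribbon category,
  \<open>tr\<^sub>X(f) = ev\<^sub>X \<cdot> c\<^bsub>X, X\<^sup>*\<^esub> \<cdot> ((\<theta>\<^sub>X \<cdot> f) \<otimes> id) \<cdot> coev\<^sub>X\<close>, with \<open>End(\<one>)\<close> identified with the ground field.
\<close>
definition qtrace :: "('o, 'm, 'k::field, 'z) ribbon_data_scheme \<Rightarrow> 'o \<Rightarrow> 'm \<Rightarrow> 'k" where
  "qtrace C X f = end_unit_scalar C
     (ev C X \<cdot> braid C X (dual C X) \<cdot> ((twist C X \<cdot> f) \<otimes>\<^sub>m ident C (dual C X)) \<cdot> coev C X)"
  for C (structure)

definition S_matrix :: "('o, 'm, 'k::field, 'z) ribbon_data_scheme \<Rightarrow> ('i \<Rightarrow> 'o) \<Rightarrow> 'k^'i^'i" where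
  "S_matrix C V = (\<chi> i j. qtrace C (V i \<otimes> V j) (braid C (V j) (V i) \<cdot> braid C (V i) (V j)))"
  for C (structure)

text \<open>
  The finite type \<open>'i\<close> indexes the isomorphism classes of simple objects, with representatives \<open>V i\<close>;
  \<open>i0\<close> is the index of the unit object.
\<close>
locale modular_category = ribbon_fusion_category C
  for C :: "('o, 'm, 'k::field) ribbon_data" (structure) +
  fixes V :: "'i::finite \<Rightarrow> 'o" and i0 :: 'i
  assumes V_simple: "simple_object C (V i)"
    and V_representatives: "simple_object C X \<Longrightarrow> \<exists>!i. isomorphic C X (V i)"
    and V_unit: "V i0 = \<one>"
    and S_invertible: "invertible (S_matrix C V)"

definition quantum_dim :: "('o, 'm, 'k::field, 'z) ribbon_data_scheme \<Rightarrow> ('i::finite \<Rightarrow> 'o) \<Rightarrow> 'i \<Rightarrow> 'i \<Rightarrow> 'k" where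
  "quantum_dim C V i0 i = S_matrix C V $ i0 $ i"

definition A_matrix :: "('o, 'm, 'k::field, 'z) ribbon_data_scheme \<Rightarrow> ('i::finite \<Rightarrow> 'o) \<Rightarrow> 'i \<Rightarrow> 'k^'i^'i" where
  "A_matrix C V i0 =
     (\<chi> i j. S_matrix C V $ i $ j / (quantum_dim C V i0 i * quantum_dim C V i0 j))"

definition invertible_object :: "('o, 'm, 'k, 'z) ribbon_data_scheme \<Rightarrow> 'o \<Rightarrow> bool" where
  "invertible_object C X \<longleftrightarrow> X \<in> Obj C \<and>
     (\<exists>Y\<in>Obj C. isomorphic C (X \<otimes> Y) \<one> \<and> isomorphic C (Y \<otimes> X) \<one>)"
  for C (structure)

definition pointed :: "('o, 'm, 'k, 'z) ribbon_data_scheme \<Rightarrow> bool" where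
  "pointed C \<longleftrightarrow> (\<forall>X. simple_object C X \<longrightarrow> invertible_object C X)"

end

theory Submission
  imports Defs "HOL-Library.Function_Algebras"
begin

text \<open>
  Closing a loop coloured \<open>X\<close> around a strand coloured \<open>V i\<close> is multiplication by a scalar \<open>\<chi>\<^sub>i(X)\<close>. These scalars are
  multiplicative in \<open>X\<close>, additive and isomorphism invariant, and \<open>S\<^sub>i\<^sub>j = \<chi>\<^sub>i(V\<^sub>j) d\<^sub>i\<close>; so, \<open>S\<close> being symmetric and
  invertible, \<open>A\<^sub>i\<^sub>j = \<chi>\<^sub>i(V\<^sub>j) / d\<^sub>j\<close> and the class of \<open>X\<close> in the Grothendieck ring is determined by the \<open>\<chi>\<^sub>i(X)\<close>.

  Row and column \<open>i0\<close> of \<open>A\<close> are constant, so if the \<open>r\<close>-th Hadamard power is block-rank-one, it is constant and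
  \<open>\<chi>\<^sub>i(V\<^sub>j)\<^sup>r\<close> does not depend on \<open>i\<close>. Choose \<open>k\<close> such that \<open>\<one>\<close> occurs exactly once in \<open>V j \<otimes> V k\<close>. The \<open>r\<close>-th power of
  \<open>V j \<otimes> V k\<close> has constant characters, hence is a multiple of \<open>\<one>\<close>; it contains every constituent of
  \<open>V j \<otimes> V k\<close>, which is therefore \<open>\<one>\<close>. Conversely, in a pointed category the simple classes form a finite
  group, so all \<open>\<chi>\<^sub>i(V\<^sub>j)\<close> are roots of unity of a common order.
\<close>

section \<open>Partial traces in a strict ribbon category\<close>

text \<open>Moving loops around strands needs many identities between morphisms of long tensor
  products, and with explicit associators each would carry its own coherence argument. Traces are
  therefore computed in an abstract strict ribbon category whose objects are lists; a
  strictification of the given category is shown to be an instance. Duals are a relation there, so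
  that a trace can be computed with any dual; this compares the dual of \<open>X \<otimes> Y\<close>
  with the product of the duals of \<open>X\<close> and \<open>Y\<close>. Algebraic closedness
  enters through Schur's lemma, which makes a loop act by a scalar, and characteristic zero through
  the recovery of multiplicities from their images in the field. The index \<open>k\<close> comes
  from counting the unit in \<open>V j \<otimes> dual C (V j)\<close>: the count is one, so exactly
  one simple constituent of the dual accounts for it, whether or not the dual is known to be simple.
  Multiplying by a class that contains the unit can only enlarge a class, which is why constituents
  survive in powers; that the unit occurs exactly once then identifies
  \<open>V j \<otimes> V k\<close> with the unit itself and not merely with a multiple of
  it.\<close>

locale strict_ribbon_category =
  fixes ob :: "'o list \<Rightarrow> bool" and arr :: "'a \<Rightarrow> bool"
    and src :: "'a \<Rightarrow> 'o list" and tgt :: "'a \<Rightarrow> 'o list"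
    and I :: "'o list \<Rightarrow> 'a"
    and cmp :: "'a \<Rightarrow> 'a \<Rightarrow> 'a"  (infixr \<open>\<triangleleft>\<close> 55)
    and tns :: "'a \<Rightarrow> 'a \<Rightarrow> 'a"  (infixr \<open>\<star>\<close> 60)
    and add :: "'a \<Rightarrow> 'a \<Rightarrow> 'a"
    and smul :: "'k::field \<Rightarrow> 'a \<Rightarrow> 'a"
    and br :: "'o list \<Rightarrow> 'o list \<Rightarrow> 'a" and tw :: "'o list \<Rightarrow> 'a"
  assumes ob_Nil [simp]: "ob []" and ob_append [simp]: "ob (l @ m) \<longleftrightarrow> ob l \<and> ob m"
    and ob_src [simp]: "arr f \<Longrightarrow> ob (src f)" and ob_tgt [simp]: "arr f \<Longrightarrow> ob (tgt f)"
    and src_I [simp]: "src (I l) = l" and tgt_I [simp]: "tgt (I l) = l"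
    and arr_I [simp]: "ob l \<Longrightarrow> arr (I l)"
    and src_cmp [simp]: "src (g \<triangleleft> f) = src f" and tgt_cmp [simp]: "tgt (g \<triangleleft> f) = tgt g"
    and arr_cmp [simp]: "\<lbrakk>arr g; arr f; src g = tgt f\<rbrakk> \<Longrightarrow> arr (g \<triangleleft> f)"
    and src_tns [simp]: "src (f \<star> g) = src f @ src g" and tgt_tns [simp]: "tgt (f \<star> g) = tgt f @ tgt g"
    and arr_tns [simp]: "\<lbrakk>arr f; arr g\<rbrakk> \<Longrightarrow> arr (f \<star> g)"
    and src_add [simp]: "src (add f g) = src f" and tgt_add [simp]: "tgt (add f g) = tgt f"
    and arr_add [simp]: "\<lbrakk>arr f; arr g; src f = src g; tgt f = tgt g\<rbrakk> \<Longrightarrow> arr (add f g)"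
    and src_smul [simp]: "src (smul a f) = src f" and tgt_smul [simp]: "tgt (smul a f) = tgt f"
    and arr_smul [simp]: "arr f \<Longrightarrow> arr (smul a f)"
    and src_br [simp]: "src (br l m) = l @ m" and tgt_br [simp]: "tgt (br l m) = m @ l"
    and arr_br [simp]: "\<lbrakk>ob l; ob m\<rbrakk> \<Longrightarrow> arr (br l m)"
    and src_tw [simp]: "src (tw l) = l" and tgt_tw [simp]: "tgt (tw l) = l"
    and arr_tw [simp]: "ob l \<Longrightarrow> arr (tw l)"
    and cmp_I_left [simp]: "\<lbrakk>arr f; l = tgt f\<rbrakk> \<Longrightarrow> I l \<triangleleft> f = f"
    and cmp_I_right [simp]: "\<lbrakk>arr f; l = src f\<rbrakk> \<Longrightarrow> f \<triangleleft> I l = f"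
    and cmp_assoc [simp]: "\<lbrakk>arr h; arr g; arr f; src h = tgt g; src g = tgt f\<rbrakk>
          \<Longrightarrow> (h \<triangleleft> g) \<triangleleft> f = h \<triangleleft> (g \<triangleleft> f)"
    and tns_I [simp]: "\<lbrakk>ob l; ob m\<rbrakk> \<Longrightarrow> I (l @ m) = I l \<star> I m"
    and tns_unit_left [simp]: "arr f \<Longrightarrow> I [] \<star> f = f"
    and tns_unit_right [simp]: "arr f \<Longrightarrow> f \<star> I [] = f"
    and tns_assoc [simp]: "\<lbrakk>arr f; arr g; arr h\<rbrakk> \<Longrightarrow> (f \<star> g) \<star> h = f \<star> (g \<star> h)"
    and interchange: "\<lbrakk>arr f; arr g; arr f'; arr g'; src g = tgt f; src g' = tgt f'\<rbrakk>
          \<Longrightarrow> (g \<star> g') \<triangleleft> (f \<star> f') = (g \<triangleleft> f) \<star> (g' \<triangleleft> f')"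
    and add_cmp: "\<lbrakk>arr g; arr g'; arr f; src g = tgt f; src g' = tgt f; tgt g = tgt g'\<rbrakk>
          \<Longrightarrow> add g g' \<triangleleft> f = add (g \<triangleleft> f) (g' \<triangleleft> f)"
    and cmp_add: "\<lbrakk>arr g; arr f; arr f'; src g = tgt f; src g = tgt f'; src f = src f'\<rbrakk>
          \<Longrightarrow> g \<triangleleft> add f f' = add (g \<triangleleft> f) (g \<triangleleft> f')"
    and add_tns: "\<lbrakk>arr g; arr g'; arr f; src g = src g'; tgt g = tgt g'\<rbrakk>
          \<Longrightarrow> add g g' \<star> f = add (g \<star> f) (g' \<star> f)"
    and tns_add: "\<lbrakk>arr g; arr g'; arr f; src g = src g'; tgt g = tgt g'\<rbrakk>
          \<Longrightarrow> f \<star> add g g' = add (f \<star> g) (f \<star> g')"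
    and smul_cmp: "\<lbrakk>arr g; arr f; src g = tgt f\<rbrakk> \<Longrightarrow> smul a g \<triangleleft> f = smul a (g \<triangleleft> f)"
    and cmp_smul: "\<lbrakk>arr g; arr f; src g = tgt f\<rbrakk> \<Longrightarrow> g \<triangleleft> smul a f = smul a (g \<triangleleft> f)"
    and smul_tns: "\<lbrakk>arr g; arr f\<rbrakk> \<Longrightarrow> smul a g \<star> f = smul a (g \<star> f)"
    and tns_smul: "\<lbrakk>arr g; arr f\<rbrakk> \<Longrightarrow> g \<star> smul a f = smul a (g \<star> f)"
    and br_iso: "\<lbrakk>ob l; ob m\<rbrakk> \<Longrightarrow> \<exists>g. arr g \<and> src g = m @ l \<and> tgt g = l @ m \<and> g \<triangleleft> br l m = I (l @ m)"
    and br_natural: "\<lbrakk>arr f; arr g; src f = l; src g = m; tgt f = l'; tgt g = m'\<rbrakk>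
          \<Longrightarrow> br l' m' \<triangleleft> (f \<star> g) = (g \<star> f) \<triangleleft> br l m"
    and br_append_right: "\<lbrakk>ob l; ob m; ob n\<rbrakk> \<Longrightarrow> br l (m @ n) = (I m \<star> br l n) \<triangleleft> (br l m \<star> I n)"
    and br_append_left: "\<lbrakk>ob l; ob m; ob n\<rbrakk> \<Longrightarrow> br (l @ m) n = (br l n \<star> I m) \<triangleleft> (I l \<star> br m n)"
    and tw_natural: "\<lbrakk>arr f; src f = l; tgt f = m\<rbrakk> \<Longrightarrow> tw m \<triangleleft> f = f \<triangleleft> tw l"
    and tw_append: "\<lbrakk>ob l; ob m\<rbrakk> \<Longrightarrow> tw (l @ m) = br m l \<triangleleft> br l m \<triangleleft> (tw l \<star> tw m)"
begin

lemma cmp_II_left [simp]: "\<lbrakk>arr f; tgt f = l @ m; ob l; ob m\<rbrakk> \<Longrightarrow> (I l \<star> I m) \<triangleleft> f = f"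
  using cmp_I_left[of f "l @ m"] by simp

lemma left_whisker: "\<lbrakk>ob l; arr g; arr f; src g = tgt f\<rbrakk> \<Longrightarrow> I l \<star> (g \<triangleleft> f) = (I l \<star> g) \<triangleleft> (I l \<star> f)"
  by (simp add: interchange)

lemma right_whisker: "\<lbrakk>ob l; arr g; arr f; src g = tgt f\<rbrakk> \<Longrightarrow> (g \<triangleleft> f) \<star> I l = (g \<star> I l) \<triangleleft> (f \<star> I l)"
  by (simp add: interchange)

text \<open>The case of \<open>I (l @ m)\<close> with the identity already split, as simplification
  by \<open>tns_I\<close> leaves it.\<close>

lemma right_whisker_append: "\<lbrakk>ob l; ob m; arr g; arr f; src g = tgt f\<rbrakk>
    \<Longrightarrow> (g \<triangleleft> f) \<star> I l \<star> I m = (g \<star> I l \<star> I m) \<triangleleft> (f \<star> I l \<star> I m)"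
  using right_whisker[of "l @ m" g f] by simp

text \<open>Both sides are \<open>f \<star> g\<close>: morphisms on disjoint strands pass each
  other.\<close>

lemma slide: "\<lbrakk>arr f; arr g; src f = l; src g = m; tgt f = l'; tgt g = m'\<rbrakk>
    \<Longrightarrow> (I l' \<star> g) \<triangleleft> (f \<star> I m) = (f \<star> I m') \<triangleleft> (I l \<star> g)"
  using interchange[of f "I l'" "I m" g] interchange[of "I l" f g "I m'"] by auto

text \<open>The hexagon for empty lists makes \<open>br [] l\<close> idempotent, and an idempotent
  with a left inverse is an identity.\<close>

lemma br_unit_left [simp]: assumes "ob l" shows "br [] l = I l"
proof -
  obtain g where g: "arr g" "src g = l" "tgt g = l" "g \<triangleleft> br [] l = I l"
    using br_iso[of "[]" l] assms by auto
  have "br [] l = br [] l \<triangleleft> br [] l"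
    using br_append_left[of "[]" "[]" l] assms by simp
  then have "g \<triangleleft> br [] l = (g \<triangleleft> br [] l) \<triangleleft> br [] l"
    using assms g(1-3) by simp
  then show ?thesis unfolding g(4) using assms by simp
qed

lemma br_unit_right [simp]: assumes "ob l" shows "br l [] = I l"
proof -
  obtain g where g: "arr g" "src g = l" "tgt g = l" "g \<triangleleft> br l [] = I l"
    using br_iso[of l "[]"] assms by auto
  have "br l [] = br l [] \<triangleleft> br l []"
    using br_append_right[of l "[]" "[]"] assms by simp
  then have "g \<triangleleft> br l [] = (g \<triangleleft> br l []) \<triangleleft> br l []"
    using assms g(1-3) by simp
  then show ?thesis unfolding g(4) using assms by simp
qed

section \<open>Duals, transposed morphisms and closures of strands\<close>

definition dual_pair :: "'o list \<Rightarrow> 'o list \<Rightarrow> 'a \<Rightarrow> 'a \<Rightarrow> bool" where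
  "dual_pair l d e h \<longleftrightarrow> ob l \<and> ob d \<and> arr e \<and> arr h \<and>
     src e = d @ l \<and> tgt e = [] \<and> src h = [] \<and> tgt h = l @ d \<and>
     (I l \<star> e) \<triangleleft> (h \<star> I l) = I l \<and> (e \<star> I d) \<triangleleft> (I d \<star> h) = I d"

lemma dual_pairD:
  assumes "dual_pair l d e h"
  shows "ob l" "ob d" "arr e" "arr h" "src e = d @ l" "tgt e = []" "src h = []" "tgt h = l @ d"
    "(I l \<star> e) \<triangleleft> (h \<star> I l) = I l" "(e \<star> I d) \<triangleleft> (I d \<star> h) = I d"
  using assms by (auto simp: dual_pair_def)

text \<open>The witness is the transpose of \<open>g\<close>, obtained by bending both of its legs.
  Straightening the bend of \<open>l'\<close> gives the first equation, straightening that of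
  \<open>l\<close> the second.\<close>

lemma dual_arrow:
  assumes "dual_pair l d e h" "dual_pair l' d' e' h'" "arr g" "src g = l'" "tgt g = l"
  obtains gs where "arr gs" "src gs = d" "tgt gs = d'"
    "e' \<triangleleft> (gs \<star> I l') = e \<triangleleft> (I d \<star> g)" "(I l \<star> gs) \<triangleleft> h = (g \<star> I d') \<triangleleft> h'"
proof -
  note D = dual_pairD(1-8)[OF assms(1)] dual_pairD(1-8)[OF assms(2)] assms(3-5)
  define gs where "gs = (e \<star> I d') \<triangleleft> (I d \<star> g \<star> I d') \<triangleleft> (I d \<star> h')"
  have "e' \<triangleleft> (gs \<star> I l') = e' \<triangleleft> (e \<star> I d' \<star> I l') \<triangleleft> (I d \<star> g \<star> I d' \<star> I l') \<triangleleft> (I d \<star> h' \<star> I l')"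
    using D by (simp add: gs_def right_whisker right_whisker_append)
  also have "\<dots> = (e' \<triangleleft> (e \<star> I d' \<star> I l')) \<triangleleft> (I d \<star> g \<star> I d' \<star> I l') \<triangleleft> (I d \<star> h' \<star> I l')"
    using D by simp
  \<comment> \<open>Two evaluations on disjoint strands may be done in either order; this brings
    \<open>e'\<close> next to \<open>h'\<close>.\<close>
  also have "e' \<triangleleft> (e \<star> I d' \<star> I l') = e \<triangleleft> (I d \<star> I l \<star> e')"
    using slide[of e e' "d @ l" "d' @ l'" "[]" "[]"] D by simp
  also have "(e \<triangleleft> (I d \<star> I l \<star> e')) \<triangleleft> (I d \<star> g \<star> I d' \<star> I l') \<triangleleft> (I d \<star> h' \<star> I l')
      = e \<triangleleft> (I d \<star> ((I l \<star> e') \<triangleleft> (g \<star> I (d' @ l')) \<triangleleft> (h' \<star> I l')))"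
    using D by (simp add: left_whisker)
  also have "(I l \<star> e') \<triangleleft> (g \<star> I (d' @ l')) \<triangleleft> (h' \<star> I l')
      = ((I l \<star> e') \<triangleleft> (g \<star> I (d' @ l'))) \<triangleleft> (h' \<star> I l')"
    using D by simp
  also have "\<dots> = ((g \<star> I []) \<triangleleft> (I l' \<star> e')) \<triangleleft> (h' \<star> I l')"
    using slide[of g e' l' "d' @ l'" l "[]"] D by simp
  also have "\<dots> = g \<triangleleft> ((I l' \<star> e') \<triangleleft> (h' \<star> I l'))"
    using D by simp
  also have "\<dots> = g"
    unfolding dual_pairD(9)[OF assms(2)] using D by simp
  finally have 1: "e' \<triangleleft> (gs \<star> I l') = e \<triangleleft> (I d \<star> g)" .
  have "(I l \<star> gs) \<triangleleft> h = (I l \<star> e \<star> I d') \<triangleleft> (I l \<star> I d \<star> g \<star> I d') \<triangleleft> (I l \<star> I d \<star> h') \<triangleleft> h"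
    using D by (simp add: gs_def left_whisker)
  also have "(I l \<star> I d \<star> h') \<triangleleft> h = (h \<star> I l' \<star> I d') \<triangleleft> h'"
    using slide[of h h' "[]" "[]" "l @ d" "l' @ d'"] D by simp
  also have "(I l \<star> e \<star> I d') \<triangleleft> (I l \<star> I d \<star> g \<star> I d') \<triangleleft> (h \<star> I l' \<star> I d') \<triangleleft> h'
      = (I l \<star> e \<star> I d') \<triangleleft> ((I (l @ d) \<star> (g \<star> I d')) \<triangleleft> (h \<star> I (l' @ d'))) \<triangleleft> h'"
    using D by simp
  also have "(I (l @ d) \<star> (g \<star> I d')) \<triangleleft> (h \<star> I (l' @ d')) = (h \<star> I (l @ d')) \<triangleleft> (I [] \<star> g \<star> I d')"
    using slide[of h "g \<star> I d'" "[]" "l' @ d'" "l @ d" "l @ d'"] D by simp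
  also have "(I l \<star> e \<star> I d') \<triangleleft> ((h \<star> I (l @ d')) \<triangleleft> (I [] \<star> g \<star> I d')) \<triangleleft> h'
      = (((I l \<star> e) \<triangleleft> (h \<star> I l)) \<star> I d') \<triangleleft> (g \<star> I d') \<triangleleft> h'"
    using D by (simp add: right_whisker right_whisker_append)
  also have "\<dots> = (g \<star> I d') \<triangleleft> h'"
    unfolding dual_pairD(9)[OF assms(1)] using D by simp
  finally have 2: "(I l \<star> gs) \<triangleleft> h = (g \<star> I d') \<triangleleft> h'" .
  show thesis
    by (rule that[OF _ _ _ 1 2]) (use D in \<open>auto simp: gs_def\<close>)
qed

text \<open>
  The evaluation \<open>l \<otimes> d \<rightarrow> \<one>\<close> from the other side, obtained from \<open>e\<close> by braiding and twisting; closing a strand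
  with it gives the spherical (partial) trace.
\<close>
definition eps :: "'o list \<Rightarrow> 'o list \<Rightarrow> 'a \<Rightarrow> 'a" where
  "eps l d e = e \<triangleleft> br l d \<triangleleft> (tw l \<star> I d)"

lemma eps_type:
  assumes "dual_pair l d e h"
  shows "arr (eps l d e)" "src (eps l d e) = l @ d" "tgt (eps l d e) = []"
  using dual_pairD[OF assms] by (auto simp: eps_def)

text \<open>Closes the last strand \<open>l\<close> of \<open>F : m @ l \<rightarrow> n @ l\<close>
  into a loop on the right. With \<open>m\<close> and \<open>n\<close> empty this is the spherical
  trace.\<close>

definition ptr :: "'o list \<Rightarrow> 'o list \<Rightarrow> 'o list \<Rightarrow> 'o list \<Rightarrow> 'a \<Rightarrow> 'a \<Rightarrow> 'a \<Rightarrow> 'a" where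
  "ptr m n l d e h F = (I n \<star> eps l d e) \<triangleleft> (F \<star> I d) \<triangleleft> (I m \<star> h)"

text \<open>Braiding and twist are natural, so the transpose passes through the cap on the other
  side as well.\<close>

lemma eps_slide:
  assumes "dual_pair l d e h" "dual_pair l' d' e' h'" "arr g" "src g = l'" "tgt g = l"
    and gs: "arr gs" "src gs = d" "tgt gs = d'" "e' \<triangleleft> (gs \<star> I l') = e \<triangleleft> (I d \<star> g)"
  shows "eps l d e \<triangleleft> (g \<star> I d) = eps l' d' e' \<triangleleft> (I l' \<star> gs)"
proof -
  note D = dual_pairD(1-8)[OF assms(1)] dual_pairD(1-8)[OF assms(2)] assms(3-5) gs(1-3)
  have "eps l d e \<triangleleft> (g \<star> I d) = e \<triangleleft> br l d \<triangleleft> ((tw l \<triangleleft> g) \<star> I d)"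
    using D by (simp add: eps_def right_whisker right_whisker_append)
  also have "tw l \<triangleleft> g = g \<triangleleft> tw l'" using D by (intro tw_natural) auto
  also have "e \<triangleleft> br l d \<triangleleft> ((g \<triangleleft> tw l') \<star> I d) = e \<triangleleft> (br l d \<triangleleft> (g \<star> I d)) \<triangleleft> (tw l' \<star> I d)"
    using D by (simp add: right_whisker right_whisker_append)
  also have "br l d \<triangleleft> (g \<star> I d) = (I d \<star> g) \<triangleleft> br l' d"
    using D by (intro br_natural) auto
  also have "e \<triangleleft> ((I d \<star> g) \<triangleleft> br l' d) \<triangleleft> (tw l' \<star> I d) = (e \<triangleleft> (I d \<star> g)) \<triangleleft> br l' d \<triangleleft> (tw l' \<star> I d)"
    using D by simp
  also have "\<dots> = (e' \<triangleleft> (gs \<star> I l')) \<triangleleft> br l' d \<triangleleft> (tw l' \<star> I d)"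
    using gs by simp
  also have "\<dots> = e' \<triangleleft> ((gs \<star> I l') \<triangleleft> br l' d) \<triangleleft> (tw l' \<star> I d)"
    using D by simp
  also have "(gs \<star> I l') \<triangleleft> br l' d = br l' d' \<triangleleft> (I l' \<star> gs)"
    using D by (intro br_natural[symmetric]) auto
  also have "e' \<triangleleft> (br l' d' \<triangleleft> (I l' \<star> gs)) \<triangleleft> (tw l' \<star> I d) = e' \<triangleleft> br l' d' \<triangleleft> ((I l' \<star> gs) \<triangleleft> (tw l' \<star> I d))"
    using D by simp
  also have "(I l' \<star> gs) \<triangleleft> (tw l' \<star> I d) = (tw l' \<star> I d') \<triangleleft> (I l' \<star> gs)"
    using D by (intro slide) auto
  finally show ?thesis using D by (simp add: eps_def)
qed

text \<open>With \<open>g = I l\<close> this says that the trace does not depend on the chosen dual.\<close>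
lemma ptr_cyclic:
  assumes "dual_pair l d e h" "dual_pair l' d' e' h'" "arr g" "src g = l'" "tgt g = l"
    and F: "arr F" "src F = m @ l" "tgt F = n @ l'" "ob m" "ob n"
  shows "ptr m n l d e h ((I n \<star> g) \<triangleleft> F) = ptr m n l' d' e' h' (F \<triangleleft> (I m \<star> g))"
proof -
  obtain gs where gs: "arr gs" "src gs = d" "tgt gs = d'"
    "e' \<triangleleft> (gs \<star> I l') = e \<triangleleft> (I d \<star> g)" "(I l \<star> gs) \<triangleleft> h = (g \<star> I d') \<triangleleft> h'"
    using dual_arrow[OF assms(1-5)] by blast
  note D = dual_pairD(1-8)[OF assms(1)] dual_pairD(1-8)[OF assms(2)] assms(3-5) gs(1-3) F
    eps_type[OF assms(1)] eps_type[OF assms(2)]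
  have "ptr m n l d e h ((I n \<star> g) \<triangleleft> F) = (I n \<star> (eps l d e \<triangleleft> (g \<star> I d))) \<triangleleft> (F \<star> I d) \<triangleleft> (I m \<star> h)"
    using D by (simp add: ptr_def right_whisker left_whisker)
  also have "eps l d e \<triangleleft> (g \<star> I d) = eps l' d' e' \<triangleleft> (I l' \<star> gs)"
    by (rule eps_slide[OF assms(1-5) gs(1-4)])
  also have "(I n \<star> (eps l' d' e' \<triangleleft> (I l' \<star> gs))) \<triangleleft> (F \<star> I d) \<triangleleft> (I m \<star> h)
    = (I n \<star> eps l' d' e') \<triangleleft> ((I (n @ l') \<star> gs) \<triangleleft> (F \<star> I d)) \<triangleleft> (I m \<star> h)"
    using D by (simp add: left_whisker)
  \<comment> \<open>The transpose sits on the returning strand, so it can be pulled past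
    \<open>F\<close> from the cap to the cup, where it turns into \<open>g\<close> again.\<close>
  also have "(I (n @ l') \<star> gs) \<triangleleft> (F \<star> I d) = (F \<star> I d') \<triangleleft> (I (m @ l) \<star> gs)"
    using D by (intro slide) auto
  also have "(I n \<star> eps l' d' e') \<triangleleft> ((F \<star> I d') \<triangleleft> (I (m @ l) \<star> gs)) \<triangleleft> (I m \<star> h)
    = (I n \<star> eps l' d' e') \<triangleleft> (F \<star> I d') \<triangleleft> (I m \<star> ((I l \<star> gs) \<triangleleft> h))"
    using D by (simp add: left_whisker)
  also have "\<dots> = ptr m n l' d' e' h' (F \<triangleleft> (I m \<star> g))"
    unfolding gs(5) using D by (simp add: ptr_def right_whisker left_whisker)
  finally show ?thesis .
qed

text \<open>Cups and caps are nested, hence the reversed order of the duals. Sliding the inner cap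
  or cup aside separates the two zigzags, which are then straightened one by one.\<close>

lemma dual_pair_append:
  assumes "dual_pair l1 d1 e1 h1" "dual_pair l2 d2 e2 h2"
  shows "dual_pair (l1 @ l2) (d2 @ d1) (e2 \<triangleleft> (I d2 \<star> e1 \<star> I l2)) ((I l1 \<star> h2 \<star> I d1) \<triangleleft> h1)"
proof -
  note D = dual_pairD(1-8)[OF assms(1)] dual_pairD(1-8)[OF assms(2)]
  note Z1 = dual_pairD(9,10)[OF assms(1)] and Z2 = dual_pairD(9,10)[OF assms(2)]
  have "(I (l1 @ l2) \<star> (e2 \<triangleleft> (I d2 \<star> e1 \<star> I l2))) \<triangleleft> (((I l1 \<star> h2 \<star> I d1) \<triangleleft> h1) \<star> I (l1 @ l2))
     = (I l1 \<star> I l2 \<star> e2) \<triangleleft> (I l1 \<star> ((I (l2 @ d2) \<star> (e1 \<star> I l2)) \<triangleleft> (h2 \<star> I (d1 @ l1 @ l2)))) \<triangleleft> (h1 \<star> I l1 \<star> I l2)"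
    using D by (simp add: left_whisker right_whisker right_whisker_append)
  also have "(I (l2 @ d2) \<star> (e1 \<star> I l2)) \<triangleleft> (h2 \<star> I (d1 @ l1 @ l2)) = (h2 \<star> I l2) \<triangleleft> (I [] \<star> e1 \<star> I l2)"
    using slide[of h2 "e1 \<star> I l2" "[]" "d1 @ l1 @ l2" "l2 @ d2" "l2"] D by simp
  also have "(I l1 \<star> I l2 \<star> e2) \<triangleleft> (I l1 \<star> ((h2 \<star> I l2) \<triangleleft> (I [] \<star> e1 \<star> I l2))) \<triangleleft> (h1 \<star> I l1 \<star> I l2)
     = (I l1 \<star> ((I l2 \<star> e2) \<triangleleft> (h2 \<star> I l2))) \<triangleleft> (((I l1 \<star> e1) \<triangleleft> (h1 \<star> I l1)) \<star> I l2)"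
    using D by (simp add: left_whisker right_whisker right_whisker_append)
  also have "\<dots> = I (l1 @ l2)"
    unfolding Z1 Z2 using D by simp
  finally have 1: "(I (l1 @ l2) \<star> (e2 \<triangleleft> (I d2 \<star> e1 \<star> I l2))) \<triangleleft> (((I l1 \<star> h2 \<star> I d1) \<triangleleft> h1) \<star> I (l1 @ l2))
     = I (l1 @ l2)" .
  have "((e2 \<triangleleft> (I d2 \<star> e1 \<star> I l2)) \<star> I (d2 @ d1)) \<triangleleft> (I (d2 @ d1) \<star> ((I l1 \<star> h2 \<star> I d1) \<triangleleft> h1))
     = (e2 \<star> I d2 \<star> I d1) \<triangleleft> (I d2 \<star> ((e1 \<star> I (l2 @ d2 @ d1)) \<triangleleft> (I (d1 @ l1) \<star> (h2 \<star> I d1)))) \<triangleleft> (I d2 \<star> I d1 \<star> h1)"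
    using D by (simp add: left_whisker right_whisker right_whisker_append)
  also have "(e1 \<star> I (l2 @ d2 @ d1)) \<triangleleft> (I (d1 @ l1) \<star> (h2 \<star> I d1)) = (I [] \<star> (h2 \<star> I d1)) \<triangleleft> (e1 \<star> I d1)"
    using slide[of e1 "h2 \<star> I d1" "d1 @ l1" "d1" "[]" "l2 @ d2 @ d1"] D by simp
  also have "(e2 \<star> I d2 \<star> I d1) \<triangleleft> (I d2 \<star> ((I [] \<star> (h2 \<star> I d1)) \<triangleleft> (e1 \<star> I d1))) \<triangleleft> (I d2 \<star> I d1 \<star> h1)
     = (((e2 \<star> I d2) \<triangleleft> (I d2 \<star> h2)) \<star> I d1) \<triangleleft> (I d2 \<star> ((e1 \<star> I d1) \<triangleleft> (I d1 \<star> h1)))"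
    using D by (simp add: left_whisker right_whisker right_whisker_append)
  also have "\<dots> = I (d2 @ d1)"
    unfolding Z1 Z2 using D by simp
  finally show ?thesis
    using 1 D by (simp add: dual_pair_def)
qed

text \<open>
  The full twist in \<open>tw (X @ Y)\<close> cancels the crossing of the \<open>X\<close> and \<open>Y\<close> strands produced by braiding
  \<open>X @ Y\<close> past its dual, leaving two nested closures.
\<close>
lemma eps_append:
  assumes "dual_pair X P e1 h1" "dual_pair Y Q e2 h2"
  shows "eps (X @ Y) (Q @ P) (e2 \<triangleleft> (I Q \<star> e1 \<star> I Y)) = eps X P e1 \<triangleleft> (I X \<star> eps Y Q e2 \<star> I P)"
proof -
  note D = dual_pairD(1-8)[OF assms(1)] dual_pairD(1-8)[OF assms(2)]
  \<comment> \<open>Caps still without their twists, which are restored at the end.\<close>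
  define b1 where "b1 = e1 \<triangleleft> br X P"
  define b2 where "b2 = e2 \<triangleleft> br Y Q"
  have B: "arr b1" "arr b2" "src b1 = X @ P" "tgt b1 = []" "src b2 = Y @ Q" "tgt b2 = []"
    using D by (auto simp: b1_def b2_def)
  have s1: "(e2 \<triangleleft> (I Q \<star> e1 \<star> I Y)) \<triangleleft> br (X @ Y) (Q @ P)
      = e2 \<triangleleft> (I Q \<star> ((b1 \<star> I Y) \<triangleleft> (I X \<star> br Y P))) \<triangleleft> (br (X @ Y) Q \<star> I P)"
    using D by (simp add: br_append_right[of "X @ Y" Q P] br_append_left[of X Y P] b1_def left_whisker right_whisker right_whisker_append)
  \<comment> \<open>The two crossings together carry \<open>Y\<close> across \<open>X @ P\<close>,
    so the cap \<open>b1\<close> can be pulled through and no crossing remains.\<close>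
  have s2: "((b1 \<star> I Y) \<triangleleft> (I X \<star> br Y P)) \<triangleleft> (br Y X \<star> I P) = I Y \<star> b1"
  proof -
    have "((b1 \<star> I Y) \<triangleleft> (I X \<star> br Y P)) \<triangleleft> (br Y X \<star> I P) = (b1 \<star> I Y) \<triangleleft> br Y (X @ P)"
      using D B by (simp add: br_append_right)
    also have "\<dots> = br Y [] \<triangleleft> (I Y \<star> b1)"
      using D B by (intro br_natural[symmetric]) auto
    finally show ?thesis using D B by simp
  qed
  \<comment> \<open>Carries one crossing of the full twist past \<open>Q\<close>, to where
    \<open>s2\<close> can use it.\<close>
  have s3: "br (X @ Y) Q \<triangleleft> (br Y X \<star> I Q) = (I Q \<star> br Y X) \<triangleleft> br (Y @ X) Q"
    using D by (intro br_natural) auto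
  have s4: "e2 \<triangleleft> (I Q \<star> I Y \<star> b1) \<triangleleft> (br Y Q \<star> I X \<star> I P) = b1 \<triangleleft> (b2 \<star> I X \<star> I P)"
  proof -
    have "e2 \<triangleleft> (I Q \<star> I Y \<star> b1) \<triangleleft> (br Y Q \<star> I X \<star> I P) = e2 \<triangleleft> (I (Q @ Y) \<star> b1) \<triangleleft> (br Y Q \<star> I (X @ P))"
      using D B by simp
    also have "(I (Q @ Y) \<star> b1) \<triangleleft> (br Y Q \<star> I (X @ P)) = (br Y Q \<star> I []) \<triangleleft> (I (Y @ Q) \<star> b1)"
      using D B by (intro slide) auto
    also have "e2 \<triangleleft> (br Y Q \<star> I []) \<triangleleft> (I (Y @ Q) \<star> b1) = (b2 \<star> I []) \<triangleleft> (I (Y @ Q) \<star> b1)"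
      using D B by (simp add: b2_def)
    also have "\<dots> = (I [] \<star> b1) \<triangleleft> (b2 \<star> I (X @ P))"
      using D B by (intro slide[symmetric]) auto
    finally show ?thesis using D B by simp
  qed
  have s5: "(b2 \<star> I X) \<triangleleft> (I Y \<star> br X Q) \<triangleleft> (br X Y \<star> I Q) = I X \<star> b2"
  proof -
    have "(b2 \<star> I X) \<triangleleft> (I Y \<star> br X Q) \<triangleleft> (br X Y \<star> I Q) = (b2 \<star> I X) \<triangleleft> br X (Y @ Q)"
      using D B by (simp add: br_append_right)
    also have "\<dots> = br X [] \<triangleleft> (I X \<star> b2)"
      using D B by (intro br_natural[symmetric]) auto
    finally show ?thesis using D B by simp
  qed
  have "eps (X @ Y) (Q @ P) (e2 \<triangleleft> (I Q \<star> e1 \<star> I Y))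
    = ((e2 \<triangleleft> (I Q \<star> e1 \<star> I Y)) \<triangleleft> br (X @ Y) (Q @ P)) \<triangleleft> (br Y X \<star> I Q \<star> I P) \<triangleleft> (br X Y \<star> I Q \<star> I P)
        \<triangleleft> (tw X \<star> tw Y \<star> I Q \<star> I P)"
    using D by (simp add: eps_def tw_append right_whisker right_whisker_append)
  also have "\<dots> = e2 \<triangleleft> (I Q \<star> ((b1 \<star> I Y) \<triangleleft> (I X \<star> br Y P))) \<triangleleft> ((br (X @ Y) Q \<triangleleft> (br Y X \<star> I Q)) \<star> I P)
       \<triangleleft> (br X Y \<star> I Q \<star> I P) \<triangleleft> (tw X \<star> tw Y \<star> I Q \<star> I P)"
    unfolding s1 using D B by (simp add: right_whisker right_whisker_append)
  also have "\<dots> = e2 \<triangleleft> (I Q \<star> (((b1 \<star> I Y) \<triangleleft> (I X \<star> br Y P)) \<triangleleft> (br Y X \<star> I P))) \<triangleleft> (br (Y @ X) Q \<star> I P)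
       \<triangleleft> (br X Y \<star> I Q \<star> I P) \<triangleleft> (tw X \<star> tw Y \<star> I Q \<star> I P)"
    unfolding s3 using D B by (simp add: right_whisker left_whisker)
  also have "\<dots> = (e2 \<triangleleft> (I Q \<star> I Y \<star> b1) \<triangleleft> (br Y Q \<star> I X \<star> I P)) \<triangleleft> (I Y \<star> br X Q \<star> I P)
       \<triangleleft> (br X Y \<star> I Q \<star> I P) \<triangleleft> (tw X \<star> tw Y \<star> I Q \<star> I P)"
    unfolding s2 using D B by (simp add: br_append_left right_whisker right_whisker_append)
  also have "\<dots> = b1 \<triangleleft> (((b2 \<star> I X) \<triangleleft> (I Y \<star> br X Q) \<triangleleft> (br X Y \<star> I Q)) \<star> I P) \<triangleleft> (tw X \<star> tw Y \<star> I Q \<star> I P)"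
    unfolding s4 using D B by (simp add: right_whisker right_whisker_append)
  also have "\<dots> = b1 \<triangleleft> (I X \<star> b2 \<star> I P) \<triangleleft> (tw X \<star> ((tw Y \<star> I Q) \<star> I P))"
    unfolding s5 using D B by simp
  also have "tw X \<star> ((tw Y \<star> I Q) \<star> I P) = (I X \<star> ((tw Y \<star> I Q) \<star> I P)) \<triangleleft> (tw X \<star> I (Y @ Q @ P))"
    using D cmp_I_right[of "tw Y \<star> I Q \<star> I P" "Y @ Q @ P"] interchange[of "tw X" "I X" "I (Y @ Q @ P)" "tw Y \<star> I Q \<star> I P"] by simp
  also have "b1 \<triangleleft> (I X \<star> b2 \<star> I P) \<triangleleft> (I X \<star> ((tw Y \<star> I Q) \<star> I P)) \<triangleleft> (tw X \<star> I (Y @ Q @ P))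
     = b1 \<triangleleft> (I X \<star> (eps Y Q e2 \<star> I P)) \<triangleleft> (tw X \<star> I (Y @ Q @ P))"
    using D B by (simp add: eps_def b2_def left_whisker right_whisker right_whisker_append)
  also have "(I X \<star> (eps Y Q e2 \<star> I P)) \<triangleleft> (tw X \<star> I (Y @ Q @ P)) = (tw X \<star> I P) \<triangleleft> (I X \<star> (eps Y Q e2 \<star> I P))"
    using D eps_type[OF assms(2)] by (intro slide) auto
  finally show ?thesis
    using D eps_type[OF assms(2)] by (simp add: eps_def b1_def)
qed

section \<open>Monodromy, and loops around a strand\<close>

definition dbr :: "'o list \<Rightarrow> 'o list \<Rightarrow> 'a" where
  "dbr m l = br l m \<triangleleft> br m l"

lemma dbr_type [simp]: "src (dbr m l) = m @ l" "tgt (dbr m l) = m @ l" "ob l \<Longrightarrow> ob m \<Longrightarrow> arr (dbr m l)"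
  by (auto simp: dbr_def)

lemma dbr_natural:
  assumes "ob m" "arr g" "src g = l" "tgt g = l'"
  shows "dbr m l' \<triangleleft> (I m \<star> g) = (I m \<star> g) \<triangleleft> dbr m l"
proof -
  have o: "ob l" "ob l'" using assms by (auto dest: ob_src ob_tgt)
  have "dbr m l' \<triangleleft> (I m \<star> g) = br l' m \<triangleleft> (br m l' \<triangleleft> (I m \<star> g))"
    using assms o by (simp add: dbr_def)
  also have "br m l' \<triangleleft> (I m \<star> g) = (g \<star> I m) \<triangleleft> br m l"
    using assms o by (intro br_natural) auto
  also have "br l' m \<triangleleft> (g \<star> I m) \<triangleleft> br m l = (br l' m \<triangleleft> (g \<star> I m)) \<triangleleft> br m l"
    using assms o by simp
  also have "br l' m \<triangleleft> (g \<star> I m) = (I m \<star> g) \<triangleleft> br l m"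
    using assms o by (intro br_natural) auto
  finally show ?thesis using assms o by (simp add: dbr_def)
qed

text \<open>To encircle \<open>l @ l'\<close>, the strand \<open>m\<close> crosses \<open>l\<close>,
  encircles \<open>l'\<close>, and crosses back.\<close>

lemma dbr_append:
  assumes "ob m" "ob l" "ob l'"
  shows "dbr m (l @ l') = (br l m \<star> I l') \<triangleleft> (I l \<star> dbr m l') \<triangleleft> (br m l \<star> I l')"
  using assms by (simp add: dbr_def br_append_left br_append_right left_whisker)

text \<open>A loop coloured \<open>l\<close> around \<open>m\<close>. It is kept as an endomorphism
  here; it becomes a scalar once Schur's lemma is available for \<open>m\<close>.\<close>

definition chi :: "'o list \<Rightarrow> 'o list \<Rightarrow> 'o list \<Rightarrow> 'a \<Rightarrow> 'a \<Rightarrow> 'a" where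
  "chi m l d e h = ptr m m l d e h (dbr m l)"

lemma ptr_type:
  assumes "dual_pair l d e h" "arr F" "src F = m @ l" "tgt F = n @ l" "ob m" "ob n"
  shows "arr (ptr m n l d e h F)" "src (ptr m n l d e h F) = m" "tgt (ptr m n l d e h F) = n"
  using dual_pairD(1-8)[OF assms(1)] eps_type[OF assms(1)] assms(2-) by (auto simp: ptr_def)

lemma chi_type:
  assumes "dual_pair l d e h" "ob m"
  shows "arr (chi m l d e h)" "src (chi m l d e h) = m" "tgt (chi m l d e h) = m"
  using ptr_type[OF assms(1)] assms(2) dual_pairD[OF assms(1)] by (auto simp: chi_def)

lemma ptr_smul:
  assumes "dual_pair l d e h" "arr F" "src F = m @ l" "tgt F = n @ l" "ob m" "ob n"
  shows "ptr m n l d e h (smul a F) = smul a (ptr m n l d e h F)"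
  using dual_pairD(1-8)[OF assms(1)] eps_type[OF assms(1)] assms(2-)
  by (simp add: ptr_def smul_cmp cmp_smul smul_tns)

lemma ptr_add:
  assumes "dual_pair l d e h" "arr F" "src F = m @ l" "tgt F = n @ l" "ob m" "ob n"
    "arr G" "src G = m @ l" "tgt G = n @ l"
  shows "ptr m n l d e h (add F G) = add (ptr m n l d e h F) (ptr m n l d e h G)"
  using dual_pairD(1-8)[OF assms(1)] eps_type[OF assms(1)] assms(2-)
  by (simp add: ptr_def add_cmp cmp_add add_tns)

text \<open>Cyclicity carries \<open>i\<close> around the loop, and naturality of the monodromy lets
  it meet \<open>p\<close>, where the two cancel. A loop on a direct summand is thus the large loop
  with an idempotent inserted.\<close>

lemma chi_retract:
  assumes "dual_pair l d e h" "dual_pair l' d' e' h'" "ob m"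
    and "arr i" "src i = l'" "tgt i = l" "arr p" "src p = l" "tgt p = l'" "p \<triangleleft> i = I l'"
  shows "chi m l' d' e' h' = ptr m m l d e h ((I m \<star> (i \<triangleleft> p)) \<triangleleft> dbr m l)"
proof -
  note D = dual_pairD(1-8)[OF assms(1)] dual_pairD(1-8)[OF assms(2)] assms(3-9)
  have "ptr m m l d e h ((I m \<star> (i \<triangleleft> p)) \<triangleleft> dbr m l) = ptr m m l d e h ((I m \<star> i) \<triangleleft> ((I m \<star> p) \<triangleleft> dbr m l))"
    using D by (simp add: left_whisker)
  also have "\<dots> = ptr m m l' d' e' h' (((I m \<star> p) \<triangleleft> dbr m l) \<triangleleft> (I m \<star> i))"
    using D by (intro ptr_cyclic[OF assms(1,2)]) auto
  also have "(I m \<star> p) \<triangleleft> dbr m l = dbr m l' \<triangleleft> (I m \<star> p)"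
    using D by (intro dbr_natural[symmetric]) auto
  also have "(dbr m l' \<triangleleft> (I m \<star> p)) \<triangleleft> (I m \<star> i) = dbr m l' \<triangleleft> (I m \<star> (p \<triangleleft> i))"
    using D by (simp add: left_whisker)
  also have "\<dots> = dbr m l'"
    unfolding assms(10) using D cmp_I_right[of "dbr m l'" "m @ l'"] by simp
  finally show ?thesis by (simp add: chi_def)
qed

lemma chi_iso:
  assumes "dual_pair l d e h" "dual_pair l' d' e' h'" "ob m"
    and "arr i" "src i = l'" "tgt i = l" "arr p" "src p = l" "tgt p = l'" "p \<triangleleft> i = I l'" "i \<triangleleft> p = I l"
  shows "chi m l' d' e' h' = chi m l d e h"
  using chi_retract[OF assms(1-10)] assms(3,11) dual_pairD(1)[OF assms(1)] by (simp add: chi_def)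

text \<open>The identity of \<open>l\<close> is a sum of two idempotents, and
  \<open>chi_retract\<close> recognises the loop with either one inserted.\<close>

lemma chi_biproduct:
  assumes "dual_pair l d e h" "dual_pair l1 d1 e1 h1" "dual_pair l2 d2 e2 h2" "ob m"
    and "arr i" "src i = l1" "tgt i = l" "arr p" "src p = l" "tgt p = l1" "p \<triangleleft> i = I l1"
    and "arr j" "src j = l2" "tgt j = l" "arr q" "src q = l" "tgt q = l2" "q \<triangleleft> j = I l2"
    and sum: "add (i \<triangleleft> p) (j \<triangleleft> q) = I l"
  shows "chi m l d e h = add (chi m l1 d1 e1 h1) (chi m l2 d2 e2 h2)"
proof -
  note D = dual_pairD(1,2)[OF assms(1)] dual_pairD(1,2)[OF assms(2)] dual_pairD(1,2)[OF assms(3)] assms(4-)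
  have "dbr m l = (I m \<star> add (i \<triangleleft> p) (j \<triangleleft> q)) \<triangleleft> dbr m l"
    unfolding sum using D by simp
  also have "\<dots> = add ((I m \<star> (i \<triangleleft> p)) \<triangleleft> dbr m l) ((I m \<star> (j \<triangleleft> q)) \<triangleleft> dbr m l)"
    using D(1-21) by (simp add: tns_add add_cmp)
  finally have "chi m l d e h = ptr m m l d e h (add ((I m \<star> (i \<triangleleft> p)) \<triangleleft> dbr m l) ((I m \<star> (j \<triangleleft> q)) \<triangleleft> dbr m l))"
    by (simp add: chi_def)
  also have "\<dots> = add (ptr m m l d e h ((I m \<star> (i \<triangleleft> p)) \<triangleleft> dbr m l)) (ptr m m l d e h ((I m \<star> (j \<triangleleft> q)) \<triangleleft> dbr m l))"
    using D by (intro ptr_add[OF assms(1)]) auto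
  finally show ?thesis
    using chi_retract[OF assms(1,2,4-11)] chi_retract[OF assms(1,3,4,12-18)] by simp
qed

text \<open>By \<open>eps_append\<close>, closing a composite strand nests two loops, that of the
  right factor inside.\<close>

lemma ptr_append:
  assumes "dual_pair l1 d1 e1 h1" "dual_pair l2 d2 e2 h2" "ob m" "ob n" "arr F" "src F = m @ l1 @ l2" "tgt F = n @ l1 @ l2"
  shows "ptr m n (l1 @ l2) (d2 @ d1) (e2 \<triangleleft> (I d2 \<star> e1 \<star> I l2)) ((I l1 \<star> h2 \<star> I d1) \<triangleleft> h1) F
    = ptr m n l1 d1 e1 h1 (ptr (m @ l1) (n @ l1) l2 d2 e2 h2 F)"
  using dual_pairD(1-8)[OF assms(1)] dual_pairD(1-8)[OF assms(2)] eps_type[OF assms(1)] eps_type[OF assms(2)] assms(3-)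
  by (simp add: ptr_def eps_append[OF assms(1,2)] left_whisker right_whisker right_whisker_append)

lemma ptr_left:
  assumes "dual_pair l d e h" "ob x" "ob m" "ob n" "arr F" "src F = m @ l" "tgt F = n @ l"
  shows "ptr (x @ m) (x @ n) l d e h (I x \<star> F) = I x \<star> ptr m n l d e h F"
  using dual_pairD(1-8)[OF assms(1)] eps_type[OF assms(1)] assms(2-)
  by (simp add: ptr_def left_whisker)

lemma ptr_conj:
  assumes "dual_pair l d e h" "arr f" "arr g" "src f = n" "tgt f = n'" "src g = m'" "tgt g = m"
    "arr F" "src F = m @ l" "tgt F = n @ l"
  shows "ptr m' n' l d e h ((f \<star> I l) \<triangleleft> F \<triangleleft> (g \<star> I l)) = f \<triangleleft> ptr m n l d e h F \<triangleleft> g"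
proof -
  note D = dual_pairD(1-8)[OF assms(1)] eps_type[OF assms(1)] assms(2-)
  have o: "ob m" "ob n" "ob m'" "ob n'" using assms(2-7) by (auto dest: ob_src ob_tgt)
  have "ptr m' n' l d e h ((f \<star> I l) \<triangleleft> F \<triangleleft> (g \<star> I l))
      = ((I n' \<star> eps l d e) \<triangleleft> (f \<star> I (l @ d))) \<triangleleft> (F \<star> I d) \<triangleleft> (g \<star> I (l @ d)) \<triangleleft> (I m' \<star> h)"
    using D o by (simp add: ptr_def right_whisker right_whisker_append)
  also have "(I n' \<star> eps l d e) \<triangleleft> (f \<star> I (l @ d)) = (f \<star> I []) \<triangleleft> (I n \<star> eps l d e)"
    using D o by (intro slide) auto
  also have "(g \<star> I (l @ d)) \<triangleleft> (I m' \<star> h) = (I m \<star> h) \<triangleleft> (g \<star> I [])"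
    using D o by (intro slide[symmetric]) auto
  finally show ?thesis using D o by (simp add: ptr_def)
qed

text \<open>The inner loop \<open>l2\<close> encircles only \<open>m\<close>, where it acts by
  \<open>s\<close>. Once it is gone, the two crossings of \<open>m\<close> with \<open>l1\<close>
  make up the monodromy with \<open>l1\<close>.\<close>

lemma chi_append:
  assumes "dual_pair l1 d1 e1 h1" "dual_pair l2 d2 e2 h2" "ob m"
    and s: "chi m l2 d2 e2 h2 = smul s (I m)"
  shows "chi m (l1 @ l2) (d2 @ d1) (e2 \<triangleleft> (I d2 \<star> e1 \<star> I l2)) ((I l1 \<star> h2 \<star> I d1) \<triangleleft> h1)
    = smul s (chi m l1 d1 e1 h1)"
proof -
  note D = dual_pairD(1-8)[OF assms(1)] dual_pairD(1-8)[OF assms(2)] assms(3)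
  have "ptr (m @ l1) (m @ l1) l2 d2 e2 h2 (dbr m (l1 @ l2))
      = br l1 m \<triangleleft> ptr (l1 @ m) (l1 @ m) l2 d2 e2 h2 (I l1 \<star> dbr m l2) \<triangleleft> br m l1"
    unfolding dbr_append[OF assms(3) D(1,9)] using D by (intro ptr_conj[OF assms(2)]) auto
  also have "ptr (l1 @ m) (l1 @ m) l2 d2 e2 h2 (I l1 \<star> dbr m l2) = I l1 \<star> smul s (I m)"
    using D ptr_left[OF assms(2), of l1 m m "dbr m l2"] s by (simp add: chi_def)
  also have "br l1 m \<triangleleft> (I l1 \<star> smul s (I m)) \<triangleleft> br m l1 = smul s (dbr m l1)"
    using D by (simp add: tns_smul smul_cmp cmp_smul dbr_def)
  finally have "ptr (m @ l1) (m @ l1) l2 d2 e2 h2 (dbr m (l1 @ l2)) = smul s (dbr m l1)" .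
  then show ?thesis
    using D ptr_append[OF assms(1,2), of m m "dbr m (l1 @ l2)"] ptr_smul[OF assms(1), of "dbr m l1" m m s]
    by (simp add: chi_def)
qed

text \<open>Closing the second strand first leaves a loop around \<open>l1\<close>, which is the
  scalar \<open>s\<close>; what remains is the dimension of \<open>l1\<close>. This is the source of
  \<open>S_ij = \<chi>_i(V_j) d_i\<close>.\<close>

lemma tr_dbr:
  assumes "dual_pair l1 d1 e1 h1" "dual_pair l2 d2 e2 h2" 
    and s: "chi l1 l2 d2 e2 h2 = smul s (I l1)"
  shows "ptr [] [] (l1 @ l2) (d2 @ d1) (e2 \<triangleleft> (I d2 \<star> e1 \<star> I l2)) ((I l1 \<star> h2 \<star> I d1) \<triangleleft> h1) (dbr l1 l2)
    = smul s (ptr [] [] l1 d1 e1 h1 (I l1))"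
proof -
  note D = dual_pairD(1-8)[OF assms(1)] dual_pairD(1-8)[OF assms(2)]
  show ?thesis
    using D ptr_append[OF assms(1,2), of "[]" "[]" "dbr l1 l2"] s ptr_smul[OF assms(1), of "I l1" "[]" "[]" s]
    by (simp add: chi_def)
qed

text \<open>Bending the \<open>d\<close>-leg of \<open>f\<close> and bending it back is a zigzag.
  Hence a morphism from the unit to \<open>l @ d\<close> is determined by an endomorphism of
  \<open>l\<close>.\<close>

lemma unit_to_dual:
  assumes "dual_pair l d e h" "arr f" "src f = []" "tgt f = l @ d"
  shows "(((I l \<star> e) \<triangleleft> (f \<star> I l)) \<star> I d) \<triangleleft> h = f"
proof -
  note D = dual_pairD(1-8)[OF assms(1)] assms(2-)
  have "(((I l \<star> e) \<triangleleft> (f \<star> I l)) \<star> I d) \<triangleleft> h = (I l \<star> e \<star> I d) \<triangleleft> ((f \<star> I (l @ d)) \<triangleleft> (I [] \<star> h))"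
    using D by (simp add: right_whisker right_whisker_append)
  also have "(f \<star> I (l @ d)) \<triangleleft> (I [] \<star> h) = (I (l @ d) \<star> h) \<triangleleft> (f \<star> I [])"
    using D by (intro slide[symmetric]) auto
  also have "(I l \<star> e \<star> I d) \<triangleleft> (I (l @ d) \<star> h) \<triangleleft> (f \<star> I []) = (I l \<star> ((e \<star> I d) \<triangleleft> (I d \<star> h))) \<triangleleft> f"
    using D by (simp add: left_whisker)
  finally show ?thesis unfolding dual_pairD(10)[OF assms(1)] using D by simp
qed

end

section \<open>Strictification of a ribbon category\<close>

text \<open>With source and target carried along, simplification discharges the typing conditions of the axioms.\<close>
datatype ('x, 'm) typed = Typed (dom: 'x) (cod: 'x) (mor: 'm)

section \<open>Calculus of typed morphisms and their inverses\<close>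

context linear_category
begin

definition valid :: "('o, 'm) typed \<Rightarrow> bool" where
  "valid t \<longleftrightarrow> dom t \<in> Obj C \<and> cod t \<in> Obj C \<and> mor t \<in> Hom C (dom t) (cod t)"

definition id\<^sub>t :: "'o \<Rightarrow> ('o, 'm) typed" where
  "id\<^sub>t X = Typed X X (ident C X)"

definition comp\<^sub>t :: "('o, 'm) typed \<Rightarrow> ('o, 'm) typed \<Rightarrow> ('o, 'm) typed"  (infixr \<open>\<circ>\<^sub>t\<close> 55) where
  "g \<circ>\<^sub>t f = Typed (dom f) (cod g) (mor g \<cdot> mor f)"

definition add\<^sub>t :: "('o, 'm) typed \<Rightarrow> ('o, 'm) typed \<Rightarrow> ('o, 'm) typed" where
  "add\<^sub>t f g = Typed (dom f) (cod f) (mor f \<oplus> mor g)"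

definition smul\<^sub>t :: "'k \<Rightarrow> ('o, 'm) typed \<Rightarrow> ('o, 'm) typed" where
  "smul\<^sub>t a f = Typed (dom f) (cod f) (a \<odot> mor f)"

definition iso\<^sub>t :: "('o, 'm) typed \<Rightarrow> bool" where
  "iso\<^sub>t f \<longleftrightarrow> valid f \<and> iso_in C (dom f) (cod f) (mor f)"

definition inv\<^sub>t :: "('o, 'm) typed \<Rightarrow> ('o, 'm) typed" where
  "inv\<^sub>t f = Typed (cod f) (dom f) (inv_mor C (mor f))"

lemma typed_sel [simp]:
  "dom (id\<^sub>t X) = X" "cod (id\<^sub>t X) = X"
  "dom (g \<circ>\<^sub>t f) = dom f" "cod (g \<circ>\<^sub>t f) = cod g"
  "dom (add\<^sub>t f g) = dom f" "cod (add\<^sub>t f g) = cod f"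
  "dom (smul\<^sub>t a f) = dom f" "cod (smul\<^sub>t a f) = cod f"
  "dom (inv\<^sub>t f) = cod f" "cod (inv\<^sub>t f) = dom f"
  by (auto simp: id\<^sub>t_def comp\<^sub>t_def add\<^sub>t_def smul\<^sub>t_def inv\<^sub>t_def)

lemma valid_obj [simp]: "valid f \<Longrightarrow> dom f \<in> Obj C" "valid f \<Longrightarrow> cod f \<in> Obj C"
  by (auto simp: valid_def)

lemma valid_ops [simp]:
  "X \<in> Obj C \<Longrightarrow> valid (id\<^sub>t X)"
  "\<lbrakk>valid g; valid f; dom g = cod f\<rbrakk> \<Longrightarrow> valid (g \<circ>\<^sub>t f)"
  "\<lbrakk>valid g; valid f; dom g = dom f; cod g = cod f\<rbrakk> \<Longrightarrow> valid (add\<^sub>t g f)"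
  "valid f \<Longrightarrow> valid (smul\<^sub>t a f)"
  using comp_hom[of "dom f" "cod f" "cod g" "mor g" "mor f"]
  by (simp_all add: valid_def id\<^sub>t_def comp\<^sub>t_def add\<^sub>t_def smul\<^sub>t_def ident_hom addM_hom smulM_hom del: valid_obj)

lemma comp\<^sub>t_id [simp]:
  "\<lbrakk>valid f; X = cod f\<rbrakk> \<Longrightarrow> id\<^sub>t X \<circ>\<^sub>t f = f"
  "\<lbrakk>valid f; X = dom f\<rbrakk> \<Longrightarrow> f \<circ>\<^sub>t id\<^sub>t X = f"
  using ident_left[of "dom f" "cod f" "mor f"] ident_right[of "dom f" "cod f" "mor f"]
  by (auto simp: valid_def id\<^sub>t_def comp\<^sub>t_def simp del: valid_obj)

lemma comp\<^sub>t_assoc [simp]: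
  "\<lbrakk>valid h; valid g; valid f; dom h = cod g; dom g = cod f\<rbrakk> \<Longrightarrow> (h \<circ>\<^sub>t g) \<circ>\<^sub>t f = h \<circ>\<^sub>t (g \<circ>\<^sub>t f)"
  using comp_assoc[of "dom f" "cod f" "dom h" "cod h" "mor h" "mor g" "mor f"]
  by (simp add: valid_def comp\<^sub>t_def del: valid_obj)

lemma comp\<^sub>t_linear:
  "\<lbrakk>valid g; valid g'; valid f; dom g = cod f; dom g' = cod f; cod g = cod g'\<rbrakk>
    \<Longrightarrow> add\<^sub>t g g' \<circ>\<^sub>t f = add\<^sub>t (g \<circ>\<^sub>t f) (g' \<circ>\<^sub>t f)"
  "\<lbrakk>valid g; valid f; valid f'; dom g = cod f; dom g = cod f'; dom f = dom f'\<rbrakk>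
    \<Longrightarrow> g \<circ>\<^sub>t add\<^sub>t f f' = add\<^sub>t (g \<circ>\<^sub>t f) (g \<circ>\<^sub>t f')"
  "\<lbrakk>valid g; valid f; dom g = cod f\<rbrakk> \<Longrightarrow> smul\<^sub>t a g \<circ>\<^sub>t f = smul\<^sub>t a (g \<circ>\<^sub>t f)"
  "\<lbrakk>valid g; valid f; dom g = cod f\<rbrakk> \<Longrightarrow> g \<circ>\<^sub>t smul\<^sub>t a f = smul\<^sub>t a (g \<circ>\<^sub>t f)"
  using comp_addM_left[of "dom f" "cod f" "cod g" "mor g" "mor g'" "mor f"]
    comp_addM_right[of "dom f" "cod f" "cod g" "mor g" "mor f" "mor f'"]
    comp_smulM_left[of "dom f" "cod f" "cod g" "mor g" "mor f" a]
    comp_smulM_right[of "dom f" "cod f" "cod g" "mor g" "mor f" a]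
  by (simp_all add: valid_def comp\<^sub>t_def add\<^sub>t_def smul\<^sub>t_def del: valid_obj)

lemma inverse_pair_unique:
  assumes "X \<in> Obj C" "Y \<in> Obj C" "inverse_pair C X Y f g" "inverse_pair C X Y f g'"
  shows "g = g'"
proof -
  have "g = g \<cdot> (f \<cdot> g')" using assms by (simp add: inverse_pair_def ident_right)
  also have "\<dots> = (g \<cdot> f) \<cdot> g'" using assms comp_assoc[of Y X Y X g f g'] by (simp add: inverse_pair_def)
  also have "\<dots> = g'" using assms by (simp add: inverse_pair_def ident_left)
  finally show ?thesis .
qed

text \<open>The definition of \<open>inv_mor\<close> does not fix the objects; disjointness of
  hom-sets recovers them from \<open>f\<close>.\<close>

lemma inv_mor_eq:
  assumes "X \<in> Obj C" "Y \<in> Obj C" "inverse_pair C X Y f g"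
  shows "inv_mor C f = g"
  unfolding inv_mor_def
proof (rule the_equality)
  show "\<exists>X\<in>Obj C. \<exists>Y\<in>Obj C. inverse_pair C X Y f g" using assms by blast
  fix g' assume "\<exists>X\<in>Obj C. \<exists>Y\<in>Obj C. inverse_pair C X Y f g'"
  then obtain X' Y' where "X' \<in> Obj C" "Y' \<in> Obj C" "inverse_pair C X' Y' f g'" by blast
  moreover from this have "X' = X \<and> Y' = Y"
    using assms hom_disjoint by (metis inverse_pair_def)
  ultimately show "g' = g" using assms inverse_pair_unique by blast
qed

lemma iso\<^sub>t_pair: "iso\<^sub>t f \<Longrightarrow> inverse_pair C (dom f) (cod f) (mor f) (inv_mor C (mor f))"
  unfolding iso\<^sub>t_def iso_in_def valid_def using inv_mor_eq by blast

lemma iso\<^sub>t_inv [simp]: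
  assumes "iso\<^sub>t f"
  shows "valid f" "valid (inv\<^sub>t f)" "inv\<^sub>t f \<circ>\<^sub>t f = id\<^sub>t (dom f)" "f \<circ>\<^sub>t inv\<^sub>t f = id\<^sub>t (cod f)"
  using iso\<^sub>t_pair[OF assms] assms
  by (auto simp: iso\<^sub>t_def valid_def inverse_pair_def inv\<^sub>t_def comp\<^sub>t_def id\<^sub>t_def simp del: valid_obj)

lemma iso\<^sub>t_cancel [simp]:
  assumes "iso\<^sub>t f" "valid g"
  shows "cod g = dom f \<Longrightarrow> inv\<^sub>t f \<circ>\<^sub>t f \<circ>\<^sub>t g = g" "cod g = cod f \<Longrightarrow> f \<circ>\<^sub>t inv\<^sub>t f \<circ>\<^sub>t g = g"
  using assms comp\<^sub>t_assoc[of "inv\<^sub>t f" f g] comp\<^sub>t_assoc[of f "inv\<^sub>t f" g] by simp_all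

lemma iso\<^sub>tI:
  assumes "valid f" "valid g" "dom g = cod f" "cod g = dom f" "g \<circ>\<^sub>t f = id\<^sub>t (dom f)" "f \<circ>\<^sub>t g = id\<^sub>t (cod f)"
  shows "iso\<^sub>t f" "inv\<^sub>t f = g"
proof -
  have *: "inverse_pair C (dom f) (cod f) (mor f) (mor g)"
    using assms by (auto simp: inverse_pair_def comp\<^sub>t_def id\<^sub>t_def valid_def simp del: valid_obj)
  then show "iso\<^sub>t f" using assms(1) unfolding iso\<^sub>t_def iso_in_def by blast
  show "inv\<^sub>t f = g" using inv_mor_eq[OF _ _ *] assms by (cases g) (auto simp: inv\<^sub>t_def)
qed

lemma iso\<^sub>t_id [simp]: assumes "X \<in> Obj C" shows "iso\<^sub>t (id\<^sub>t X)" "inv\<^sub>t (id\<^sub>t X) = id\<^sub>t X"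
  using iso\<^sub>tI[of "id\<^sub>t X" "id\<^sub>t X"] assms by auto

lemma iso\<^sub>t_inv_inv [simp]: assumes "iso\<^sub>t f" shows "iso\<^sub>t (inv\<^sub>t f)" "inv\<^sub>t (inv\<^sub>t f) = f"
  using iso\<^sub>tI[of "inv\<^sub>t f" f] assms by auto

lemma iso\<^sub>t_comp [simp]:
  assumes "iso\<^sub>t g" "iso\<^sub>t f" "dom g = cod f"
  shows "iso\<^sub>t (g \<circ>\<^sub>t f)" "inv\<^sub>t (g \<circ>\<^sub>t f) = inv\<^sub>t f \<circ>\<^sub>t inv\<^sub>t g"
proof -
  have "(g \<circ>\<^sub>t f) \<circ>\<^sub>t (inv\<^sub>t f \<circ>\<^sub>t inv\<^sub>t g) = g \<circ>\<^sub>t (f \<circ>\<^sub>t inv\<^sub>t f) \<circ>\<^sub>t inv\<^sub>t g"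
    using assms by (simp del: iso\<^sub>t_inv(4) add: iso\<^sub>t_inv(1,2))
  then have 1: "(g \<circ>\<^sub>t f) \<circ>\<^sub>t (inv\<^sub>t f \<circ>\<^sub>t inv\<^sub>t g) = id\<^sub>t (cod g)"
    using assms by simp
  show "iso\<^sub>t (g \<circ>\<^sub>t f)" "inv\<^sub>t (g \<circ>\<^sub>t f) = inv\<^sub>t f \<circ>\<^sub>t inv\<^sub>t g"
    using iso\<^sub>tI[of "g \<circ>\<^sub>t f" "inv\<^sub>t f \<circ>\<^sub>t inv\<^sub>t g"] 1 assms by auto
qed

lemma iso\<^sub>t_epi:
  assumes "iso\<^sub>t p" "valid f" "valid g" "dom f = cod p" "dom g = cod p" "f \<circ>\<^sub>t p = g \<circ>\<^sub>t p"
  shows "f = g"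
proof -
  have "(f \<circ>\<^sub>t p) \<circ>\<^sub>t inv\<^sub>t p = (g \<circ>\<^sub>t p) \<circ>\<^sub>t inv\<^sub>t p" using assms by metis
  then show ?thesis using assms(1-5) by simp
qed

lemma iso\<^sub>t_mono:
  assumes "iso\<^sub>t p" "valid f" "valid g" "cod f = dom p" "cod g = dom p" "p \<circ>\<^sub>t f = p \<circ>\<^sub>t g"
  shows "f = g"
proof -
  have "inv\<^sub>t p \<circ>\<^sub>t p \<circ>\<^sub>t f = inv\<^sub>t p \<circ>\<^sub>t p \<circ>\<^sub>t g" using assms by metis
  then show ?thesis using assms(1-5) by simp
qed

end

section \<open>Typed tensor products, unit coherence and the strict tensor product\<close>

context monoidal_linear_category
begin

definition tensor\<^sub>t :: "('a, 'b) typed \<Rightarrow> ('a, 'b) typed \<Rightarrow> ('a, 'b) typed"  (infixr \<open>\<otimes>\<^sub>t\<close> 60) where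
  "f \<otimes>\<^sub>t g = Typed (dom f \<otimes> dom g) (cod f \<otimes> cod g) (mor f \<otimes>\<^sub>m mor g)"

definition assoc\<^sub>t :: "'a \<Rightarrow> 'a \<Rightarrow> 'a \<Rightarrow> ('a, 'b) typed" where
  "assoc\<^sub>t X Y Z = Typed ((X \<otimes> Y) \<otimes> Z) (X \<otimes> (Y \<otimes> Z)) (assoc C X Y Z)"

definition lunit\<^sub>t :: "'a \<Rightarrow> ('a, 'b) typed" where
  "lunit\<^sub>t X = Typed (\<one> \<otimes> X) X (lunit C X)"

definition runit\<^sub>t :: "'a \<Rightarrow> ('a, 'b) typed" where
  "runit\<^sub>t X = Typed (X \<otimes> \<one>) X (runit C X)"

lemmas tensor_unit_obj [simp] = tensorO_obj unitO_obj

lemma tensor\<^sub>t_sel [simp]: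
  "dom (f \<otimes>\<^sub>t g) = dom f \<otimes> dom g" "cod (f \<otimes>\<^sub>t g) = cod f \<otimes> cod g"
  "dom (assoc\<^sub>t X Y Z) = (X \<otimes> Y) \<otimes> Z" "cod (assoc\<^sub>t X Y Z) = X \<otimes> (Y \<otimes> Z)"
  "dom (lunit\<^sub>t X) = \<one> \<otimes> X" "cod (lunit\<^sub>t X) = X"
  "dom (runit\<^sub>t X) = X \<otimes> \<one>" "cod (runit\<^sub>t X) = X"
  by (auto simp: tensor\<^sub>t_def assoc\<^sub>t_def lunit\<^sub>t_def runit\<^sub>t_def)

lemma valid_tensor [simp]: "\<lbrakk>valid f; valid g\<rbrakk> \<Longrightarrow> valid (f \<otimes>\<^sub>t g)"
  by (simp add: valid_def tensor\<^sub>t_def tensorM_hom del: valid_obj)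

lemma interchange\<^sub>t:
  "\<lbrakk>valid f; valid g; valid f'; valid g'; dom g = cod f; dom g' = cod f'\<rbrakk>
    \<Longrightarrow> (g \<otimes>\<^sub>t g') \<circ>\<^sub>t (f \<otimes>\<^sub>t f') = (g \<circ>\<^sub>t f) \<otimes>\<^sub>t (g' \<circ>\<^sub>t f')"
  using tensorM_comp[of "dom f" "cod f" "cod g" "dom f'" "cod f'" "cod g'" "mor f" "mor g" "mor f'" "mor g'"]
  by (auto simp: valid_def tensor\<^sub>t_def comp\<^sub>t_def simp del: valid_obj)

text \<open>The form with a trailing factor is the one that matches, because
  \<open>comp\<^sub>t_assoc\<close> nests composites to the right.\<close>

lemma interchange\<^sub>t':
  "\<lbrakk>valid f; valid g; valid f'; valid g'; dom g = cod f; dom g' = cod f'; valid k; cod k = dom f \<otimes> dom f'\<rbrakk>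
    \<Longrightarrow> (g \<otimes>\<^sub>t g') \<circ>\<^sub>t (f \<otimes>\<^sub>t f') \<circ>\<^sub>t k = ((g \<circ>\<^sub>t f) \<otimes>\<^sub>t (g' \<circ>\<^sub>t f')) \<circ>\<^sub>t k"
  using comp\<^sub>t_assoc[of "g \<otimes>\<^sub>t g'" "f \<otimes>\<^sub>t f'" k] by (simp add: interchange\<^sub>t)

lemma tensor\<^sub>t_id [simp]: "\<lbrakk>X \<in> Obj C; Y \<in> Obj C\<rbrakk> \<Longrightarrow> id\<^sub>t X \<otimes>\<^sub>t id\<^sub>t Y = id\<^sub>t (X \<otimes> Y)"
  by (auto simp: tensor\<^sub>t_def id\<^sub>t_def tensorM_ident)

lemma tensor\<^sub>t_linear:
  "\<lbrakk>valid g; valid g'; valid f; dom g = dom g'; cod g = cod g'\<rbrakk>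
    \<Longrightarrow> add\<^sub>t g g' \<otimes>\<^sub>t f = add\<^sub>t (g \<otimes>\<^sub>t f) (g' \<otimes>\<^sub>t f)"
  "\<lbrakk>valid g; valid g'; valid f; dom g = dom g'; cod g = cod g'\<rbrakk>
    \<Longrightarrow> f \<otimes>\<^sub>t add\<^sub>t g g' = add\<^sub>t (f \<otimes>\<^sub>t g) (f \<otimes>\<^sub>t g')"
  "\<lbrakk>valid g; valid f\<rbrakk> \<Longrightarrow> smul\<^sub>t a g \<otimes>\<^sub>t f = smul\<^sub>t a (g \<otimes>\<^sub>t f)"
  "\<lbrakk>valid g; valid f\<rbrakk> \<Longrightarrow> g \<otimes>\<^sub>t smul\<^sub>t a f = smul\<^sub>t a (g \<otimes>\<^sub>t f)"
  using tensorM_addM_left[of "dom g" "cod g" "dom f" "cod f" "mor g" "mor g'" "mor f"]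
    tensorM_addM_right[of "dom f" "cod f" "dom g" "cod g" "mor f" "mor g" "mor g'"]
    tensorM_smulM_left[of "dom g" "cod g" "dom f" "cod f" "mor g" "mor f" a]
    tensorM_smulM_right[of "dom g" "cod g" "dom f" "cod f" "mor g" "mor f" a]
  by (simp_all add: valid_def tensor\<^sub>t_def add\<^sub>t_def smul\<^sub>t_def del: valid_obj)

lemma iso\<^sub>t_tensor [simp]:
  assumes "iso\<^sub>t g" "iso\<^sub>t f"
  shows "iso\<^sub>t (g \<otimes>\<^sub>t f)" "inv\<^sub>t (g \<otimes>\<^sub>t f) = inv\<^sub>t g \<otimes>\<^sub>t inv\<^sub>t f"
  using iso\<^sub>tI[of "g \<otimes>\<^sub>t f" "inv\<^sub>t g \<otimes>\<^sub>t inv\<^sub>t f"] assms by (auto simp: interchange\<^sub>t)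

lemma iso\<^sub>t_structural [simp]:
  "\<lbrakk>X \<in> Obj C; Y \<in> Obj C; Z \<in> Obj C\<rbrakk> \<Longrightarrow> iso\<^sub>t (assoc\<^sub>t X Y Z)"
  "X \<in> Obj C \<Longrightarrow> iso\<^sub>t (lunit\<^sub>t X)" "X \<in> Obj C \<Longrightarrow> iso\<^sub>t (runit\<^sub>t X)"
  using assoc_iso[of X Y Z] lunit_iso[of X] runit_iso[of X]
  by (auto simp: iso\<^sub>t_def assoc\<^sub>t_def lunit\<^sub>t_def runit\<^sub>t_def valid_def iso_in_def inverse_pair_def
      simp del: valid_obj iso\<^sub>t_inv(1))

lemma assoc\<^sub>t_natural:
  "\<lbrakk>valid f; valid g; valid h; dom f = X; cod f = X'; dom g = Y; cod g = Y'; dom h = Z; cod h = Z'\<rbrakk>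
    \<Longrightarrow> assoc\<^sub>t X' Y' Z' \<circ>\<^sub>t ((f \<otimes>\<^sub>t g) \<otimes>\<^sub>t h) = (f \<otimes>\<^sub>t (g \<otimes>\<^sub>t h)) \<circ>\<^sub>t assoc\<^sub>t X Y Z"
  using assoc_natural[of X Y Z X' Y' Z' "mor f" "mor g" "mor h"]
  by (auto simp: valid_def comp\<^sub>t_def tensor\<^sub>t_def assoc\<^sub>t_def simp del: valid_obj)

lemma lunit\<^sub>t_natural: "\<lbrakk>valid f; dom f = X; cod f = Y\<rbrakk> \<Longrightarrow> lunit\<^sub>t Y \<circ>\<^sub>t (id\<^sub>t \<one> \<otimes>\<^sub>t f) = f \<circ>\<^sub>t lunit\<^sub>t X"
  using lunit_natural[of X Y "mor f"]
  by (auto simp: valid_def comp\<^sub>t_def tensor\<^sub>t_def lunit\<^sub>t_def id\<^sub>t_def simp del: valid_obj)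

lemma runit\<^sub>t_natural: "\<lbrakk>valid f; dom f = X; cod f = Y\<rbrakk> \<Longrightarrow> runit\<^sub>t Y \<circ>\<^sub>t (f \<otimes>\<^sub>t id\<^sub>t \<one>) = f \<circ>\<^sub>t runit\<^sub>t X"
  using runit_natural[of X Y "mor f"]
  by (auto simp: valid_def comp\<^sub>t_def tensor\<^sub>t_def runit\<^sub>t_def id\<^sub>t_def simp del: valid_obj)

lemma pentagon\<^sub>t: "\<lbrakk>W \<in> Obj C; X \<in> Obj C; Y \<in> Obj C; Z \<in> Obj C\<rbrakk>
    \<Longrightarrow> assoc\<^sub>t W X (Y \<otimes> Z) \<circ>\<^sub>t assoc\<^sub>t (W \<otimes> X) Y Z
      = (id\<^sub>t W \<otimes>\<^sub>t assoc\<^sub>t X Y Z) \<circ>\<^sub>t assoc\<^sub>t W (X \<otimes> Y) Z \<circ>\<^sub>t (assoc\<^sub>t W X Y \<otimes>\<^sub>t id\<^sub>t Z)"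
  by (simp add: comp\<^sub>t_def tensor\<^sub>t_def assoc\<^sub>t_def id\<^sub>t_def pentagon)

lemma triangle\<^sub>t: "\<lbrakk>X \<in> Obj C; Y \<in> Obj C\<rbrakk>
    \<Longrightarrow> (id\<^sub>t X \<otimes>\<^sub>t lunit\<^sub>t Y) \<circ>\<^sub>t assoc\<^sub>t X \<one> Y = runit\<^sub>t X \<otimes>\<^sub>t id\<^sub>t Y"
  by (simp add: comp\<^sub>t_def tensor\<^sub>t_def assoc\<^sub>t_def id\<^sub>t_def lunit\<^sub>t_def runit\<^sub>t_def triangle)

text \<open>By naturality of the unit isomorphism, tensoring with \<open>\<one>\<close> is
  conjugation by an isomorphism. Coherence laws may therefore be checked after tensoring, where
  pentagon and triangle apply.\<close>

lemma tensor_unit_left_faithful: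
  assumes "valid f" "valid g" "dom f = dom g" "cod f = cod g" "id\<^sub>t \<one> \<otimes>\<^sub>t f = id\<^sub>t \<one> \<otimes>\<^sub>t g"
  shows "f = g"
proof (rule iso\<^sub>t_epi[of "lunit\<^sub>t (dom g)"])
  show "f \<circ>\<^sub>t lunit\<^sub>t (dom g) = g \<circ>\<^sub>t lunit\<^sub>t (dom g)"
    using lunit\<^sub>t_natural[of f "dom g" "cod g"] lunit\<^sub>t_natural[of g "dom g" "cod g"] assms by simp
qed (use assms in auto)

lemma tensor_unit_right_faithful:
  assumes "valid f" "valid g" "dom f = dom g" "cod f = cod g" "f \<otimes>\<^sub>t id\<^sub>t \<one> = g \<otimes>\<^sub>t id\<^sub>t \<one>"
  shows "f = g"
proof (rule iso\<^sub>t_epi[of "runit\<^sub>t (dom g)"])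
  show "f \<circ>\<^sub>t runit\<^sub>t (dom g) = g \<circ>\<^sub>t runit\<^sub>t (dom g)"
    using runit\<^sub>t_natural[of f "dom g" "cod g"] runit\<^sub>t_natural[of g "dom g" "cod g"] assms by simp
qed (use assms in auto)

text \<open>Kelly's argument: tensored with \<open>\<one>\<close> on the left, the claim follows
  from the pentagon for \<open>\<one>\<close>, \<open>\<one>\<close>, \<open>X\<close>,
  \<open>Y\<close> and two triangles.\<close>

lemma lunit\<^sub>t_tensor:
  assumes [simp]: "X \<in> Obj C" "Y \<in> Obj C"
  shows "lunit\<^sub>t (X \<otimes> Y) \<circ>\<^sub>t assoc\<^sub>t \<one> X Y = lunit\<^sub>t X \<otimes>\<^sub>t id\<^sub>t Y"
proof (rule tensor_unit_left_faithful)
  let ?p = "assoc\<^sub>t \<one> (\<one> \<otimes> X) Y \<circ>\<^sub>t (assoc\<^sub>t \<one> \<one> X \<otimes>\<^sub>t id\<^sub>t Y)"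
  show "id\<^sub>t \<one> \<otimes>\<^sub>t (lunit\<^sub>t (X \<otimes> Y) \<circ>\<^sub>t assoc\<^sub>t \<one> X Y) = id\<^sub>t \<one> \<otimes>\<^sub>t (lunit\<^sub>t X \<otimes>\<^sub>t id\<^sub>t Y)"
  proof (rule iso\<^sub>t_epi[of ?p])
    have "(id\<^sub>t \<one> \<otimes>\<^sub>t (lunit\<^sub>t (X \<otimes> Y) \<circ>\<^sub>t assoc\<^sub>t \<one> X Y)) \<circ>\<^sub>t ?p
        = (id\<^sub>t \<one> \<otimes>\<^sub>t lunit\<^sub>t (X \<otimes> Y)) \<circ>\<^sub>t (id\<^sub>t \<one> \<otimes>\<^sub>t assoc\<^sub>t \<one> X Y) \<circ>\<^sub>t ?p"
      by (simp add: interchange\<^sub>t')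
    also have "(id\<^sub>t \<one> \<otimes>\<^sub>t assoc\<^sub>t \<one> X Y) \<circ>\<^sub>t ?p = assoc\<^sub>t \<one> \<one> (X \<otimes> Y) \<circ>\<^sub>t assoc\<^sub>t (\<one> \<otimes> \<one>) X Y"
      by (simp add: pentagon\<^sub>t)
    also have "(id\<^sub>t \<one> \<otimes>\<^sub>t lunit\<^sub>t (X \<otimes> Y)) \<circ>\<^sub>t assoc\<^sub>t \<one> \<one> (X \<otimes> Y) \<circ>\<^sub>t assoc\<^sub>t (\<one> \<otimes> \<one>) X Y
        = ((id\<^sub>t \<one> \<otimes>\<^sub>t lunit\<^sub>t (X \<otimes> Y)) \<circ>\<^sub>t assoc\<^sub>t \<one> \<one> (X \<otimes> Y)) \<circ>\<^sub>t assoc\<^sub>t (\<one> \<otimes> \<one>) X Y"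
      by simp
    also have "\<dots> = (runit\<^sub>t \<one> \<otimes>\<^sub>t (id\<^sub>t X \<otimes>\<^sub>t id\<^sub>t Y)) \<circ>\<^sub>t assoc\<^sub>t (\<one> \<otimes> \<one>) X Y"
      by (simp only: triangle\<^sub>t assms tensor_unit_obj tensor\<^sub>t_id)
    also have "\<dots> = assoc\<^sub>t \<one> X Y \<circ>\<^sub>t ((runit\<^sub>t \<one> \<otimes>\<^sub>t id\<^sub>t X) \<otimes>\<^sub>t id\<^sub>t Y)"
      by (rule assoc\<^sub>t_natural[symmetric]) auto
    also have "\<dots> = assoc\<^sub>t \<one> X Y \<circ>\<^sub>t (((id\<^sub>t \<one> \<otimes>\<^sub>t lunit\<^sub>t X) \<circ>\<^sub>t assoc\<^sub>t \<one> \<one> X) \<otimes>\<^sub>t id\<^sub>t Y)"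
      by (simp add: triangle\<^sub>t)
    also have "\<dots> = (assoc\<^sub>t \<one> X Y \<circ>\<^sub>t ((id\<^sub>t \<one> \<otimes>\<^sub>t lunit\<^sub>t X) \<otimes>\<^sub>t id\<^sub>t Y)) \<circ>\<^sub>t (assoc\<^sub>t \<one> \<one> X \<otimes>\<^sub>t id\<^sub>t Y)"
      by (simp add: interchange\<^sub>t)
    also have "assoc\<^sub>t \<one> X Y \<circ>\<^sub>t ((id\<^sub>t \<one> \<otimes>\<^sub>t lunit\<^sub>t X) \<otimes>\<^sub>t id\<^sub>t Y)
        = (id\<^sub>t \<one> \<otimes>\<^sub>t (lunit\<^sub>t X \<otimes>\<^sub>t id\<^sub>t Y)) \<circ>\<^sub>t assoc\<^sub>t \<one> (\<one> \<otimes> X) Y"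
      by (rule assoc\<^sub>t_natural) auto
    finally show "(id\<^sub>t \<one> \<otimes>\<^sub>t (lunit\<^sub>t (X \<otimes> Y) \<circ>\<^sub>t assoc\<^sub>t \<one> X Y)) \<circ>\<^sub>t ?p
        = (id\<^sub>t \<one> \<otimes>\<^sub>t (lunit\<^sub>t X \<otimes>\<^sub>t id\<^sub>t Y)) \<circ>\<^sub>t ?p"
      by simp
  qed auto
qed auto

text \<open>The mirror image, with the pentagon for \<open>X\<close>, \<open>Y\<close>,
  \<open>\<one>\<close>, \<open>\<one>\<close>; the two sides are compared after composing with an
  associator.\<close>

lemma runit\<^sub>t_tensor:
  assumes [simp]: "X \<in> Obj C" "Y \<in> Obj C"
  shows "(id\<^sub>t X \<otimes>\<^sub>t runit\<^sub>t Y) \<circ>\<^sub>t assoc\<^sub>t X Y \<one> = runit\<^sub>t (X \<otimes> Y)"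
proof (rule tensor_unit_right_faithful)
  show "((id\<^sub>t X \<otimes>\<^sub>t runit\<^sub>t Y) \<circ>\<^sub>t assoc\<^sub>t X Y \<one>) \<otimes>\<^sub>t id\<^sub>t \<one> = runit\<^sub>t (X \<otimes> Y) \<otimes>\<^sub>t id\<^sub>t \<one>"
  proof (rule iso\<^sub>t_mono[of "assoc\<^sub>t X Y \<one>"])
    have "assoc\<^sub>t X Y \<one> \<circ>\<^sub>t (((id\<^sub>t X \<otimes>\<^sub>t runit\<^sub>t Y) \<circ>\<^sub>t assoc\<^sub>t X Y \<one>) \<otimes>\<^sub>t id\<^sub>t \<one>)
        = (assoc\<^sub>t X Y \<one> \<circ>\<^sub>t ((id\<^sub>t X \<otimes>\<^sub>t runit\<^sub>t Y) \<otimes>\<^sub>t id\<^sub>t \<one>)) \<circ>\<^sub>t (assoc\<^sub>t X Y \<one> \<otimes>\<^sub>t id\<^sub>t \<one>)"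
      by (simp add: interchange\<^sub>t)
    also have "assoc\<^sub>t X Y \<one> \<circ>\<^sub>t ((id\<^sub>t X \<otimes>\<^sub>t runit\<^sub>t Y) \<otimes>\<^sub>t id\<^sub>t \<one>)
        = (id\<^sub>t X \<otimes>\<^sub>t (runit\<^sub>t Y \<otimes>\<^sub>t id\<^sub>t \<one>)) \<circ>\<^sub>t assoc\<^sub>t X (Y \<otimes> \<one>) \<one>"
      by (rule assoc\<^sub>t_natural) auto
    also have "runit\<^sub>t Y \<otimes>\<^sub>t id\<^sub>t \<one> = (id\<^sub>t Y \<otimes>\<^sub>t lunit\<^sub>t \<one>) \<circ>\<^sub>t assoc\<^sub>t Y \<one> \<one>"
      by (simp add: triangle\<^sub>t)
    also have "((id\<^sub>t X \<otimes>\<^sub>t ((id\<^sub>t Y \<otimes>\<^sub>t lunit\<^sub>t \<one>) \<circ>\<^sub>t assoc\<^sub>t Y \<one> \<one>)) \<circ>\<^sub>t assoc\<^sub>t X (Y \<otimes> \<one>) \<one>) \<circ>\<^sub>t (assoc\<^sub>t X Y \<one> \<otimes>\<^sub>t id\<^sub>t \<one>)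
      = (id\<^sub>t X \<otimes>\<^sub>t (id\<^sub>t Y \<otimes>\<^sub>t lunit\<^sub>t \<one>)) \<circ>\<^sub>t (id\<^sub>t X \<otimes>\<^sub>t assoc\<^sub>t Y \<one> \<one>) \<circ>\<^sub>t assoc\<^sub>t X (Y \<otimes> \<one>) \<one> \<circ>\<^sub>t (assoc\<^sub>t X Y \<one> \<otimes>\<^sub>t id\<^sub>t \<one>)"
      by (simp add: interchange\<^sub>t')
    also have "(id\<^sub>t X \<otimes>\<^sub>t assoc\<^sub>t Y \<one> \<one>) \<circ>\<^sub>t assoc\<^sub>t X (Y \<otimes> \<one>) \<one> \<circ>\<^sub>t (assoc\<^sub>t X Y \<one> \<otimes>\<^sub>t id\<^sub>t \<one>)
      = assoc\<^sub>t X Y (\<one> \<otimes> \<one>) \<circ>\<^sub>t assoc\<^sub>t (X \<otimes> Y) \<one> \<one>"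
      by (simp add: pentagon\<^sub>t)
    also have "(id\<^sub>t X \<otimes>\<^sub>t (id\<^sub>t Y \<otimes>\<^sub>t lunit\<^sub>t \<one>)) \<circ>\<^sub>t assoc\<^sub>t X Y (\<one> \<otimes> \<one>) \<circ>\<^sub>t assoc\<^sub>t (X \<otimes> Y) \<one> \<one>
      = ((id\<^sub>t X \<otimes>\<^sub>t (id\<^sub>t Y \<otimes>\<^sub>t lunit\<^sub>t \<one>)) \<circ>\<^sub>t assoc\<^sub>t X Y (\<one> \<otimes> \<one>)) \<circ>\<^sub>t assoc\<^sub>t (X \<otimes> Y) \<one> \<one>"
      by simp
    also have "(id\<^sub>t X \<otimes>\<^sub>t (id\<^sub>t Y \<otimes>\<^sub>t lunit\<^sub>t \<one>)) \<circ>\<^sub>t assoc\<^sub>t X Y (\<one> \<otimes> \<one>) = assoc\<^sub>t X Y \<one> \<circ>\<^sub>t ((id\<^sub>t X \<otimes>\<^sub>t id\<^sub>t Y) \<otimes>\<^sub>t lunit\<^sub>t \<one>)"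
      by (rule assoc\<^sub>t_natural[symmetric]) auto
    also have "(assoc\<^sub>t X Y \<one> \<circ>\<^sub>t ((id\<^sub>t X \<otimes>\<^sub>t id\<^sub>t Y) \<otimes>\<^sub>t lunit\<^sub>t \<one>)) \<circ>\<^sub>t assoc\<^sub>t (X \<otimes> Y) \<one> \<one>
      = assoc\<^sub>t X Y \<one> \<circ>\<^sub>t (runit\<^sub>t (X \<otimes> Y) \<otimes>\<^sub>t id\<^sub>t \<one>)"
      by (simp add: triangle\<^sub>t)
    finally show "assoc\<^sub>t X Y \<one> \<circ>\<^sub>t (((id\<^sub>t X \<otimes>\<^sub>t runit\<^sub>t Y) \<circ>\<^sub>t assoc\<^sub>t X Y \<one>) \<otimes>\<^sub>t id\<^sub>t \<one>)
        = assoc\<^sub>t X Y \<one> \<circ>\<^sub>t (runit\<^sub>t (X \<otimes> Y) \<otimes>\<^sub>t id\<^sub>t \<one>)" .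
  qed auto
qed auto

text \<open>Naturality identifies \<open>lunit\<close> of \<open>\<one> \<otimes> \<one>\<close>
  with the identity tensored with \<open>lunit\<close>; then \<open>lunit\<^sub>t_tensor\<close> and
  the triangle have the same left-hand side.\<close>

lemma lunit\<^sub>t_unit: "lunit\<^sub>t \<one> = runit\<^sub>t \<one>"
proof (rule tensor_unit_right_faithful)
  have "lunit\<^sub>t (\<one> \<otimes> \<one>) = id\<^sub>t \<one> \<otimes>\<^sub>t lunit\<^sub>t \<one>"
  proof (rule iso\<^sub>t_mono[of "lunit\<^sub>t \<one>"])
    show "lunit\<^sub>t \<one> \<circ>\<^sub>t lunit\<^sub>t (\<one> \<otimes> \<one>) = lunit\<^sub>t \<one> \<circ>\<^sub>t (id\<^sub>t \<one> \<otimes>\<^sub>t lunit\<^sub>t \<one>)"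
      by (rule lunit\<^sub>t_natural[symmetric]) auto
  qed auto
  then show "lunit\<^sub>t \<one> \<otimes>\<^sub>t id\<^sub>t \<one> = runit\<^sub>t \<one> \<otimes>\<^sub>t id\<^sub>t \<one>"
    using lunit\<^sub>t_tensor[of \<one> \<one>] triangle\<^sub>t[of \<one> \<one>] by simp
qed auto

text \<open>
  Objects of the strictification are lists, read as the right-nested tensor product \<open>T\<close>; its morphisms
  \<open>l \<rightarrow> m\<close> are those from \<open>T l\<close> to \<open>T m\<close>, transported along \<open>phi l m : T l \<otimes> T m \<rightarrow> T (l @ m)\<close> when tensored.
  The correction \<open>psi\<close> arranges \<open>T [X] = X\<close> rather than \<open>X \<otimes> \<one>\<close>, so that \<open>C\<close> itself embeds without change of morphisms.
\<close>
fun T :: "'a list \<Rightarrow> 'a" where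
  "T [] = \<one>"
| "T [X] = X"
| "T (X # Y # l) = X \<otimes> T (Y # l)"

definition psi :: "'a \<Rightarrow> 'a list \<Rightarrow> ('a, 'b) typed" where
  "psi X l = (if l = [] then runit\<^sub>t X else id\<^sub>t (X \<otimes> T l))"

primrec phi :: "'a list \<Rightarrow> 'a list \<Rightarrow> ('a, 'b) typed" where
  "phi [] m = lunit\<^sub>t (T m)"
| "phi (X # l) m = psi X (l @ m) \<circ>\<^sub>t (id\<^sub>t X \<otimes>\<^sub>t phi l m) \<circ>\<^sub>t assoc\<^sub>t X (T l) (T m) \<circ>\<^sub>t (inv\<^sub>t (psi X l) \<otimes>\<^sub>t id\<^sub>t (T m))"

abbreviation objs :: "'a list \<Rightarrow> bool" where "objs l \<equiv> set l \<subseteq> Obj C"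

lemma T_obj [simp]: "objs l \<Longrightarrow> T l \<in> Obj C"
  by (induction l rule: T.induct) auto

lemma T_Cons: "T (X # l) = (if l = [] then X else X \<otimes> T l)"
  by (cases l) auto

lemma psi_sel [simp]: "dom (psi X l) = X \<otimes> T l" "cod (psi X l) = T (X # l)"
  by (auto simp: psi_def T_Cons)

lemma iso_psi [simp]: "X \<in> Obj C \<Longrightarrow> objs l \<Longrightarrow> iso\<^sub>t (psi X l)"
  by (auto simp: psi_def)

lemma phi_sel [simp]: "dom (phi l m) = T l \<otimes> T m" "cod (phi l m) = T (l @ m)"
  by (cases l; simp)+

lemma iso_phi [simp]: "objs l \<Longrightarrow> objs m \<Longrightarrow> iso\<^sub>t (phi l m)"
proof (induction l)
  case (Cons X l)
  then show ?case by simp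
qed simp

lemma phi_Nil_right: "objs l \<Longrightarrow> phi l [] = runit\<^sub>t (T l)"
proof (induction l)
  case (Cons X l)
  then have [simp]: "X \<in> Obj C" "objs l" by auto
  have "phi (X # l) [] = psi X l \<circ>\<^sub>t ((id\<^sub>t X \<otimes>\<^sub>t runit\<^sub>t (T l)) \<circ>\<^sub>t assoc\<^sub>t X (T l) \<one>) \<circ>\<^sub>t (inv\<^sub>t (psi X l) \<otimes>\<^sub>t id\<^sub>t \<one>)"
    using Cons by simp
  also have "\<dots> = psi X l \<circ>\<^sub>t runit\<^sub>t (X \<otimes> T l) \<circ>\<^sub>t (inv\<^sub>t (psi X l) \<otimes>\<^sub>t id\<^sub>t \<one>)"
    by (simp add: runit\<^sub>t_tensor)
  also have "\<dots> = psi X l \<circ>\<^sub>t inv\<^sub>t (psi X l) \<circ>\<^sub>t runit\<^sub>t (T (X # l))"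
    by (simp add: runit\<^sub>t_natural)
  finally show ?case by simp
qed (simp add: lunit\<^sub>t_unit)

text \<open>The inverse of \<open>runit\<close> coming from \<open>psi\<close> cancels, by the
  triangle, against the \<open>lunit\<close> coming from \<open>phi []\<close>. This is the effect
  of the convention \<open>T [X] = X\<close>.\<close>

lemma phi_single: "\<lbrakk>X \<in> Obj C; objs m; m \<noteq> []\<rbrakk> \<Longrightarrow> phi [X] m = id\<^sub>t (X \<otimes> T m)"
proof -
  assume [simp]: "X \<in> Obj C" "objs m" "m \<noteq> []"
  have "phi [X] m = ((id\<^sub>t X \<otimes>\<^sub>t lunit\<^sub>t (T m)) \<circ>\<^sub>t assoc\<^sub>t X \<one> (T m)) \<circ>\<^sub>t (inv\<^sub>t (runit\<^sub>t X) \<otimes>\<^sub>t id\<^sub>t (T m))"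
    by (simp add: psi_def)
  also have "\<dots> = (runit\<^sub>t X \<otimes>\<^sub>t id\<^sub>t (T m)) \<circ>\<^sub>t (inv\<^sub>t (runit\<^sub>t X) \<otimes>\<^sub>t id\<^sub>t (T m))"
    by (simp only: triangle\<^sub>t T_obj \<open>X \<in> Obj C\<close> \<open>objs m\<close>)
  finally show ?thesis by (simp add: interchange\<^sub>t)
qed

text \<open>The coherence condition behind associativity of the strict tensor product. In the
  inductive step naturality of the associator moves the head \<open>X\<close> to the outside, and
  the pentagon for \<open>X\<close>, \<open>T a\<close>, \<open>T b\<close>, \<open>T c\<close> does
  the rebracketing.\<close>

lemma phi_assoc:
  "\<lbrakk>objs a; objs b; objs c\<rbrakk> \<Longrightarrow> phi (a @ b) c \<circ>\<^sub>t (phi a b \<otimes>\<^sub>t id\<^sub>t (T c))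
    = phi a (b @ c) \<circ>\<^sub>t (id\<^sub>t (T a) \<otimes>\<^sub>t phi b c) \<circ>\<^sub>t assoc\<^sub>t (T a) (T b) (T c)"
proof (induction a)
  case Nil
  then have "phi [] (b @ c) \<circ>\<^sub>t (id\<^sub>t (T []) \<otimes>\<^sub>t phi b c) \<circ>\<^sub>t assoc\<^sub>t (T []) (T b) (T c)
    = (lunit\<^sub>t (T (b @ c)) \<circ>\<^sub>t (id\<^sub>t \<one> \<otimes>\<^sub>t phi b c)) \<circ>\<^sub>t assoc\<^sub>t \<one> (T b) (T c)"
    by simp
  also have "lunit\<^sub>t (T (b @ c)) \<circ>\<^sub>t (id\<^sub>t \<one> \<otimes>\<^sub>t phi b c) = phi b c \<circ>\<^sub>t lunit\<^sub>t (T b \<otimes> T c)"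
    using Nil by (simp add: lunit\<^sub>t_natural)
  finally show ?case using Nil by (simp add: lunit\<^sub>t_tensor)
next
  case (Cons X a)
  then have [simp]: "X \<in> Obj C" "objs a" "objs b" "objs c" by auto
  let ?A = "T a" and ?B = "T b" and ?C = "T c"
  let ?s = "inv\<^sub>t (psi X a)"
  have "phi ((X # a) @ b) c \<circ>\<^sub>t (phi (X # a) b \<otimes>\<^sub>t id\<^sub>t ?C)
    = psi X (a @ b @ c) \<circ>\<^sub>t (id\<^sub>t X \<otimes>\<^sub>t phi (a @ b) c) \<circ>\<^sub>t assoc\<^sub>t X (T (a @ b)) ?C \<circ>\<^sub>t
        (((id\<^sub>t X \<otimes>\<^sub>t phi a b) \<otimes>\<^sub>t id\<^sub>t ?C) \<circ>\<^sub>t (assoc\<^sub>t X ?A ?B \<otimes>\<^sub>t id\<^sub>t ?C) \<circ>\<^sub>t ((?s \<otimes>\<^sub>t id\<^sub>t ?B) \<otimes>\<^sub>t id\<^sub>t ?C))"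
    by (simp add: interchange\<^sub>t)
  also have "\<dots> = psi X (a @ b @ c) \<circ>\<^sub>t (id\<^sub>t X \<otimes>\<^sub>t phi (a @ b) c) \<circ>\<^sub>t (assoc\<^sub>t X (T (a @ b)) ?C \<circ>\<^sub>t
        ((id\<^sub>t X \<otimes>\<^sub>t phi a b) \<otimes>\<^sub>t id\<^sub>t ?C)) \<circ>\<^sub>t (assoc\<^sub>t X ?A ?B \<otimes>\<^sub>t id\<^sub>t ?C) \<circ>\<^sub>t ((?s \<otimes>\<^sub>t id\<^sub>t ?B) \<otimes>\<^sub>t id\<^sub>t ?C)"
    by simp
  also have "assoc\<^sub>t X (T (a @ b)) ?C \<circ>\<^sub>t ((id\<^sub>t X \<otimes>\<^sub>t phi a b) \<otimes>\<^sub>t id\<^sub>t ?C)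
     = (id\<^sub>t X \<otimes>\<^sub>t (phi a b \<otimes>\<^sub>t id\<^sub>t ?C)) \<circ>\<^sub>t assoc\<^sub>t X (?A \<otimes> ?B) ?C"
    by (rule assoc\<^sub>t_natural) auto
  also have "psi X (a @ b @ c) \<circ>\<^sub>t (id\<^sub>t X \<otimes>\<^sub>t phi (a @ b) c) \<circ>\<^sub>t ((id\<^sub>t X \<otimes>\<^sub>t (phi a b \<otimes>\<^sub>t id\<^sub>t ?C)) \<circ>\<^sub>t assoc\<^sub>t X (?A \<otimes> ?B) ?C)
       \<circ>\<^sub>t (assoc\<^sub>t X ?A ?B \<otimes>\<^sub>t id\<^sub>t ?C) \<circ>\<^sub>t ((?s \<otimes>\<^sub>t id\<^sub>t ?B) \<otimes>\<^sub>t id\<^sub>t ?C)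
     = psi X (a @ b @ c) \<circ>\<^sub>t (id\<^sub>t X \<otimes>\<^sub>t (phi (a @ b) c \<circ>\<^sub>t (phi a b \<otimes>\<^sub>t id\<^sub>t ?C))) \<circ>\<^sub>t assoc\<^sub>t X (?A \<otimes> ?B) ?C
       \<circ>\<^sub>t (assoc\<^sub>t X ?A ?B \<otimes>\<^sub>t id\<^sub>t ?C) \<circ>\<^sub>t ((?s \<otimes>\<^sub>t id\<^sub>t ?B) \<otimes>\<^sub>t id\<^sub>t ?C)"
    by (simp add: interchange\<^sub>t')
  also have "phi (a @ b) c \<circ>\<^sub>t (phi a b \<otimes>\<^sub>t id\<^sub>t ?C) = phi a (b @ c) \<circ>\<^sub>t (id\<^sub>t ?A \<otimes>\<^sub>t phi b c) \<circ>\<^sub>t assoc\<^sub>t ?A ?B ?C"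
    using Cons by simp
  also have "psi X (a @ b @ c) \<circ>\<^sub>t (id\<^sub>t X \<otimes>\<^sub>t (phi a (b @ c) \<circ>\<^sub>t (id\<^sub>t ?A \<otimes>\<^sub>t phi b c) \<circ>\<^sub>t assoc\<^sub>t ?A ?B ?C)) \<circ>\<^sub>t assoc\<^sub>t X (?A \<otimes> ?B) ?C
       \<circ>\<^sub>t (assoc\<^sub>t X ?A ?B \<otimes>\<^sub>t id\<^sub>t ?C) \<circ>\<^sub>t ((?s \<otimes>\<^sub>t id\<^sub>t ?B) \<otimes>\<^sub>t id\<^sub>t ?C)
     = psi X (a @ b @ c) \<circ>\<^sub>t (id\<^sub>t X \<otimes>\<^sub>t (phi a (b @ c) \<circ>\<^sub>t (id\<^sub>t ?A \<otimes>\<^sub>t phi b c))) \<circ>\<^sub>t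
       ((id\<^sub>t X \<otimes>\<^sub>t assoc\<^sub>t ?A ?B ?C) \<circ>\<^sub>t assoc\<^sub>t X (?A \<otimes> ?B) ?C
       \<circ>\<^sub>t (assoc\<^sub>t X ?A ?B \<otimes>\<^sub>t id\<^sub>t ?C)) \<circ>\<^sub>t ((?s \<otimes>\<^sub>t id\<^sub>t ?B) \<otimes>\<^sub>t id\<^sub>t ?C)"
    by (simp add: interchange\<^sub>t')
  also have "(id\<^sub>t X \<otimes>\<^sub>t assoc\<^sub>t ?A ?B ?C) \<circ>\<^sub>t assoc\<^sub>t X (?A \<otimes> ?B) ?C \<circ>\<^sub>t (assoc\<^sub>t X ?A ?B \<otimes>\<^sub>t id\<^sub>t ?C)
     = assoc\<^sub>t X ?A (?B \<otimes> ?C) \<circ>\<^sub>t assoc\<^sub>t (X \<otimes> ?A) ?B ?C"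
    by (simp add: pentagon\<^sub>t)
  also have "psi X (a @ b @ c) \<circ>\<^sub>t (id\<^sub>t X \<otimes>\<^sub>t (phi a (b @ c) \<circ>\<^sub>t (id\<^sub>t ?A \<otimes>\<^sub>t phi b c))) \<circ>\<^sub>t
       (assoc\<^sub>t X ?A (?B \<otimes> ?C) \<circ>\<^sub>t assoc\<^sub>t (X \<otimes> ?A) ?B ?C) \<circ>\<^sub>t ((?s \<otimes>\<^sub>t id\<^sub>t ?B) \<otimes>\<^sub>t id\<^sub>t ?C)
     = psi X (a @ b @ c) \<circ>\<^sub>t (id\<^sub>t X \<otimes>\<^sub>t phi a (b @ c)) \<circ>\<^sub>t ((id\<^sub>t X \<otimes>\<^sub>t (id\<^sub>t ?A \<otimes>\<^sub>t phi b c)) \<circ>\<^sub>t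
       assoc\<^sub>t X ?A (?B \<otimes> ?C)) \<circ>\<^sub>t (assoc\<^sub>t (X \<otimes> ?A) ?B ?C \<circ>\<^sub>t ((?s \<otimes>\<^sub>t id\<^sub>t ?B) \<otimes>\<^sub>t id\<^sub>t ?C))"
    by (simp add: interchange\<^sub>t')
  also have "assoc\<^sub>t (X \<otimes> ?A) ?B ?C \<circ>\<^sub>t ((?s \<otimes>\<^sub>t id\<^sub>t ?B) \<otimes>\<^sub>t id\<^sub>t ?C) = (?s \<otimes>\<^sub>t (id\<^sub>t ?B \<otimes>\<^sub>t id\<^sub>t ?C)) \<circ>\<^sub>t assoc\<^sub>t (T (X # a)) ?B ?C"
    by (rule assoc\<^sub>t_natural) auto
  also have "(id\<^sub>t X \<otimes>\<^sub>t (id\<^sub>t ?A \<otimes>\<^sub>t phi b c)) \<circ>\<^sub>t assoc\<^sub>t X ?A (?B \<otimes> ?C) = assoc\<^sub>t X ?A (T (b @ c)) \<circ>\<^sub>t ((id\<^sub>t X \<otimes>\<^sub>t id\<^sub>t ?A) \<otimes>\<^sub>t phi b c)"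
    by (rule assoc\<^sub>t_natural[symmetric]) auto
  also have "psi X (a @ b @ c) \<circ>\<^sub>t (id\<^sub>t X \<otimes>\<^sub>t phi a (b @ c)) \<circ>\<^sub>t (assoc\<^sub>t X ?A (T (b @ c)) \<circ>\<^sub>t ((id\<^sub>t X \<otimes>\<^sub>t id\<^sub>t ?A) \<otimes>\<^sub>t phi b c))
       \<circ>\<^sub>t (?s \<otimes>\<^sub>t (id\<^sub>t ?B \<otimes>\<^sub>t id\<^sub>t ?C)) \<circ>\<^sub>t assoc\<^sub>t (T (X # a)) ?B ?C
     = phi (X # a) (b @ c) \<circ>\<^sub>t (id\<^sub>t (T (X # a)) \<otimes>\<^sub>t phi b c) \<circ>\<^sub>t assoc\<^sub>t (T (X # a)) ?B ?C"
    by (simp add: interchange\<^sub>t')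
  finally show ?case .
qed

text \<open>An arrow of the strictification records source and target lists, as \<open>T\<close> is not injective.\<close>
definition sarr :: "('a list, ('a, 'b) typed) typed \<Rightarrow> bool" where
  "sarr f \<longleftrightarrow> objs (dom f) \<and> objs (cod f) \<and> valid (mor f) \<and> dom (mor f) = T (dom f) \<and> cod (mor f) = T (cod f)"

definition sid :: "'a list \<Rightarrow> ('a list, ('a, 'b) typed) typed" where
  "sid l = Typed l l (id\<^sub>t (T l))"

definition scomp where
  "scomp g f = Typed (dom f) (cod g) (mor g \<circ>\<^sub>t mor f)"

definition stensor where
  "stensor f g = Typed (dom f @ dom g) (cod f @ cod g)
    (phi (cod f) (cod g) \<circ>\<^sub>t (mor f \<otimes>\<^sub>t mor g) \<circ>\<^sub>t inv\<^sub>t (phi (dom f) (dom g)))"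

definition sadd where
  "sadd f g = Typed (dom f) (cod f) (add\<^sub>t (mor f) (mor g))"

definition ssmul where
  "ssmul a f = Typed (dom f) (cod f) (smul\<^sub>t a (mor f))"

lemma strict_sel [simp]:
  "dom (sid l) = l" "cod (sid l) = l" "mor (sid l) = id\<^sub>t (T l)"
  "dom (scomp g f) = dom f" "cod (scomp g f) = cod g" "mor (scomp g f) = mor g \<circ>\<^sub>t mor f"
  "dom (stensor f g) = dom f @ dom g" "cod (stensor f g) = cod f @ cod g"
  "mor (stensor f g) = phi (cod f) (cod g) \<circ>\<^sub>t (mor f \<otimes>\<^sub>t mor g) \<circ>\<^sub>t inv\<^sub>t (phi (dom f) (dom g))"
  "dom (sadd f g) = dom f" "cod (sadd f g) = cod f" "mor (sadd f g) = add\<^sub>t (mor f) (mor g)"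
  "dom (ssmul a f) = dom f" "cod (ssmul a f) = cod f" "mor (ssmul a f) = smul\<^sub>t a (mor f)"
  by (auto simp: sid_def scomp_def stensor_def sadd_def ssmul_def)

lemma sarrD [simp]:
  assumes "sarr f"
  shows "objs (dom f)" "objs (cod f)" "valid (mor f)" "dom (mor f) = T (dom f)" "cod (mor f) = T (cod f)"
  using assms by (auto simp: sarr_def)

lemma sarrI:
  assumes "objs (dom f)" "objs (cod f)" "valid (mor f)" "dom (mor f) = T (dom f)" "cod (mor f) = T (cod f)"
  shows "sarr f"
  using assms unfolding sarr_def by blast

lemma sarr_ops [simp]:
  "objs l \<Longrightarrow> sarr (sid l)"
  "\<lbrakk>sarr g; sarr f; dom g = cod f\<rbrakk> \<Longrightarrow> sarr (scomp g f)"
  "\<lbrakk>sarr g; sarr f\<rbrakk> \<Longrightarrow> sarr (stensor g f)"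
  "\<lbrakk>sarr g; sarr f; dom g = dom f; cod g = cod f\<rbrakk> \<Longrightarrow> sarr (sadd g f)"
  "sarr f \<Longrightarrow> sarr (ssmul a f)"
  by (rule sarrI; simp)+

lemma typed_eqI: "\<lbrakk>dom f = dom g; cod f = cod g; mor f = mor g\<rbrakk> \<Longrightarrow> f = (g :: ('x, 'y) typed)"
  by (cases f; cases g) auto

text \<open>A common comparison isomorphism for both bracketings of a triple product.\<close>

abbreviation phi3 where
  "phi3 a b c \<equiv> phi a (b @ c) \<circ>\<^sub>t (id\<^sub>t (T a) \<otimes>\<^sub>t phi b c) \<circ>\<^sub>t assoc\<^sub>t (T a) (T b) (T c)"

text \<open>Transported along \<open>phi3\<close>, either bracketing of the strict product becomes
  the same triple tensor product in \<open>C\<close>; since \<open>phi3\<close> is invertible, the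
  bracketings agree.\<close>

lemma stensor3_left:
  assumes "sarr f" "sarr g" "sarr h"
  shows "mor (stensor (stensor f g) h) \<circ>\<^sub>t phi3 (dom f) (dom g) (dom h)
    = phi3 (cod f) (cod g) (cod h) \<circ>\<^sub>t ((mor f \<otimes>\<^sub>t mor g) \<otimes>\<^sub>t mor h)"
proof -
  note A = assms sarrD[OF assms(1)] sarrD[OF assms(2)] sarrD[OF assms(3)]
  let ?M = "mor (stensor f g)"
  have "mor (stensor (stensor f g) h) \<circ>\<^sub>t phi3 (dom f) (dom g) (dom h)
     = mor (stensor (stensor f g) h) \<circ>\<^sub>t (phi (dom f @ dom g) (dom h) \<circ>\<^sub>t (phi (dom f) (dom g) \<otimes>\<^sub>t id\<^sub>t (T (dom h))))"
    using phi_assoc[of "dom f" "dom g" "dom h"] A by simp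
  also have "\<dots> = phi (cod f @ cod g) (cod h) \<circ>\<^sub>t (?M \<otimes>\<^sub>t mor h) \<circ>\<^sub>t (phi (dom f) (dom g) \<otimes>\<^sub>t id\<^sub>t (T (dom h)))"
    using A by simp
  also have "\<dots> = phi (cod f @ cod g) (cod h) \<circ>\<^sub>t (phi (cod f) (cod g) \<otimes>\<^sub>t id\<^sub>t (T (cod h))) \<circ>\<^sub>t ((mor f \<otimes>\<^sub>t mor g) \<otimes>\<^sub>t mor h)"
    using A by (simp add: interchange\<^sub>t)
  also have "\<dots> = (phi (cod f @ cod g) (cod h) \<circ>\<^sub>t (phi (cod f) (cod g) \<otimes>\<^sub>t id\<^sub>t (T (cod h)))) \<circ>\<^sub>t ((mor f \<otimes>\<^sub>t mor g) \<otimes>\<^sub>t mor h)"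
    using A by simp
  also have "phi (cod f @ cod g) (cod h) \<circ>\<^sub>t (phi (cod f) (cod g) \<otimes>\<^sub>t id\<^sub>t (T (cod h))) = phi3 (cod f) (cod g) (cod h)"
    using A by (intro phi_assoc) auto
  finally show ?thesis .
qed

lemma stensor3_right:
  assumes "sarr f" "sarr g" "sarr h"
  shows "mor (stensor f (stensor g h)) \<circ>\<^sub>t phi3 (dom f) (dom g) (dom h)
    = phi3 (cod f) (cod g) (cod h) \<circ>\<^sub>t ((mor f \<otimes>\<^sub>t mor g) \<otimes>\<^sub>t mor h)"
proof -
  note A = assms sarrD[OF assms(1)] sarrD[OF assms(2)] sarrD[OF assms(3)]
  have "mor (stensor f (stensor g h)) \<circ>\<^sub>t phi3 (dom f) (dom g) (dom h)
     = phi (cod f) (cod g @ cod h) \<circ>\<^sub>t (mor f \<otimes>\<^sub>t mor (stensor g h)) \<circ>\<^sub>t (id\<^sub>t (T (dom f)) \<otimes>\<^sub>t phi (dom g) (dom h)) 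
        \<circ>\<^sub>t assoc\<^sub>t (T (dom f)) (T (dom g)) (T (dom h))"
    using A by simp
  also have "\<dots> = phi (cod f) (cod g @ cod h) \<circ>\<^sub>t (id\<^sub>t (T (cod f)) \<otimes>\<^sub>t phi (cod g) (cod h)) \<circ>\<^sub>t ((mor f \<otimes>\<^sub>t (mor g \<otimes>\<^sub>t mor h)) 
        \<circ>\<^sub>t assoc\<^sub>t (T (dom f)) (T (dom g)) (T (dom h)))"
    using A by (simp add: interchange\<^sub>t')
  also have "(mor f \<otimes>\<^sub>t (mor g \<otimes>\<^sub>t mor h)) \<circ>\<^sub>t assoc\<^sub>t (T (dom f)) (T (dom g)) (T (dom h))
     = assoc\<^sub>t (T (cod f)) (T (cod g)) (T (cod h)) \<circ>\<^sub>t ((mor f \<otimes>\<^sub>t mor g) \<otimes>\<^sub>t mor h)"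
    using A by (intro assoc\<^sub>t_natural[symmetric]) auto
  finally show ?thesis using A by simp
qed

lemma stensor_assoc:
  assumes "sarr f" "sarr g" "sarr h"
  shows "stensor (stensor f g) h = stensor f (stensor g h)"
proof (rule typed_eqI)
  note A = assms sarrD[OF assms(1)] sarrD[OF assms(2)] sarrD[OF assms(3)]
  show "mor (stensor (stensor f g) h) = mor (stensor f (stensor g h))"
  proof (rule iso\<^sub>t_epi)
    show "mor (stensor (stensor f g) h) \<circ>\<^sub>t phi3 (dom f) (dom g) (dom h) 
      = mor (stensor f (stensor g h)) \<circ>\<^sub>t phi3 (dom f) (dom g) (dom h)"
      unfolding stensor3_left[OF assms] stensor3_right[OF assms] ..
  qed (use A in \<open>auto simp del: strict_sel(9)\<close>)
qed auto

end

section \<open>Braiding and twist of the strictification\<close>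

context ribbon_fusion_category
begin

definition braid\<^sub>t :: "'a \<Rightarrow> 'a \<Rightarrow> ('a, 'b) typed" where
  "braid\<^sub>t X Y = Typed (X \<otimes> Y) (Y \<otimes> X) (braid C X Y)"

definition twist\<^sub>t :: "'a \<Rightarrow> ('a, 'b) typed" where
  "twist\<^sub>t X = Typed X X (twist C X)"

lemma braid\<^sub>t_sel [simp]:
  "dom (braid\<^sub>t X Y) = X \<otimes> Y" "cod (braid\<^sub>t X Y) = Y \<otimes> X" "mor (braid\<^sub>t X Y) = braid C X Y"
  "dom (twist\<^sub>t X) = X" "cod (twist\<^sub>t X) = X" "mor (twist\<^sub>t X) = twist C X"
  by (auto simp: braid\<^sub>t_def twist\<^sub>t_def)

lemma iso_braid\<^sub>t [simp]: "\<lbrakk>X \<in> Obj C; Y \<in> Obj C\<rbrakk> \<Longrightarrow> iso\<^sub>t (braid\<^sub>t X Y)"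
  and iso_twist\<^sub>t [simp]: "X \<in> Obj C \<Longrightarrow> iso\<^sub>t (twist\<^sub>t X)"
  using braid_iso[of X Y] twist_iso[of X]
  by (auto simp: iso\<^sub>t_def valid_def iso_in_def inverse_pair_def simp del: valid_obj iso\<^sub>t_inv(1))

lemma braid\<^sub>t_natural:
  "\<lbrakk>valid f; valid g; dom f = X; cod f = X'; dom g = Y; cod g = Y'\<rbrakk>
    \<Longrightarrow> braid\<^sub>t X' Y' \<circ>\<^sub>t (f \<otimes>\<^sub>t g) = (g \<otimes>\<^sub>t f) \<circ>\<^sub>t braid\<^sub>t X Y"
  using braid_natural[of X Y X' Y' "mor f" "mor g"]
  by (auto simp: valid_def comp\<^sub>t_def tensor\<^sub>t_def simp del: valid_obj)

lemma twist\<^sub>t_natural: "\<lbrakk>valid f; dom f = X; cod f = Y\<rbrakk> \<Longrightarrow> twist\<^sub>t Y \<circ>\<^sub>t f = f \<circ>\<^sub>t twist\<^sub>t X"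
  using twist_natural[of X Y "mor f"]
  by (auto simp: valid_def comp\<^sub>t_def simp del: valid_obj)

lemma twist\<^sub>t_tensor: "\<lbrakk>X \<in> Obj C; Y \<in> Obj C\<rbrakk>
    \<Longrightarrow> twist\<^sub>t (X \<otimes> Y) = braid\<^sub>t Y X \<circ>\<^sub>t braid\<^sub>t X Y \<circ>\<^sub>t (twist\<^sub>t X \<otimes>\<^sub>t twist\<^sub>t Y)"
  by (simp add: comp\<^sub>t_def tensor\<^sub>t_def twist_tensor twist\<^sub>t_def)

lemma hexagon1\<^sub>t: "\<lbrakk>X \<in> Obj C; Y \<in> Obj C; Z \<in> Obj C\<rbrakk>
    \<Longrightarrow> assoc\<^sub>t Y Z X \<circ>\<^sub>t braid\<^sub>t X (Y \<otimes> Z) \<circ>\<^sub>t assoc\<^sub>t X Y Z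
      = (id\<^sub>t Y \<otimes>\<^sub>t braid\<^sub>t X Z) \<circ>\<^sub>t assoc\<^sub>t Y X Z \<circ>\<^sub>t (braid\<^sub>t X Y \<otimes>\<^sub>t id\<^sub>t Z)"
  by (simp add: comp\<^sub>t_def tensor\<^sub>t_def assoc\<^sub>t_def id\<^sub>t_def hexagon1)

lemma hexagon2\<^sub>t: "\<lbrakk>X \<in> Obj C; Y \<in> Obj C; Z \<in> Obj C\<rbrakk>
    \<Longrightarrow> inv\<^sub>t (assoc\<^sub>t Z X Y) \<circ>\<^sub>t braid\<^sub>t (X \<otimes> Y) Z \<circ>\<^sub>t inv\<^sub>t (assoc\<^sub>t X Y Z)
      = (braid\<^sub>t X Z \<otimes>\<^sub>t id\<^sub>t Y) \<circ>\<^sub>t inv\<^sub>t (assoc\<^sub>t X Z Y) \<circ>\<^sub>t (id\<^sub>t X \<otimes>\<^sub>t braid\<^sub>t Y Z)"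
  by (simp add: comp\<^sub>t_def tensor\<^sub>t_def assoc\<^sub>t_def id\<^sub>t_def inv\<^sub>t_def hexagon2)

definition sbraid where
  "sbraid l m = Typed (l @ m) (m @ l) (phi m l \<circ>\<^sub>t braid\<^sub>t (T l) (T m) \<circ>\<^sub>t inv\<^sub>t (phi l m))"

definition stwist where
  "stwist l = Typed l l (twist\<^sub>t (T l))"

lemma sbraid_sel [simp]:
  "dom (sbraid l m) = l @ m" "cod (sbraid l m) = m @ l"
  "mor (sbraid l m) = phi m l \<circ>\<^sub>t braid\<^sub>t (T l) (T m) \<circ>\<^sub>t inv\<^sub>t (phi l m)"
  "dom (stwist l) = l" "cod (stwist l) = l" "mor (stwist l) = twist\<^sub>t (T l)"
  by (auto simp: sbraid_def stwist_def)

lemma sarr_braid [simp]: "\<lbrakk>objs l; objs m\<rbrakk> \<Longrightarrow> sarr (sbraid l m)" "objs l \<Longrightarrow> sarr (stwist l)"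
  by (rule sarrI; simp)+

lemma phi_assoc': "\<lbrakk>objs a; objs b; objs c; valid k; cod k = (T a \<otimes> T b) \<otimes> T c\<rbrakk> \<Longrightarrow>
    phi (a @ b) c \<circ>\<^sub>t (phi a b \<otimes>\<^sub>t id\<^sub>t (T c)) \<circ>\<^sub>t k
    = phi a (b @ c) \<circ>\<^sub>t (id\<^sub>t (T a) \<otimes>\<^sub>t phi b c) \<circ>\<^sub>t assoc\<^sub>t (T a) (T b) (T c) \<circ>\<^sub>t k"
  using phi_assoc[of a b c] comp\<^sub>t_assoc[of "phi (a @ b) c" "phi a b \<otimes>\<^sub>t id\<^sub>t (T c)" k] by simp

text \<open>The first hexagon transported along \<open>phi\<close>: after composing with
  \<open>phi3\<close>, naturality moves the braiding onto the bare tensor factors, where the hexagon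
  applies.\<close>

lemma sbraid_append_right:
  assumes [simp]: "objs l" "objs m" "objs n"
  shows "sbraid l (m @ n) = scomp (stensor (sid m) (sbraid l n)) (stensor (sbraid l m) (sid n))"
proof (rule typed_eqI)
  let ?R = "scomp (stensor (sid m) (sbraid l n)) (stensor (sbraid l m) (sid n))"
  let ?a = "T l" and ?b = "T m" and ?c = "T n"
  show "mor (sbraid l (m @ n)) = mor ?R"
  proof (rule iso\<^sub>t_epi[of "phi3 l m n"])
    have "mor (sbraid l (m @ n)) \<circ>\<^sub>t phi3 l m n
      = phi (m @ n) l \<circ>\<^sub>t (braid\<^sub>t ?a (T (m @ n)) \<circ>\<^sub>t (id\<^sub>t ?a \<otimes>\<^sub>t phi m n)) \<circ>\<^sub>t assoc\<^sub>t ?a ?b ?c"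
      by simp
    also have "braid\<^sub>t ?a (T (m @ n)) \<circ>\<^sub>t (id\<^sub>t ?a \<otimes>\<^sub>t phi m n) = (phi m n \<otimes>\<^sub>t id\<^sub>t ?a) \<circ>\<^sub>t braid\<^sub>t ?a (?b \<otimes> ?c)"
      by (rule braid\<^sub>t_natural) auto
    also have "phi (m @ n) l \<circ>\<^sub>t ((phi m n \<otimes>\<^sub>t id\<^sub>t ?a) \<circ>\<^sub>t braid\<^sub>t ?a (?b \<otimes> ?c)) \<circ>\<^sub>t assoc\<^sub>t ?a ?b ?c
      = phi m (n @ l) \<circ>\<^sub>t (id\<^sub>t ?b \<otimes>\<^sub>t phi n l) \<circ>\<^sub>t (assoc\<^sub>t ?b ?c ?a \<circ>\<^sub>t braid\<^sub>t ?a (?b \<otimes> ?c) \<circ>\<^sub>t assoc\<^sub>t ?a ?b ?c)"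
      by (simp add: phi_assoc')
    also have "assoc\<^sub>t ?b ?c ?a \<circ>\<^sub>t braid\<^sub>t ?a (?b \<otimes> ?c) \<circ>\<^sub>t assoc\<^sub>t ?a ?b ?c
      = (id\<^sub>t ?b \<otimes>\<^sub>t braid\<^sub>t ?a ?c) \<circ>\<^sub>t assoc\<^sub>t ?b ?a ?c \<circ>\<^sub>t (braid\<^sub>t ?a ?b \<otimes>\<^sub>t id\<^sub>t ?c)"
      by (simp add: hexagon1\<^sub>t)
    finally have L: "mor (sbraid l (m @ n)) \<circ>\<^sub>t phi3 l m n = phi m (n @ l) \<circ>\<^sub>t (id\<^sub>t ?b \<otimes>\<^sub>t phi n l) \<circ>\<^sub>t
      (id\<^sub>t ?b \<otimes>\<^sub>t braid\<^sub>t ?a ?c) \<circ>\<^sub>t assoc\<^sub>t ?b ?a ?c \<circ>\<^sub>t (braid\<^sub>t ?a ?b \<otimes>\<^sub>t id\<^sub>t ?c)" .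
    have "mor ?R \<circ>\<^sub>t phi3 l m n = mor ?R \<circ>\<^sub>t (phi (l @ m) n \<circ>\<^sub>t (phi l m \<otimes>\<^sub>t id\<^sub>t ?c))"
      by (simp only: phi_assoc assms)
    also have "\<dots> = phi m (n @ l) \<circ>\<^sub>t (id\<^sub>t ?b \<otimes>\<^sub>t (phi n l \<circ>\<^sub>t braid\<^sub>t ?a ?c \<circ>\<^sub>t inv\<^sub>t (phi l n))) \<circ>\<^sub>t inv\<^sub>t (phi m (l @ n))
        \<circ>\<^sub>t phi (m @ l) n \<circ>\<^sub>t ((phi m l \<otimes>\<^sub>t id\<^sub>t ?c) \<circ>\<^sub>t (braid\<^sub>t ?a ?b \<otimes>\<^sub>t id\<^sub>t ?c))"
      by (simp add: interchange\<^sub>t)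
    also have "\<dots> = phi m (n @ l) \<circ>\<^sub>t (id\<^sub>t ?b \<otimes>\<^sub>t (phi n l \<circ>\<^sub>t braid\<^sub>t ?a ?c \<circ>\<^sub>t inv\<^sub>t (phi l n))) \<circ>\<^sub>t (id\<^sub>t ?b \<otimes>\<^sub>t phi l n)
        \<circ>\<^sub>t assoc\<^sub>t ?b ?a ?c \<circ>\<^sub>t (braid\<^sub>t ?a ?b \<otimes>\<^sub>t id\<^sub>t ?c)"
      by (simp add: phi_assoc')
    finally show "mor (sbraid l (m @ n)) \<circ>\<^sub>t phi3 l m n = mor ?R \<circ>\<^sub>t phi3 l m n"
      unfolding L by (simp add: interchange\<^sub>t')
  qed auto
qed auto

lemma sbraid_append_left:
  assumes [simp]: "objs l" "objs m" "objs n"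
  shows "sbraid (l @ m) n = scomp (stensor (sbraid l n) (sid m)) (stensor (sid l) (sbraid m n))"
proof (rule typed_eqI)
  let ?R = "scomp (stensor (sbraid l n) (sid m)) (stensor (sid l) (sbraid m n))"
  let ?a = "T l" and ?b = "T m" and ?c = "T n"
  show "mor (sbraid (l @ m) n) = mor ?R"
  proof (rule iso\<^sub>t_epi[of "phi3 l m n"])
    have "mor (sbraid (l @ m) n) \<circ>\<^sub>t phi3 l m n = mor (sbraid (l @ m) n) \<circ>\<^sub>t (phi (l @ m) n \<circ>\<^sub>t (phi l m \<otimes>\<^sub>t id\<^sub>t ?c))"
      by (simp only: phi_assoc assms)
    also have "\<dots> = phi n (l @ m) \<circ>\<^sub>t (braid\<^sub>t (T (l @ m)) ?c \<circ>\<^sub>t (phi l m \<otimes>\<^sub>t id\<^sub>t ?c))"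
      by simp
    also have "braid\<^sub>t (T (l @ m)) ?c \<circ>\<^sub>t (phi l m \<otimes>\<^sub>t id\<^sub>t ?c) = (id\<^sub>t ?c \<otimes>\<^sub>t phi l m) \<circ>\<^sub>t braid\<^sub>t (?a \<otimes> ?b) ?c"
      by (rule braid\<^sub>t_natural) auto
    finally have L: "mor (sbraid (l @ m) n) \<circ>\<^sub>t phi3 l m n
      = phi n (l @ m) \<circ>\<^sub>t (id\<^sub>t ?c \<otimes>\<^sub>t phi l m) \<circ>\<^sub>t braid\<^sub>t (?a \<otimes> ?b) ?c" .
    have "mor ?R \<circ>\<^sub>t phi3 l m n = phi (n @ l) m \<circ>\<^sub>t ((phi n l \<circ>\<^sub>t braid\<^sub>t ?a ?c \<circ>\<^sub>t inv\<^sub>t (phi l n)) \<otimes>\<^sub>t id\<^sub>t ?b)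
       \<circ>\<^sub>t inv\<^sub>t (phi (l @ n) m) \<circ>\<^sub>t phi l (n @ m) \<circ>\<^sub>t (id\<^sub>t ?a \<otimes>\<^sub>t phi n m) \<circ>\<^sub>t (id\<^sub>t ?a \<otimes>\<^sub>t braid\<^sub>t ?b ?c) \<circ>\<^sub>t assoc\<^sub>t ?a ?b ?c"
      by (simp add: interchange\<^sub>t')
    \<comment> \<open>An associator and its inverse are inserted so that \<open>phi3 l n m\<close>
      appears and can be rebracketed by \<open>phi_assoc\<close>.\<close>
    also have "\<dots> = phi (n @ l) m \<circ>\<^sub>t ((phi n l \<circ>\<^sub>t braid\<^sub>t ?a ?c \<circ>\<^sub>t inv\<^sub>t (phi l n)) \<otimes>\<^sub>t id\<^sub>t ?b)
       \<circ>\<^sub>t inv\<^sub>t (phi (l @ n) m) \<circ>\<^sub>t (phi3 l n m \<circ>\<^sub>t inv\<^sub>t (assoc\<^sub>t ?a ?c ?b) \<circ>\<^sub>t (id\<^sub>t ?a \<otimes>\<^sub>t braid\<^sub>t ?b ?c) \<circ>\<^sub>t assoc\<^sub>t ?a ?b ?c)"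
      by simp
    also have "phi3 l n m = phi (l @ n) m \<circ>\<^sub>t (phi l n \<otimes>\<^sub>t id\<^sub>t ?b)"
      by (simp only: phi_assoc assms)
    also have "phi (n @ l) m \<circ>\<^sub>t ((phi n l \<circ>\<^sub>t braid\<^sub>t ?a ?c \<circ>\<^sub>t inv\<^sub>t (phi l n)) \<otimes>\<^sub>t id\<^sub>t ?b)
       \<circ>\<^sub>t inv\<^sub>t (phi (l @ n) m) \<circ>\<^sub>t ((phi (l @ n) m \<circ>\<^sub>t (phi l n \<otimes>\<^sub>t id\<^sub>t ?b)) \<circ>\<^sub>t inv\<^sub>t (assoc\<^sub>t ?a ?c ?b) \<circ>\<^sub>t (id\<^sub>t ?a \<otimes>\<^sub>t braid\<^sub>t ?b ?c) \<circ>\<^sub>t assoc\<^sub>t ?a ?b ?c)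
      = phi (n @ l) m \<circ>\<^sub>t (phi n l \<otimes>\<^sub>t id\<^sub>t ?b) \<circ>\<^sub>t ((braid\<^sub>t ?a ?c \<otimes>\<^sub>t id\<^sub>t ?b) \<circ>\<^sub>t inv\<^sub>t (assoc\<^sub>t ?a ?c ?b) \<circ>\<^sub>t (id\<^sub>t ?a \<otimes>\<^sub>t braid\<^sub>t ?b ?c)) \<circ>\<^sub>t assoc\<^sub>t ?a ?b ?c"
      by (simp add: interchange\<^sub>t')
    also have "(braid\<^sub>t ?a ?c \<otimes>\<^sub>t id\<^sub>t ?b) \<circ>\<^sub>t inv\<^sub>t (assoc\<^sub>t ?a ?c ?b) \<circ>\<^sub>t (id\<^sub>t ?a \<otimes>\<^sub>t braid\<^sub>t ?b ?c)
      = inv\<^sub>t (assoc\<^sub>t ?c ?a ?b) \<circ>\<^sub>t braid\<^sub>t (?a \<otimes> ?b) ?c \<circ>\<^sub>t inv\<^sub>t (assoc\<^sub>t ?a ?b ?c)"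
      by (simp add: hexagon2\<^sub>t)
    also have "phi (n @ l) m \<circ>\<^sub>t (phi n l \<otimes>\<^sub>t id\<^sub>t ?b) \<circ>\<^sub>t (inv\<^sub>t (assoc\<^sub>t ?c ?a ?b) \<circ>\<^sub>t braid\<^sub>t (?a \<otimes> ?b) ?c \<circ>\<^sub>t inv\<^sub>t (assoc\<^sub>t ?a ?b ?c)) \<circ>\<^sub>t assoc\<^sub>t ?a ?b ?c
      = phi n (l @ m) \<circ>\<^sub>t (id\<^sub>t ?c \<otimes>\<^sub>t phi l m) \<circ>\<^sub>t braid\<^sub>t (?a \<otimes> ?b) ?c"
      by (simp add: phi_assoc')
    finally show "mor (sbraid (l @ m) n) \<circ>\<^sub>t phi3 l m n = mor ?R \<circ>\<^sub>t phi3 l m n"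
      unfolding L by simp
  qed auto
qed auto

lemma stwist_append:
  assumes [simp]: "objs l" "objs m"
  shows "stwist (l @ m) = scomp (sbraid m l) (scomp (sbraid l m) (stensor (stwist l) (stwist m)))"
proof (rule typed_eqI)
  let ?R = "scomp (sbraid m l) (scomp (sbraid l m) (stensor (stwist l) (stwist m)))"
  have "twist\<^sub>t (T (l @ m)) \<circ>\<^sub>t phi l m = phi l m \<circ>\<^sub>t twist\<^sub>t (T l \<otimes> T m)"
    by (rule twist\<^sub>t_natural) auto
  then show "mor (stwist (l @ m)) = mor ?R"
    by - (rule iso\<^sub>t_epi[of "phi l m"], auto simp: twist\<^sub>t_tensor)
qed auto

text \<open>The type restriction makes this rule split only arrows between lists; repeated use
  leaves the typed morphisms inside intact.\<close>

lemma strict_eqI: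
  fixes f g :: "('a list, ('a, 'b) typed) typed"
  shows "\<lbrakk>dom f = dom g; cod f = cod g; mor f = mor g\<rbrakk> \<Longrightarrow> f = g"
  by (rule typed_eqI)

lemma strict_ribbon_category:
  "strict_ribbon_category (\<lambda>l. objs l) sarr dom cod sid scomp stensor sadd ssmul sbraid stwist"
proof
  fix f :: "('a list, ('a, 'b) typed) typed" and l assume "sarr f" 
  then show "stensor (sid []) f = f" "stensor f (sid []) = f" 
    using lunit\<^sub>t_natural[of "mor f" "T (dom f)" "T (cod f)"] runit\<^sub>t_natural[of "mor f" "T (dom f)" "T (cod f)"]
      comp\<^sub>t_assoc[of "lunit\<^sub>t (T (cod f))" "id\<^sub>t \<one> \<otimes>\<^sub>t mor f" "inv\<^sub>t (lunit\<^sub>t (T (dom f)))"]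
      comp\<^sub>t_assoc[of "runit\<^sub>t (T (cod f))" "mor f \<otimes>\<^sub>t id\<^sub>t \<one>" "inv\<^sub>t (runit\<^sub>t (T (dom f)))"]
    by (auto intro!: strict_eqI simp: phi_Nil_right)
next
  fix f g f' g' :: "('a list, ('a, 'b) typed) typed"
  assume "sarr f" "sarr g" "sarr f'" "sarr g'" "dom g = cod f" "dom g' = cod f'"
  then show "scomp (stensor g g') (stensor f f') = stensor (scomp g f) (scomp g' f')"
    by (auto intro!: strict_eqI simp: interchange\<^sub>t')
next
  fix l m assume [simp]: "objs l" "objs m"
  let ?g = "Typed (m @ l) (l @ m) (inv\<^sub>t (mor (sbraid l m)))"
  have "sarr ?g" by (rule sarrI) auto
  moreover have "scomp ?g (sbraid l m) = sid (l @ m)"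
    by (rule strict_eqI) auto
  ultimately show "\<exists>g. sarr g \<and> dom g = m @ l \<and> cod g = l @ m \<and> scomp g (sbraid l m) = sid (l @ m)"
    by (intro exI[of _ ?g]) auto
next
  fix f g l m l' m' assume A: "sarr f" "sarr g" "dom f = l" "dom g = m" "cod f = l'" "cod g = m'"
  note B = sarrD[OF A(1)] sarrD[OF A(2)]
  have "braid\<^sub>t (T l') (T m') \<circ>\<^sub>t (mor f \<otimes>\<^sub>t mor g) = (mor g \<otimes>\<^sub>t mor f) \<circ>\<^sub>t braid\<^sub>t (T l) (T m)"
    using A B by (intro braid\<^sub>t_natural) auto
  then have "phi m' l' \<circ>\<^sub>t (braid\<^sub>t (T l') (T m') \<circ>\<^sub>t (mor f \<otimes>\<^sub>t mor g)) \<circ>\<^sub>t inv\<^sub>t (phi l m) 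
    = phi m' l' \<circ>\<^sub>t ((mor g \<otimes>\<^sub>t mor f) \<circ>\<^sub>t braid\<^sub>t (T l) (T m)) \<circ>\<^sub>t inv\<^sub>t (phi l m)" by simp
  then show "scomp (sbraid l' m') (stensor f g) = scomp (stensor g f) (sbraid l m)"
    using A B by (intro strict_eqI) auto
next
  fix f l m assume A: "sarr f" "dom f = l" "cod f = m"
  then show "scomp (stwist m) f = scomp f (stwist l)"
    by (auto intro!: strict_eqI twist\<^sub>t_natural)
qed ((rule stensor_assoc sbraid_append_right sbraid_append_left stwist_append; assumption) | (simp; fail)
  | (rule strict_eqI; simp add: comp\<^sub>t_linear tensor\<^sub>t_linear))+

end

section \<open>Embedding of the category into its strictification\<close>

context monoidal_linear_category
begin

lemma phi_double: "\<lbrakk>X \<in> Obj C; Y \<in> Obj C; Z \<in> Obj C\<rbrakk> \<Longrightarrow> phi [X, Y] [Z] = assoc\<^sub>t X Y Z"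
  using phi_single[of Y "[Z]"] by (simp add: psi_def del: phi.simps(2) add: phi.simps(2)[of X "[Y]"])

definition lift :: "'a list \<Rightarrow> 'a list \<Rightarrow> 'b \<Rightarrow> ('a list, ('a, 'b) typed) typed" where
  "lift l m f = Typed l m (Typed (T l) (T m) f)"

lemma lift_sel [simp]: "dom (lift l m f) = l" "cod (lift l m f) = m" "mor (lift l m f) = Typed (T l) (T m) f"
  by (auto simp: lift_def)

lemma sarr_lift: "\<lbrakk>objs l; objs m; f \<in> Hom C (T l) (T m)\<rbrakk> \<Longrightarrow> sarr (lift l m f)"
  by (rule sarrI) (auto simp: valid_def simp del: valid_obj)

lemma sarr_cases:
  assumes "sarr s" obtains f where "s = lift (dom s) (cod s) f" "f \<in> Hom C (T (dom s)) (T (cod s))"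
proof
  show "s = lift (dom s) (cod s) (mor (mor s))"
    using sarrD(4,5)[OF assms] by (cases s; cases "mor s") (auto simp: lift_def)
  show "mor (mor s) \<in> Hom C (T (dom s)) (T (cod s))"
    using sarrD(3-5)[OF assms] by (auto simp: valid_def simp del: valid_obj)
qed

lemma lift_inject [simp]: "lift l m f = lift l m g \<longleftrightarrow> f = g"
  by (simp add: lift_def)

lemma lift_comp: "scomp (lift m n g) (lift l m f) = lift l n (g \<cdot> f)"
  by (simp add: scomp_def lift_def comp\<^sub>t_def)

lemma lift_ident: "sid l = lift l l (ident C (T l))"
  by (simp add: sid_def lift_def id\<^sub>t_def)

lemma lift_add: "sadd (lift l m f) (lift l m g) = lift l m (f \<oplus> g)"
  by (simp add: sadd_def lift_def add\<^sub>t_def)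

lemma lift_smul: "ssmul a (lift l m f) = lift l m (a \<odot> f)"
  by (simp add: ssmul_def lift_def smul\<^sub>t_def)

text \<open>On singletons \<open>phi\<close> is an identity, so nothing is transported.\<close>

lemma lift_tensor:
  assumes "X \<in> Obj C" "X' \<in> Obj C" "Y \<in> Obj C" "Y' \<in> Obj C" "f \<in> Hom C X Y" "g \<in> Hom C X' Y'"
  shows "stensor (lift [X] [Y] f) (lift [X'] [Y'] g) = lift [X, X'] [Y, Y'] (f \<otimes>\<^sub>m g)"
proof -
  have "valid (Typed X Y f)" "valid (Typed X' Y' g)"
    using assms by (auto simp: valid_def simp del: valid_obj)
  then show ?thesis
    using assms phi_single[of X "[X']"] phi_single[of Y "[Y']"]
    by (simp add: stensor_def del: phi.simps) (simp add: lift_def tensor\<^sub>t_def)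
qed

end

sublocale ribbon_fusion_category \<subseteq> S: strict_ribbon_category
  "\<lambda>l. objs l" sarr dom cod sid scomp stensor sadd ssmul sbraid stwist
  by (rule strict_ribbon_category)

context ribbon_fusion_category
begin

lemma lift_braid: "\<lbrakk>X \<in> Obj C; Y \<in> Obj C\<rbrakk> \<Longrightarrow> sbraid [X] [Y] = lift [X, Y] [Y, X] (braid C X Y)"
  using phi_single[of X "[Y]"] phi_single[of Y "[X]"]
  by (simp add: sbraid_def del: phi.simps) (simp add: lift_def braid\<^sub>t_def)

lemma lift_twist: "stwist [X] = lift [X] [X] (twist C X)"
  by (simp add: stwist_def lift_def twist\<^sub>t_def)

definition sev where "sev X = lift [dual C X, X] [] (ev C X)"
definition scoev where "scoev X = lift [] [X, dual C X] (coev C X)"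

lemma dual_pair_single:
  assumes X: "X \<in> Obj C"
  shows "S.dual_pair [X] [dual C X] (sev X) (scoev X)"
proof -
  let ?d = "dual C X"
  have d [simp]: "?d \<in> Obj C" and X' [simp]: "X \<in> Obj C" using X dual_obj by auto
  have a: "sarr (sev X)" "sarr (scoev X)"
    using ev_hom[OF X] coev_hom[OF X] by (auto simp: sev_def scoev_def intro!: sarr_lift)
  define e where "e = Typed (?d \<otimes> X) \<one> (ev C X)"
  define h where "h = Typed \<one> (X \<otimes> ?d) (coev C X)"
  have m: "mor (sev X) = e" "mor (scoev X) = h" "dom (sev X) = [?d, X]" "cod (sev X) = []"
    "dom (scoev X) = []" "cod (scoev X) = [X, ?d]"
    by (simp_all add: sev_def scoev_def e_def h_def)
  have v [simp]: "valid e" "valid h" using sarrD(3)[OF a(1)] sarrD(3)[OF a(2)] m by simp_all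
  have s [simp]: "dom e = ?d \<otimes> X" "cod e = \<one>" "dom h = \<one>" "cod h = X \<otimes> ?d" by (auto simp: e_def h_def)
  have z1: "runit\<^sub>t X \<circ>\<^sub>t (id\<^sub>t X \<otimes>\<^sub>t e) \<circ>\<^sub>t assoc\<^sub>t X ?d X \<circ>\<^sub>t (h \<otimes>\<^sub>t id\<^sub>t X) \<circ>\<^sub>t inv\<^sub>t (lunit\<^sub>t X) = id\<^sub>t X"
    using zigzag[OF X]
    by (simp add: e_def h_def comp\<^sub>t_def tensor\<^sub>t_def inv\<^sub>t_def id\<^sub>t_def lunit\<^sub>t_def runit\<^sub>t_def assoc\<^sub>t_def)
  have z2: "lunit\<^sub>t ?d \<circ>\<^sub>t (e \<otimes>\<^sub>t id\<^sub>t ?d) \<circ>\<^sub>t inv\<^sub>t (assoc\<^sub>t ?d X ?d) \<circ>\<^sub>t (id\<^sub>t ?d \<otimes>\<^sub>t h) \<circ>\<^sub>t inv\<^sub>t (runit\<^sub>t ?d) = id\<^sub>t ?d"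
    using zigzag_dual[OF X]
    by (simp add: e_def h_def comp\<^sub>t_def tensor\<^sub>t_def inv\<^sub>t_def id\<^sub>t_def lunit\<^sub>t_def runit\<^sub>t_def assoc\<^sub>t_def)
  \<comment> \<open>On these short lists \<open>phi\<close> supplies exactly the unit isomorphisms
    and associators written out in the zigzag axioms.\<close>
  have p: "phi [X] [] = runit\<^sub>t X" "phi [?d] [] = runit\<^sub>t ?d" "phi [] [X] = lunit\<^sub>t X" "phi [] [?d] = lunit\<^sub>t ?d"
    "phi [X] [?d, X] = id\<^sub>t (X \<otimes> (?d \<otimes> X))" "phi [?d] [X, ?d] = id\<^sub>t (?d \<otimes> (X \<otimes> ?d))"
    "phi [X, ?d] [X] = assoc\<^sub>t X ?d X" "phi [?d, X] [?d] = assoc\<^sub>t ?d X ?d"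
    using phi_Nil_right[of "[X]"] phi_Nil_right[of "[?d]"] phi_single[of X "[?d, X]"] phi_single[of ?d "[X, ?d]"]
      phi_double[of X ?d X] phi_double[of ?d X ?d] by (simp_all del: phi.simps(2))
  have 1: "scomp (stensor (sid [X]) (sev X)) (stensor (scoev X) (sid [X])) = sid [X]"
    by (rule strict_eqI) (simp_all add: m p z1 del: phi.simps)
  have 2: "scomp (stensor (sev X) (sid [?d])) (stensor (sid [?d]) (scoev X)) = sid [?d]"
    by (rule strict_eqI) (simp_all add: m p z2 del: phi.simps)
  show ?thesis
    unfolding S.dual_pair_def using a m 1 2 by auto
qed

lemma end_unit_scalar_eq: "end_unit_scalar C (a \<odot> ident C \<one>) = a" if "\<And>a b. a \<odot> ident C \<one> = b \<odot> ident C \<one> \<Longrightarrow> a = b"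
  unfolding end_unit_scalar_def using that by (intro the_equality) auto

text \<open>The strict closure of a single object is the very morphism inside \<open>qtrace\<close>;
  this is the bridge from strict traces to the S-matrix.\<close>

lemma trace_lift:
  assumes X: "X \<in> Obj C" and f: "f \<in> Hom C X X"
  shows "S.ptr [] [] [X] [dual C X] (sev X) (scoev X) (lift [X] [X] f)
    = lift [] [] (ev C X \<cdot> braid C X (dual C X) \<cdot> ((twist C X \<cdot> f) \<otimes>\<^sub>m ident C (dual C X)) \<cdot> coev C X)"
proof -
  let ?d = "dual C X"
  have d: "?d \<in> Obj C" using X dual_obj by auto
  note D = S.dual_pairD(1-8)[OF dual_pair_single[OF X]]
  have tw: "twist C X \<in> Hom C X X" using iso\<^sub>t_inv(1)[OF iso_twist\<^sub>t[OF X]] by (simp add: valid_def del: valid_obj)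
  have F: "sarr (lift [X] [X] f)" "sarr (stwist [X])" using sarr_lift[of "[X]" "[X]" f] X f by auto
  have "S.ptr [] [] [X] [?d] (sev X) (scoev X) (lift [X] [X] f)
     = scomp (sev X) (scomp (sbraid [X] [?d]) (scomp (stensor (scomp (stwist [X]) (lift [X] [X] f)) (sid [?d])) (scoev X)))"
    unfolding S.ptr_def S.eps_def using D F X d by (simp add: S.right_whisker del: phi.simps)
  also have "\<dots> = lift [] [] (ev C X \<cdot> braid C X ?d \<cdot> ((twist C X \<cdot> f) \<otimes>\<^sub>m ident C ?d) \<cdot> coev C X)"
    unfolding lift_twist lift_ident lift_comp T.simps
    using lift_tensor[of X ?d X ?d "twist C X \<cdot> f" "ident C ?d"] X d ident_hom[OF d] comp_hom[OF X X X tw f]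
    by (simp add: lift_braid[OF X d] sev_def scoev_def lift_comp)
  finally show ?thesis .
qed

end

section \<open>Schur's lemma\<close>

context linear_category
begin

lemma add_self_zero:
  assumes "X \<in> Obj C" "Y \<in> Obj C" "f \<in> Hom C X Y" "f \<oplus> f = f"
  shows "f = zeroM C X Y"
proof -
  obtain g where g: "g \<in> Hom C X Y" "f \<oplus> g = zeroM C X Y" using addM_neg assms by blast
  have "f = f \<oplus> (f \<oplus> g)" using g addM_zero assms by simp
  also have "\<dots> = (f \<oplus> f) \<oplus> g" using addM_assoc[OF assms(1,2,3,3) g(1)] by simp
  finally show ?thesis using g assms by simp
qed

lemma smul_zero [simp]: "\<lbrakk>X \<in> Obj C; Y \<in> Obj C; f \<in> Hom C X Y\<rbrakk> \<Longrightarrow> 0 \<odot> f = zeroM C X Y"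
  using smulM_plus[of X Y f 0 0] by (intro add_self_zero) (auto intro: smulM_hom)

lemma smul_zeroM [simp]: "\<lbrakk>X \<in> Obj C; Y \<in> Obj C\<rbrakk> \<Longrightarrow> a \<odot> zeroM C X Y = zeroM C X Y"
  using smulM_times[of X Y "zeroM C X Y" a 0] zeroM_hom[of X Y] by simp

lemma comp_zeroM_right: "\<lbrakk>X \<in> Obj C; Y \<in> Obj C; Z \<in> Obj C; g \<in> Hom C Y Z\<rbrakk> \<Longrightarrow> g \<cdot> zeroM C X Y = zeroM C X Z"
  using comp_smulM_right[of X Y Z g "zeroM C X Y" 0] zeroM_hom[of X Y] comp_hom[of X Y Z g "zeroM C X Y"] by simp

lemma comp_zeroM_left: "\<lbrakk>X \<in> Obj C; Y \<in> Obj C; Z \<in> Obj C; f \<in> Hom C X Y\<rbrakk> \<Longrightarrow> zeroM C Y Z \<cdot> f = zeroM C X Z"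
  using comp_smulM_left[of X Y Z "zeroM C Y Z" f 0] zeroM_hom[of Y Z] comp_hom[of X Y Z "zeroM C Y Z" f] by simp

lemma add_neg: "\<lbrakk>X \<in> Obj C; Y \<in> Obj C; f \<in> Hom C X Y\<rbrakk> \<Longrightarrow> f \<oplus> (- a) \<odot> f = (1 - a) \<odot> f"
  using smulM_plus[of X Y f 1 "- a"] smulM_one[of X Y f] by simp

lemma zeroM_add: "\<lbrakk>X \<in> Obj C; Y \<in> Obj C; f \<in> Hom C X Y\<rbrakk> \<Longrightarrow> zeroM C X Y \<oplus> f = f"
  using addM_comm[of X Y f "zeroM C X Y"] addM_zero[of X Y f] zeroM_hom by simp

lemma eq_if_diff_zero:
  assumes "X \<in> Obj C" "Y \<in> Obj C" "f \<in> Hom C X Y" "g \<in> Hom C X Y" "f \<oplus> (- 1) \<odot> g = zeroM C X Y"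
  shows "f = g"
proof -
  have h: "(- 1) \<odot> g \<in> Hom C X Y" using assms smulM_hom by blast
  have "f = f \<oplus> (g \<oplus> (- 1) \<odot> g)" using assms add_neg[of X Y g 1] addM_zero by simp
  also have "g \<oplus> (- 1) \<odot> g = (- 1) \<odot> g \<oplus> g" using addM_comm[OF assms(1,2,4) h] .
  also have "f \<oplus> \<dots> = (f \<oplus> (- 1) \<odot> g) \<oplus> g" using addM_assoc[OF assms(1,2,3) h assms(4)] by simp
  finally show ?thesis using assms zeroM_add by simp
qed

lemma zero_objectI:
  assumes "X \<in> Obj C" "ident C X = zeroM C X X"
  shows "zero_object C X"
proof -
  have "f = zeroM C Y X" if "Y \<in> Obj C" "f \<in> Hom C Y X" for Y f
    using that assms ident_left[of Y X f] comp_zeroM_left[of Y X X f] by simp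
  moreover have "f = zeroM C X Y" if "Y \<in> Obj C" "f \<in> Hom C X Y" for Y f
    using that assms ident_right[of X Y f] comp_zeroM_right[of X X Y f] by simp
  ultimately show ?thesis using assms zeroM_hom unfolding zero_object_def by blast
qed

lemma scalar_inj:
  assumes "X \<in> Obj C" "\<not> zero_object C X" "a \<odot> ident C X = b \<odot> ident C X"
  shows "a = b"
proof (rule ccontr)
  assume "a \<noteq> b"
  have i: "ident C X \<in> Hom C X X" using assms ident_hom by blast
  have "(a - b) \<odot> ident C X = a \<odot> ident C X \<oplus> (- b) \<odot> ident C X"
    using smulM_plus[of X X "ident C X" a "- b"] assms(1) i by simp
  also have "\<dots> = (b + - b) \<odot> ident C X"
    using smulM_plus[of X X "ident C X" b "- b"] assms i by simp
  also have "\<dots> = zeroM C X X" using assms i by simp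
  finally have "inverse (a - b) \<odot> ((a - b) \<odot> ident C X) = zeroM C X X" using assms by simp
  then have "(inverse (a - b) * (a - b)) \<odot> ident C X = zeroM C X X"
    using smulM_times[of X X "ident C X" "inverse (a - b)" "a - b"] assms i by simp
  then have "ident C X = zeroM C X X" using \<open>a \<noteq> b\<close> smulM_one[of X X "ident C X"] assms i by simp
  then show False using zero_objectI assms by blast
qed

end

context semisimple_abelian_category
begin

lemma zero_object_hom:
  assumes "zero_object C Z" "X \<in> Obj C"
  shows "f \<in> Hom C X Z \<Longrightarrow> f = zeroM C X Z" "f \<in> Hom C Z X \<Longrightarrow> f = zeroM C Z X"
  using assms zeroM_hom unfolding zero_object_def by metis+

text \<open>The kernel of \<open>f\<close> is a subobject of the simple \<open>X\<close>, and it is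
  not all of \<open>X\<close> because \<open>f\<close> is nonzero. So it is zero, \<open>f\<close>
  is mono, and a nonzero subobject of the simple \<open>Y\<close> is all of
  \<open>Y\<close>.\<close>

lemma simple_hom_iso:
  assumes "simple_object C X" "simple_object C Y" "f \<in> Hom C X Y" "f \<noteq> zeroM C X Y"
  shows "iso_in C X Y f"
proof -
  have X: "X \<in> Obj C" and Y: "Y \<in> Obj C" using assms by (auto simp: simple_object_def)
  obtain K u where K: "K \<in> Obj C" "is_kernel C K X Y u f" using ex_kernel X Y assms by blast
  have u: "u \<in> Hom C K X" "f \<cdot> u = zeroM C K Y"
    and ker: "\<And>W h. W \<in> Obj C \<Longrightarrow> h \<in> Hom C W X \<Longrightarrow> f \<cdot> h = zeroM C W Y \<Longrightarrow> \<exists>!v. v \<in> Hom C W K \<and> u \<cdot> v = h"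
    using K(2) by (auto simp: is_kernel_def)
  have "mono_in C K X u"
    unfolding mono_in_def
  proof (intro conjI ballI impI u(1))
    fix W g h assume W: "W \<in> Obj C" "g \<in> Hom C W K" "h \<in> Hom C W K" "u \<cdot> g = u \<cdot> h"
    have "f \<cdot> (u \<cdot> g) = (f \<cdot> u) \<cdot> g" using comp_assoc[of W K X Y f u g] W K X Y assms u by simp
    also have "\<dots> = zeroM C W Y" using comp_zeroM_left[of W K Y g] u W K Y by simp
    finally have "\<exists>!v. v \<in> Hom C W K \<and> u \<cdot> v = u \<cdot> g"
      using W K X u comp_hom by (intro ker) auto
    then show "g = h" using W by auto
  qed
  then have "zero_object C K \<or> iso_in C K X u" using assms(1) K by (auto simp: simple_object_def)
  moreover have "\<not> iso_in C K X u"
  proof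
    assume "iso_in C K X u"
    then obtain v where v: "v \<in> Hom C X K" "u \<cdot> v = ident C X" by (auto simp: iso_in_def inverse_pair_def)
    have "f = f \<cdot> (u \<cdot> v)" using v ident_right X Y assms by simp
    also have "\<dots> = (f \<cdot> u) \<cdot> v" using comp_assoc[of X K X Y f u v] v u X Y K assms by simp
    also have "\<dots> = zeroM C X Y" using comp_zeroM_left[of X K Y v] u v X Y K by simp
    finally show False using assms by simp
  qed
  ultimately have Z: "zero_object C K" by blast
  have "mono_in C X Y f"
    unfolding mono_in_def
  proof (intro conjI ballI impI assms(3))
    fix W g h assume W: "W \<in> Obj C" "g \<in> Hom C W X" "h \<in> Hom C W X" "f \<cdot> g = f \<cdot> h"
    let ?d = "g \<oplus> (- 1) \<odot> h"
    have n: "(- 1) \<odot> h \<in> Hom C W X" using W X smulM_hom by blast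
    have d: "?d \<in> Hom C W X" using W X n addM_hom by blast
    have fh: "f \<cdot> h \<in> Hom C W Y" using W X Y assms comp_hom by blast
    have "f \<cdot> ?d = f \<cdot> g \<oplus> (- 1) \<odot> (f \<cdot> h)"
      using comp_addM_right[of W X Y f g "(- 1) \<odot> h"] comp_smulM_right[of W X Y f h "- 1"] W X Y assms n by simp
    also have "\<dots> = zeroM C W Y" using W Y fh add_neg[of W Y "f \<cdot> h" 1] by simp
    finally obtain v where v: "v \<in> Hom C W K" "u \<cdot> v = ?d" using ker[of W ?d] W d by blast
    have "v = zeroM C W K" using zero_object_hom(1)[OF Z] v W by blast
    then have "?d = zeroM C W X" using v comp_zeroM_right u W K X by metis
    then show "g = h" using eq_if_diff_zero W X by blast
  qed
  then show ?thesis using assms X by (auto simp: simple_object_def)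
qed

end

section \<open>Endomorphisms of simple objects are scalars\<close>

locale alg_closed_category = semisimple_abelian_category C
  for C :: "('o, 'm, 'k::alg_closed_field) ribbon_data" (structure)
begin

context
  fixes X f assumes X: "X \<in> Obj C" and f: "f \<in> Hom C X X"
begin

text \<open>Horner evaluation at \<open>f\<close> in the endomorphism algebra, whose operations are
  those of the category.\<close>

definition peval :: "'k poly \<Rightarrow> 'm" where
  "peval p = fold_coeffs (\<lambda>a r. a \<odot> ident C X \<oplus> f \<cdot> r) p (zeroM C X X)"

lemma endo_closed: "ident C X \<in> Hom C X X" "zeroM C X X \<in> Hom C X X" "a \<odot> ident C X \<in> Hom C X X"
  "g \<in> Hom C X X \<Longrightarrow> h \<in> Hom C X X \<Longrightarrow> g \<cdot> h \<in> Hom C X X"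
  "g \<in> Hom C X X \<Longrightarrow> h \<in> Hom C X X \<Longrightarrow> g \<oplus> h \<in> Hom C X X" "g \<in> Hom C X X \<Longrightarrow> a \<odot> g \<in> Hom C X X"
  using ident_hom[OF X] zeroM_hom[OF X X] smulM_hom[OF X X] comp_hom[OF X X X] addM_hom[OF X X] by simp_all

lemma peval_pCons: "peval (pCons a p) = a \<odot> ident C X \<oplus> f \<cdot> peval p"
proof (cases "a = 0 \<and> p = 0")
  case True
  then show ?thesis
    using comp_zeroM_right[OF X X X f] addM_zero[OF X X endo_closed(2)] smul_zero[OF X X endo_closed(1)] by (simp add: peval_def)
next
  case False
  then show ?thesis unfolding peval_def
    by (cases "p = 0") (simp_all add: fold_coeffs_pCons_coeff_not_0_eq fold_coeffs_pCons_not_0_0_eq)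
qed

lemma peval_0: "peval 0 = zeroM C X X"
  by (simp add: peval_def)

lemma peval_hom: "peval p \<in> Hom C X X"
  by (induction p) (auto simp: peval_0 peval_pCons endo_closed f)

lemma add_swap_middle: "\<lbrakk>a \<in> Hom C X X; b \<in> Hom C X X; c \<in> Hom C X X; d \<in> Hom C X X\<rbrakk>
    \<Longrightarrow> (a \<oplus> b) \<oplus> (c \<oplus> d) = (a \<oplus> c) \<oplus> (b \<oplus> d)"
proof -
  assume A: "a \<in> Hom C X X" "b \<in> Hom C X X" "c \<in> Hom C X X" "d \<in> Hom C X X"
  have "(a \<oplus> b) \<oplus> (c \<oplus> d) = a \<oplus> ((b \<oplus> c) \<oplus> d)" using A X endo_closed addM_assoc[of X X] by simp
  also have "b \<oplus> c = c \<oplus> b" using addM_comm[OF X X A(2,3)] .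
  finally show ?thesis using A X endo_closed addM_assoc[of X X] by simp
qed

lemma peval_add: "peval (p + q) = peval p \<oplus> peval q"
proof (induction p q rule: poly_induct2)
  case 0
  then show ?case using addM_zero X endo_closed by (simp add: peval_0)
next
  case (pCons a p b q)
  have "peval (pCons a p + pCons b q) = (a \<odot> ident C X \<oplus> b \<odot> ident C X) \<oplus> (f \<cdot> peval p \<oplus> f \<cdot> peval q)"
    using pCons X f endo_closed peval_hom smulM_plus[of X X "ident C X" a b] comp_addM_right[of X X X f "peval p" "peval q"]
    by (simp add: peval_pCons)
  then show ?case using add_swap_middle endo_closed f peval_hom by (simp add: peval_pCons)
qed

lemma peval_smult: "peval (smult a p) = a \<odot> peval p"
proof (induction p)
  case 0
  then show ?case using X by (simp add: peval_0)
next
  case (pCons b p)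
  then show ?case
    using X f endo_closed peval_hom smulM_times[of X X "ident C X" a b] comp_smulM_right[of X X X f "peval p" a]
      smulM_addM[of X X "b \<odot> ident C X" "f \<cdot> peval p" a]
    by (simp add: peval_pCons)
qed

lemma peval_root_factor: "peval ([:- a, 1:] * q) = (f \<oplus> (- a) \<odot> ident C X) \<cdot> peval q"
proof -
  have "[:- a, 1:] * q = pCons 0 q + smult (- a) q" by simp
  then have "peval ([:- a, 1:] * q) = f \<cdot> peval q \<oplus> (- a) \<odot> peval q"
    by (simp only: peval_add peval_smult peval_pCons smul_zero[OF X X endo_closed(1)] zeroM_add[OF X X endo_closed(4)[OF f peval_hom]])
  also have "\<dots> = (f \<oplus> (- a) \<odot> ident C X) \<cdot> peval q"
    using X f endo_closed peval_hom comp_addM_left[of X X X f "(- a) \<odot> ident C X" "peval q"]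
      comp_smulM_left[of X X X "ident C X" "peval q" "- a"] ident_left by simp
  finally show ?thesis .
qed

text \<open>Coefficients are functions on morphisms, so that linear dependence can be studied among
  functions instead of in the hom-set.\<close>

definition lincomb :: "'m list \<Rightarrow> ('m \<Rightarrow> 'k) \<Rightarrow> 'm" where
  "lincomb bs c = foldr (\<lambda>b r. c b \<odot> b \<oplus> r) bs (zeroM C X X)"

lemma lincomb_hom: "set bs \<subseteq> Hom C X X \<Longrightarrow> lincomb bs c \<in> Hom C X X"
  by (induction bs) (auto simp: lincomb_def endo_closed)

lemma lincomb_add: "set bs \<subseteq> Hom C X X \<Longrightarrow> lincomb bs (c + d) = lincomb bs c \<oplus> lincomb bs d"
proof (induction bs)
  case Nil
  then show ?case using addM_zero X endo_closed by (simp add: lincomb_def)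
next
  case (Cons b bs)
  then have "lincomb (b # bs) (c + d) = (c b \<odot> b \<oplus> d b \<odot> b) \<oplus> (lincomb bs c \<oplus> lincomb bs d)"
    using smulM_plus X by (simp add: lincomb_def)
  then show ?case using Cons add_swap_middle[of "c b \<odot> b" "d b \<odot> b" "lincomb bs c" "lincomb bs d"] lincomb_hom endo_closed
    by (simp add: lincomb_def)
qed

lemma lincomb_smult: "set bs \<subseteq> Hom C X X \<Longrightarrow> lincomb bs (\<lambda>x. a * c x) = a \<odot> lincomb bs c"
proof (induction bs)
  case Nil
  then show ?case using X by (simp add: lincomb_def)
next
  case (Cons b bs)
  then show ?case using X smulM_times smulM_addM[of X X "c b \<odot> b" "lincomb bs c" a] lincomb_hom[of bs c] endo_closed
    by (simp add: lincomb_def)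
qed

lemma lincomb_delta: "\<lbrakk>distinct bs; set bs \<subseteq> Hom C X X; b \<in> set bs\<rbrakk> \<Longrightarrow> lincomb bs (\<lambda>x. if x = b then 1 else 0) = b"
proof (induction bs)
  case (Cons d bs)
  have z: "b \<notin> set bs \<Longrightarrow> set bs \<subseteq> Hom C X X \<Longrightarrow> lincomb bs (\<lambda>x. if x = b then 1 else 0) = zeroM C X X" for bs
    using X endo_closed zeroM_add by (induction bs) (auto simp: lincomb_def)
  show ?case
  proof (cases "d = b")
    case True
    then show ?thesis using Cons z[of bs] X addM_zero smulM_one by (simp add: lincomb_def)
  next
    case False
    then show ?thesis using Cons X zeroM_add by (auto simp: lincomb_def)
  qed
qed simp

lemma lincomb_exists:
  assumes "distinct bs" "set bs \<subseteq> Hom C X X" "g \<in> hom_span C X X (set bs)"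
  shows "\<exists>c. (\<forall>x. x \<notin> set bs \<longrightarrow> c x = 0) \<and> lincomb bs c = g"
  using assms(3)
proof induction
  case zero
  have "lincomb bs (\<lambda>x. 0 * 0) = 0 \<odot> lincomb bs (\<lambda>x. 0)"
    using lincomb_smult[OF assms(2), of 0 "\<lambda>x. 0"] by simp
  then show ?case using lincomb_hom[OF assms(2)] X by (intro exI[of _ "\<lambda>x. 0"]) simp
next
  case (add b g a)
  then obtain c where c: "\<forall>x. x \<notin> set bs \<longrightarrow> c x = 0" "lincomb bs c = g" by blast
  let ?c = "(\<lambda>x. a * (if x = b then 1 else 0)) + c"
  have "lincomb bs ?c = a \<odot> b \<oplus> g"
    using lincomb_add[OF assms(2)] lincomb_smult[OF assms(2)] lincomb_delta[OF assms(1,2)] c add by simp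
  moreover have "\<forall>x. x \<notin> set bs \<longrightarrow> ?c x = 0" using c add by auto
  ultimately show ?case by (intro exI[of _ ?c] conjI)
qed

text \<open>Each power of \<open>f\<close> has a coefficient vector supported on a finite spanning
  set \<open>B\<close>. Among the first \<open>card B + 1\<close> of these vectors there is a linear
  relation, whose coefficients form the polynomial.\<close>

lemma ex_annihilating_poly: "\<exists>p. p \<noteq> 0 \<and> peval p = zeroM C X X"
proof -
  obtain B where B: "finite B" "B \<subseteq> Hom C X X" "hom_span C X X B = Hom C X X"
    using hom_finite_dim[OF X X] by blast
  then obtain bs where bs: "distinct bs" "set bs = B" using finite_distinct_list by blast
  have "\<exists>c. (\<forall>x. x \<notin> set bs \<longrightarrow> c x = 0) \<and> lincomb bs c = peval (monom 1 n)" for n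
    using lincomb_exists[of bs "peval (monom 1 n)"] bs B peval_hom by simp
  then obtain c where c: "\<And>n x. x \<notin> B \<Longrightarrow> c n x = 0" "\<And>n. lincomb bs (c n) = peval (monom 1 n)"
    using bs by metis
  interpret F: vector_space "\<lambda>(a::'k) (c :: 'm \<Rightarrow> 'k) x. a * c x"
    by unfold_locales (auto simp: algebra_simps)
  let ?N = "card B"
  have lin: "lincomb bs (\<Sum>i\<le>n. (\<lambda>x. u i * c i x)) = peval (\<Sum>i\<le>n. monom (u i) i)" for u n
  proof (induction n)
    case 0
    then show ?case using lincomb_smult[of bs "u 0" "c 0"] c bs B peval_smult[of "u 0" "monom 1 0"] by (simp add: smult_monom monom_0)
  next
    case (Suc n)
    have "lincomb bs (\<Sum>i\<le>Suc n. (\<lambda>x. u i * c i x))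
      = lincomb bs (\<Sum>i\<le>n. (\<lambda>x. u i * c i x)) \<oplus> lincomb bs (\<lambda>x. u (Suc n) * c (Suc n) x)"
      unfolding sum.atMost_Suc using bs B by (intro lincomb_add) auto
    also have "lincomb bs (\<lambda>x. u (Suc n) * c (Suc n) x) = peval (monom (u (Suc n)) (Suc n))"
      using lincomb_smult[of bs "u (Suc n)" "c (Suc n)"] c(2) bs B peval_smult[of "u (Suc n)" "monom 1 (Suc n)"]
      by (simp add: smult_monom)
    finally show ?case unfolding Suc sum.atMost_Suc[of "\<lambda>i. monom (u i) i"] peval_add .
  qed
  have "\<exists>u. (\<exists>i\<le>?N. u i \<noteq> 0) \<and> (\<Sum>i\<le>?N. (\<lambda>x. u i * c i x)) = 0"
  proof (cases "inj_on c {..?N}")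
    \<comment> \<open>Two equal vectors are a single element of the image set, so this relation has
      to be given explicitly.\<close>
    case False
    then obtain i j where ij: "i \<le> ?N" "j \<le> ?N" "i \<noteq> j" "c i = c j" by (auto simp: inj_on_def)
    let ?u = "\<lambda>k. (if k = i then 1 else 0) - (if k = j then 1 else 0) :: 'k"
    have "(\<Sum>k\<le>?N. (\<lambda>x. ?u k * c k x)) = (\<Sum>k\<le>?N. (if k = i then c k else 0)) - (\<Sum>k\<le>?N. (if k = j then c k else 0))"
      unfolding sum_subtractf[symmetric] by (intro sum.cong) (auto simp: fun_eq_iff)
    also have "\<dots> = 0" using ij by simp
    finally show ?thesis using ij by (intro exI[of _ ?u]) auto
  next
    case True
    \<comment> \<open>The indicator functions of elements of \<open>B\<close> span all coefficient
      vectors, which bounds independent sets by \<open>card B\<close>.\<close>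
    let ?d = "\<lambda>b x. if x = b then 1 else 0 :: 'k"
    have "c n \<in> F.span (?d ` B)" for n
    proof -
      have eq: "c n = (\<Sum>b\<in>B. (\<lambda>x. c n b * ?d b x))"
      proof
        fix x
        have "(\<Sum>b\<in>B. (\<lambda>x. c n b * ?d b x)) x = (\<Sum>b\<in>B. c n b * ?d b x)"
          using B(1) by (induction B rule: finite_induct) auto
        also have "\<dots> = (\<Sum>b\<in>B. if x = b then c n b else 0)" by (intro sum.cong) auto
        also have "\<dots> = c n x" using B(1) c(1)[of x n] by auto
        finally show "c n x = (\<Sum>b\<in>B. (\<lambda>x. c n b * ?d b x)) x" by simp
      qed
      have "(\<lambda>x. c n b * ?d b x) \<in> F.span (?d ` B)" if "b \<in> B" for b
        by (rule F.span_scale[OF F.span_base]) (rule imageI[OF that])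
      then have "(\<Sum>b\<in>B. (\<lambda>x. c n b * ?d b x)) \<in> F.span (?d ` B)"
        by (rule F.span_sum)
      then show ?thesis
        by (rule iffD2[OF arg_cong[OF eq, of "\<lambda>v. v \<in> F.span (?d ` B)"]])
    qed
    then have sub: "c ` {..?N} \<subseteq> F.span (?d ` B)" by blast
    have "F.dependent (c ` {..?N})"
    proof (rule ccontr)
      assume "\<not> F.dependent (c ` {..?N})"
      then have "card (c ` {..?N}) \<le> card (?d ` B)"
        using F.independent_span_bound[OF _ _ sub] B(1) by auto
      also have "\<dots> \<le> card B" using B(1) card_image_le by blast
      finally show False using card_image[OF True] by simp
    qed
    then obtain u where u: "\<exists>v\<in>c ` {..?N}. u v \<noteq> 0" "(\<Sum>v\<in>c ` {..?N}. (\<lambda>x. u v * v x)) = 0"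
      using F.dependent_finite[of "c ` {..?N}"] by auto
    then have "(\<Sum>i\<le>?N. (\<lambda>x. u (c i) * c i x)) = 0" using sum.reindex[OF True, of "\<lambda>v x. u v * v x"] by (simp add: o_def)
    then show ?thesis using u(1) by (intro exI[of _ "u \<circ> c"]) auto
  qed
  then obtain u i where u: "i \<le> ?N" "u i \<noteq> 0" "(\<Sum>i\<le>?N. (\<lambda>x. u i * c i x)) = 0" by blast
  let ?p = "\<Sum>i\<le>?N. monom (u i) i"
  have "coeff ?p i = u i" using u(1) by (simp add: coeff_sum)
  then have "?p \<noteq> 0" using u(2) by auto
  have "lincomb bs 0 = 0 \<odot> lincomb bs (\<lambda>x. 0)"
    using lincomb_smult[of bs 0 "\<lambda>x. 0"] bs B by (simp add: zero_fun_def)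
  then have "peval ?p = zeroM C X X" using lin[of u ?N] u(3) lincomb_hom bs B X by simp
  with \<open>?p \<noteq> 0\<close> show ?thesis by blast
qed

text \<open>Induction on the degree: split off a root \<open>a\<close>. Either \<open>f\<close>
  minus \<open>a\<close> vanishes, or it is invertible and cancels, so that the cofactor annihilates
  \<open>f\<close> too.\<close>

lemma simple_end_scalar_aux:
  assumes "simple_object C X" "p \<noteq> 0" "peval p = zeroM C X X"
  shows "\<exists>a. f = a \<odot> ident C X"
  using assms(2,3)
proof (induction "degree p" arbitrary: p rule: less_induct)
  case less
  show ?case
  proof (cases "degree p = 0")
    case True
    then obtain c where c: "p = [:c:]" by (metis degree_eq_zeroE)
    then have "c \<odot> ident C X = 0 \<odot> ident C X"
      using less.prems X f endo_closed comp_zeroM_right[of X X X f] addM_zero[of X X "c \<odot> ident C X"]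
      by (simp add: peval_pCons peval_0)
    then have "c = 0" using scalar_inj[OF X] assms(1) by (auto simp: simple_object_def)
    then show ?thesis using c less.prems by simp
  next
    case False
    then obtain a where "poly p a = 0" using alg_closed_imp_poly_has_root by blast
    then obtain q where q: "p = [:- a, 1:] * q" using poly_eq_0_iff_dvd by blast
    let ?g = "f \<oplus> (- a) \<odot> ident C X"
    have g: "?g \<in> Hom C X X" using endo_closed f by blast
    show ?thesis
    proof (cases "?g = zeroM C X X")
      case True
      then have "f = a \<odot> ident C X"
        using eq_if_diff_zero[OF X X f, of "a \<odot> ident C X"] smulM_times[OF X X endo_closed(1), of "- 1" a] endo_closed by simp
      then show ?thesis by blast
    next
      case False
      then obtain h where h: "h \<in> Hom C X X" "h \<cdot> ?g = ident C X"
        using simple_hom_iso[OF assms(1,1) g] by (auto simp: iso_in_def inverse_pair_def)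
      have "?g \<cdot> peval q = zeroM C X X" using less.prems(2) q peval_root_factor by simp
      then have "h \<cdot> (?g \<cdot> peval q) = zeroM C X X" using comp_zeroM_right X h by simp
      then have "peval q = zeroM C X X"
        using comp_assoc[of X X X X h ?g "peval q"] X g h peval_hom ident_left by simp
      moreover have "q \<noteq> 0" using q less.prems by auto
      moreover have "degree q < degree p" using q \<open>q \<noteq> 0\<close> by (simp add: degree_mult_eq del: mult_pCons_left)
      ultimately show ?thesis using less.hyps by blast
    qed
  qed
qed

end

lemma simple_end_scalar:
  assumes "simple_object C X" "f \<in> Hom C X X"
  shows "\<exists>a. f = a \<odot> ident C X"
proof -
  have X: "X \<in> Obj C" using assms by (simp add: simple_object_def)
  show ?thesis
    using ex_annihilating_poly[OF X assms(2)] simple_end_scalar_aux[OF X assms(2,1)] by blast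
qed

end

section \<open>Constant matrices and block-rank-one\<close>

text \<open>The whole matrix is one block, and all its rows are the same nonzero vector.\<close>

lemma block_rank_one_constI:
  fixes M :: "'k::field^'i^'i"
  assumes "c \<noteq> 0" and M: "\<And>i j. M $ i $ j = c"
  shows "block_rank_one M"
proof -
  have supp: "matrix_supp M = UNIV" using assms by (auto simp: matrix_supp_def)
  have block: "matrix_block M UNIV UNIV = M" by (simp add: matrix_block_def vec_eq_iff)
  have "rows M = {\<chi> j. c}" using M by (auto simp: rows_def row_def)
  moreover have "(\<chi> j. c) \<noteq> (0 :: 'k^'i)" using assms(1) by (simp add: vec_eq_iff)
  ultimately have "rank M = 1"
    unfolding row_rank_def_gen by (simp add: vec.dim_eq_card_independent)
  then show ?thesis
    unfolding block_rank_one_def rectangular_decomposition_def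
    by (intro exI[of _ "1 :: nat"] exI[of _ "\<lambda>_. UNIV"]) (auto simp: supp block disjoint_family_on_def)
qed

text \<open>Row and column \<open>i0\<close> have full support, so one block covers the matrix.
  Having rank one, it has only multiples of the constant row \<open>i0\<close> as rows; the factor
  is read off in column \<open>i0\<close>.\<close>

lemma block_rank_oneD_const:
  fixes M :: "'k::field^'i^'i"
  assumes "block_rank_one M" "c \<noteq> 0" and row: "\<And>j. M $ i0 $ j = c" and col: "\<And>i. M $ i $ i0 = c"
  shows "M $ i $ j = c"
proof -
  obtain s R K where D: "rectangular_decomposition M s R K"
    and rk: "\<And>p. p < s \<Longrightarrow> rank (matrix_block M (R p) (K p)) = 1"
    using assms(1) by (auto simp: block_rank_one_def)
  have disj: "disjoint_family_on R {..<s}" "disjoint_family_on K {..<s}"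
    and supp: "matrix_supp M = (\<Union>p<s. R p \<times> K p)"
    using D by (auto simp: rectangular_decomposition_def)
  have row_supp: "\<exists>q<s. i0 \<in> R q \<and> j \<in> K q" for j
  proof -
    have "(i0, j) \<in> matrix_supp M" using row assms(2) by (simp add: matrix_supp_def)
    then show ?thesis unfolding supp by auto
  qed
  have col_supp: "\<exists>q<s. i \<in> R q \<and> i0 \<in> K q" for i
  proof -
    have "(i, i0) \<in> matrix_supp M" using col assms(2) by (simp add: matrix_supp_def)
    then show ?thesis unfolding supp by auto
  qed
  obtain p where p: "p < s" "i0 \<in> R p" "i0 \<in> K p" using row_supp by blast
  have same: "q = p" if "q < s" "i0 \<in> R q \<or> i0 \<in> K q" for q
  proof (rule ccontr)
    assume "q \<noteq> p"
    then have "R q \<inter> R p = {}" "K q \<inter> K p = {}"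
      using disj that(1) p(1) by (simp_all add: disjoint_family_on_def)
    then show False using that(2) p by blast
  qed
  have "j \<in> K p" for j using row_supp[of j] same by metis
  moreover have "i \<in> R p" for i using col_supp[of i] same by metis
  ultimately have "matrix_block M (R p) (K p) = M" by (simp add: matrix_block_def vec_eq_iff)
  then have "vec.dim (rows M) = 1" using rk[OF p(1)] by (simp add: row_rank_def_gen)
  have nz: "row i0 M \<noteq> 0" using row assms(2) by (auto simp: row_def vec_eq_iff)
  have "row i M \<in> vec.span {row i0 M}"
  proof (rule ccontr)
    assume *: "row i M \<notin> vec.span {row i0 M}"
    then have "vec.independent {row i M, row i0 M}"
      using nz vec.independent_insertI[of "row i M" "{row i0 M}"] by simp
    moreover have "{row i M, row i0 M} \<subseteq> rows M" by (auto simp: rows_def)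
    ultimately have "card {row i M, row i0 M} \<le> vec.dim (rows M)"
      using vec.independent_card_le_dim by blast
    moreover have "row i M \<noteq> row i0 M" using * vec.span_base[of "row i0 M" "{row i0 M}"] by (metis insertI1)
    ultimately show False using \<open>vec.dim (rows M) = 1\<close> by simp
  qed
  then obtain a where a: "row i M = a *s row i0 M" by (auto simp: vec.span_singleton)
  have "M $ i $ l = a * c" for l
    using arg_cong[OF a, of "\<lambda>v. v $ l"] row by (simp add: row_def)
  then show ?thesis using col[of i] by metis
qed

section \<open>Characters of a modular category\<close>

locale modular_alg_closed = modular_category C V i0
  for C :: "('o, 'm, 'k::{alg_closed_field, field_char_0}) ribbon_data" (structure)
    and V :: "'i::finite \<Rightarrow> 'o" and i0 :: 'i

sublocale modular_alg_closed \<subseteq> alg_closed_category C ..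

context modular_alg_closed
begin

lemma V_obj [simp]: "V i \<in> Obj C"
  using V_simple[of i] by (simp add: simple_object_def)

lemma ssmul_sid: "ssmul a (sid l) = lift l l (a \<odot> ident C (T l))"
  unfolding lift_ident lift_smul ..

lemma simple_ssmul_inj: "ssmul a (sid [V i]) = ssmul b (sid [V i]) \<longleftrightarrow> a = b"
  using scalar_inj[of "V i" a b] V_simple[of i] by (auto simp: ssmul_sid simple_object_def)

lemma unit_scalar_inj: "a \<odot> ident C \<one> = b \<odot> ident C \<one> \<longleftrightarrow> a = b"
  using scalar_inj[of \<one> a b] unit_nonzero by auto

lemma strict_simple_end_scalar:
  assumes "sarr f" "dom f = [V i]" "cod f = [V i]"
  shows "\<exists>a. f = ssmul a (sid [V i])"
proof -
  obtain g where g: "f = lift [V i] [V i] g" "g \<in> Hom C (V i) (V i)"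
    using sarr_cases[OF assms(1)] assms(2,3) by auto
  then show ?thesis using simple_end_scalar[OF V_simple g(2)] by (auto simp: ssmul_sid)
qed

definition chi_scalar :: "'i \<Rightarrow> 'o list \<Rightarrow> 'o list \<Rightarrow> ('o list, ('o, 'm) typed) typed \<Rightarrow> ('o list, ('o, 'm) typed) typed \<Rightarrow> 'k" where
  "chi_scalar i l d e h = (THE a. S.chi [V i] l d e h = ssmul a (sid [V i]))"

lemma chi_eq_scalar:
  assumes "S.dual_pair l d e h"
  shows "S.chi [V i] l d e h = ssmul (chi_scalar i l d e h) (sid [V i])"
proof -
  obtain a where a: "S.chi [V i] l d e h = ssmul a (sid [V i])"
    using strict_simple_end_scalar[of "S.chi [V i] l d e h" i] S.chi_type[OF assms, of "[V i]"] by auto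
  then have "chi_scalar i l d e h = a" unfolding chi_scalar_def using simple_ssmul_inj by (intro the_equality) auto
  then show ?thesis using a by simp
qed

lemma chi_scalar_eq:
  assumes "S.dual_pair l d e h" "S.chi [V i] l d e h = ssmul a (sid [V i])"
  shows "chi_scalar i l d e h = a"
  using chi_eq_scalar[OF assms(1), of i] assms(2) simple_ssmul_inj by metis

text \<open>The scalar by which a loop coloured \<open>X\<close> around a strand coloured \<open>V i\<close> acts: \<open>S_ij / d_i\<close> for \<open>X = V j\<close>.\<close>
definition character :: "'i \<Rightarrow> 'o \<Rightarrow> 'k" where
  "character i X = chi_scalar i [X] [dual C X] (sev X) (scoev X)"

lemma sarr_lift1: "\<lbrakk>X \<in> Obj C; Y \<in> Obj C; f \<in> Hom C X Y\<rbrakk> \<Longrightarrow> sarr (lift [X] [Y] f)"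
  by (rule sarr_lift) auto

lemma character_iso:
  assumes "X \<in> Obj C" "Y \<in> Obj C" "isomorphic C X Y"
  shows "character i X = character i Y"
proof -
  obtain f g where fg: "f \<in> Hom C X Y" "g \<in> Hom C Y X" "g \<cdot> f = ident C X" "f \<cdot> g = ident C Y"
    using assms(3) by (auto simp: isomorphic_def iso_in_def inverse_pair_def)
  have "S.chi [V i] [X] [dual C X] (sev X) (scoev X) = S.chi [V i] [Y] [dual C Y] (sev Y) (scoev Y)"
    by (rule S.chi_iso[OF dual_pair_single[OF assms(2)] dual_pair_single[OF assms(1)], of _ "lift [X] [Y] f" "lift [Y] [X] g"])
      (use assms fg in \<open>auto simp: sarr_lift1 lift_comp lift_ident\<close>)
  then show ?thesis by (simp add: character_def chi_scalar_def)
qed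

lemma character_biproduct:
  assumes "A \<in> Obj C" "B \<in> Obj C" "Y \<in> Obj C" "biproduct C A B Y"
  shows "character i Y = character i A + character i B"
proof -
  obtain f g p q where fg: "f \<in> Hom C A Y" "g \<in> Hom C B Y" "p \<in> Hom C Y A" "q \<in> Hom C Y B"
    "p \<cdot> f = ident C A" "q \<cdot> g = ident C B" "(f \<cdot> p) \<oplus> (g \<cdot> q) = ident C Y"
    using assms(4) by (auto simp: biproduct_def)
  have "S.chi [V i] [Y] [dual C Y] (sev Y) (scoev Y)
      = sadd (S.chi [V i] [A] [dual C A] (sev A) (scoev A)) (S.chi [V i] [B] [dual C B] (sev B) (scoev B))"
    by (rule S.chi_biproduct[OF dual_pair_single[OF assms(3)] dual_pair_single[OF assms(1)] dual_pair_single[OF assms(2)],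
          of _ "lift [A] [Y] f" "lift [Y] [A] p" "lift [B] [Y] g" "lift [Y] [B] q"])
      (use assms fg in \<open>auto simp: sarr_lift1 lift_comp lift_ident lift_add\<close>)
  also have "\<dots> = ssmul (character i A + character i B) (sid [V i])"
    using smulM_plus[of "V i" "V i" "ident C (V i)" "character i A" "character i B"] ident_hom[of "V i"]
    by (simp add: chi_eq_scalar[OF dual_pair_single[OF assms(1)]] chi_eq_scalar[OF dual_pair_single[OF assms(2)]] character_def ssmul_sid lift_add)
  finally show ?thesis unfolding character_def[of i Y] by (rule chi_scalar_eq[OF dual_pair_single[OF assms(3)]])
qed

text \<open>A zero object is a direct sum of two copies of itself, so its character equals its own
  double.\<close>

lemma character_zero_object:
  assumes "zero_object C Z"
  shows "character i Z = 0"
proof -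
  have Z: "Z \<in> Obj C" using assms by (simp add: zero_object_def)
  let ?z = "zeroM C Z Z"
  have z: "?z \<in> Hom C Z Z" using Z zeroM_hom by blast
  have "ident C Z = ?z" using zero_object_hom(1)[OF assms Z] ident_hom[OF Z] by blast
  then have "biproduct C Z Z Z"
    unfolding biproduct_def using z Z comp_zeroM_left[OF Z Z Z z] addM_zero[OF Z Z z]
    by (intro bexI[of _ ?z]) auto
  from character_biproduct[OF Z Z Z this, of i] show ?thesis by simp
qed

text \<open>Since \<open>T [X, Y]\<close> is \<open>X \<otimes> Y\<close>, one identity morphism
  connects the list of two objects with the list of one.\<close>

lemma tensor_object_iso:
  assumes "X \<in> Obj C" "Y \<in> Obj C"
  defines "u \<equiv> lift [X, Y] [X \<otimes> Y] (ident C (X \<otimes> Y))" and "v \<equiv> lift [X \<otimes> Y] [X, Y] (ident C (X \<otimes> Y))"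
  shows "sarr u" "dom u = [X, Y]" "cod u = [X \<otimes> Y]" "sarr v" "dom v = [X \<otimes> Y]" "cod v = [X, Y]"
    "scomp v u = sid [X, Y]" "scomp u v = sid [X \<otimes> Y]"
  using assms ident_hom[of "X \<otimes> Y"] ident_left[of "X \<otimes> Y" "X \<otimes> Y" "ident C (X \<otimes> Y)"]
  by (auto simp: u_def v_def lift_comp lift_ident[of "[X, Y]"] lift_ident[of "[X \<otimes> Y]"] simp del: S.tns_I intro!: sarr_lift)

text \<open>Along the isomorphism of \<open>[X \<otimes> Y]\<close> with \<open>[X, Y]\<close> the
  loop becomes two nested loops; \<open>chi_iso\<close> absorbs the change of dual.\<close>

lemma character_tensor:
  assumes X: "X \<in> Obj C" and Y: "Y \<in> Obj C"
  shows "character i (X \<otimes> Y) = character i X * character i Y"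
proof -
  have XY: "X \<otimes> Y \<in> Obj C" using X Y by simp
  note u = tensor_object_iso[OF X Y]
  note d = S.dual_pair_append[OF dual_pair_single[OF X] dual_pair_single[OF Y], simplified append_Cons append_Nil]
  have "ssmul (character i (X \<otimes> Y)) (sid [V i]) = S.chi [V i] [X \<otimes> Y] [dual C (X \<otimes> Y)] (sev (X \<otimes> Y)) (scoev (X \<otimes> Y))"
    by (simp add: chi_eq_scalar[OF dual_pair_single[OF XY]] character_def)
  also have "\<dots> = S.chi [V i] ([X] @ [Y]) ([dual C Y] @ [dual C X])
      (scomp (sev Y) (stensor (sid [dual C Y]) (stensor (sev X) (sid [Y]))))
      (scomp (stensor (sid [X]) (stensor (scoev Y) (sid [dual C X]))) (scoev X))"
    unfolding append_Cons append_Nil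
    by (rule S.chi_iso[OF d dual_pair_single[OF XY] _ u(4-6) u(1-3) u(8,7)]) simp
  also have "\<dots> = ssmul (character i Y) (S.chi [V i] [X] [dual C X] (sev X) (scoev X))"
    by (rule S.chi_append[OF dual_pair_single[OF X] dual_pair_single[OF Y]])
      (simp_all add: chi_eq_scalar[OF dual_pair_single[OF Y]] character_def)
  also have "\<dots> = ssmul (character i X * character i Y) (sid [V i])"
    using smulM_times[of "V i" "V i" "ident C (V i)" "character i Y" "character i X"] ident_hom[of "V i"]
    by (simp add: chi_eq_scalar[OF dual_pair_single[OF X]] character_def[symmetric] ssmul_sid lift_smul mult.commute)
  finally show ?thesis using simple_ssmul_inj by blast
qed

lemma trace_scalar:
  assumes X: "X \<in> Obj C" and f: "f \<in> Hom C X X"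
  shows "S.ptr [] [] [X] [dual C X] (sev X) (scoev X) (lift [X] [X] f) = ssmul (qtrace C X f) (sid [])"
proof -
  let ?t = "ev C X \<cdot> braid C X (dual C X) \<cdot> ((twist C X \<cdot> f) \<otimes>\<^sub>m ident C (dual C X)) \<cdot> coev C X"
  let ?p = "S.ptr [] [] [X] [dual C X] (sev X) (scoev X) (lift [X] [X] f)"
  have "sarr ?p" "dom ?p = []" "cod ?p = []"
    using S.ptr_type[OF dual_pair_single[OF X], of "lift [X] [X] f" "[]" "[]"] sarr_lift1[OF X X f] by auto
  then have "?t \<in> Hom C \<one> \<one>" using sarr_cases[of ?p] trace_lift[OF X f] by (metis T.simps(1) lift_inject)
  then obtain a where a: "?t = a \<odot> ident C \<one>" using end_unit by blast
  then have "qtrace C X f = a"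
    unfolding qtrace_def a using unit_scalar_inj by (intro end_unit_scalar_eq) auto
  then show ?thesis using trace_lift[OF X f] a by (simp add: ssmul_sid)
qed

text \<open>The dimension as a trace of the identity. That it agrees with \<open>quantum_dim\<close>
  needs the symmetry of \<open>S\<close> and \<open>character j \<one> = 1\<close>.\<close>

abbreviation qdim :: "'i \<Rightarrow> 'k" where
  "qdim i \<equiv> qtrace C (V i) (ident C (V i))"

text \<open>The closure of the monodromy by nested cups and caps, instead of by the dual of
  \<open>X \<otimes> Y\<close> that occurs in the S-matrix.\<close>

definition pair_trace where
  "pair_trace X Y = S.ptr [] [] [X, Y] [dual C Y, dual C X]
      (scomp (sev Y) (stensor (sid [dual C Y]) (stensor (sev X) (sid [Y]))))
      (scomp (stensor (sid [X]) (stensor (scoev Y) (sid [dual C X]))) (scoev X)) (S.dbr [X] [Y])"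

text \<open>Cyclicity applied to an isomorphism between different lists exchanges the dual of
  \<open>V i \<otimes> V j\<close> for the product of the separate duals.\<close>

lemma S_matrix_pair_trace: "ssmul (S_matrix C V $ i $ j) (sid []) = pair_trace (V i) (V j)"
proof -
  let ?X = "V i" and ?Y = "V j"
  let ?P = "?X \<otimes> ?Y" and ?c = "braid C (V j) (V i) \<cdot> braid C (V i) (V j)"
  let ?u = "lift [?X, ?Y] [?P] (ident C ?P)" and ?v = "lift [?P] [?X, ?Y] (ident C ?P)"
  note u = tensor_object_iso[OF V_obj V_obj, of i j]
  note d = S.dual_pair_append[OF dual_pair_single[OF V_obj] dual_pair_single[OF V_obj], simplified append_Cons append_Nil, of i j]
  have P: "?P \<in> Obj C" by simp
  have db: "S.dbr [?X] [?Y] = lift [?X, ?Y] [?X, ?Y] ?c"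
    by (simp add: S.dbr_def lift_braid lift_comp)
  have c: "?c \<in> Hom C ?P ?P"
    using sarrD(3)[OF S.dbr_type(3)[of "[?Y]" "[?X]"]] unfolding db by (simp add: valid_def del: valid_obj)
  have "ssmul (S_matrix C V $ i $ j) (sid []) = S.ptr [] [] [?P] [dual C ?P] (sev ?P) (scoev ?P) (lift [?P] [?P] ?c)"
    using trace_scalar[OF P c] by (simp add: S_matrix_def)
  also have "lift [?P] [?P] ?c = scomp (stensor (sid []) ?u) (scomp (S.dbr [?X] [?Y]) ?v)"
    using u(1) c P ident_left[OF P P c] ident_right[OF P P c] by (simp add: db lift_comp)
  also have "S.ptr [] [] [?P] [dual C ?P] (sev ?P) (scoev ?P) \<dots> = S.ptr [] [] [?X, ?Y] [dual C ?Y, dual C ?X]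
      (scomp (sev ?Y) (stensor (sid [dual C ?Y]) (stensor (sev ?X) (sid [?Y]))))
      (scomp (stensor (sid [?X]) (stensor (scoev ?Y) (sid [dual C ?X]))) (scoev ?X)) 
      (scomp (scomp (S.dbr [?X] [?Y]) ?v) (stensor (sid []) ?u))"
    by (rule S.ptr_cyclic[OF dual_pair_single[OF P] d]) (use u in auto)
  also have "scomp (scomp (S.dbr [?X] [?Y]) ?v) (stensor (sid []) ?u) = S.dbr [?X] [?Y]"
    using u(1) c ident_left[OF P P ident_hom[OF P]] ident_right[OF P P c] by (simp add: db lift_comp)
  finally show ?thesis unfolding pair_trace_def .
qed

lemma unit_ssmul_inj: "ssmul a (sid []) = ssmul b (sid []) \<longleftrightarrow> a = b"
  using unit_scalar_inj by (simp add: ssmul_sid)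

lemma S_matrix_character: "S_matrix C V $ i $ j = character i (V j) * qdim i"
proof -
  have "ssmul (S_matrix C V $ i $ j) (sid []) = ssmul (character i (V j)) (S.ptr [] [] [V i] [dual C (V i)] (sev (V i)) (scoev (V i)) (sid [V i]))"
    unfolding S_matrix_pair_trace pair_trace_def
    by (rule S.tr_dbr[OF dual_pair_single[OF V_obj] dual_pair_single[OF V_obj], simplified append_Cons append_Nil])
      (simp add: chi_eq_scalar[OF dual_pair_single] character_def)
  also have "\<dots> = ssmul (character i (V j)) (ssmul (qdim i) (sid []))"
    using trace_scalar[OF V_obj ident_hom[OF V_obj], of i] by (simp add: lift_ident[of "[V i]"])
  also have "\<dots> = ssmul (character i (V j) * qdim i) (sid [])"
    using smulM_times[of \<one> \<one> "ident C \<one>" "character i (V j)" "qdim i"] ident_hom[of \<one>]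
    by (simp add: ssmul_sid lift_smul)
  finally show ?thesis using unit_ssmul_inj by blast
qed

text \<open>The monodromy consists of two crossings; moving one of them around the closure gives the
  monodromy in the opposite order.\<close>

lemma S_matrix_symmetric: "S_matrix C V $ i $ j = S_matrix C V $ j $ i"
proof -
  note d = S.dual_pair_append[OF dual_pair_single[OF V_obj] dual_pair_single[OF V_obj], simplified append_Cons append_Nil]
  have "pair_trace (V i) (V j) = pair_trace (V j) (V i)"
    using S.ptr_cyclic[OF d[of i j] d[of j i], of "sbraid [V j] [V i]" "sbraid [V i] [V j]" "[]" "[]"]
    by (simp add: pair_trace_def S.dbr_def)
  then show ?thesis using S_matrix_pair_trace unit_ssmul_inj by metis
qed

end

section \<open>Fusion rules\<close>

context modular_alg_closed
begin

lemma S_times_vec_zero: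
  assumes "\<And>i. (\<Sum>j\<in>UNIV. S_matrix C V $ i $ j * x j) = 0"
  shows "x j = 0"
proof -
  obtain B where B: "B ** S_matrix C V = mat 1"
    using S_invertible by (auto simp: invertible_def)
  have "S_matrix C V *v (\<chi> j. x j) = 0"
    using assms by (simp add: matrix_vector_mult_def vec_eq_iff)
  then have "(B ** S_matrix C V) *v (\<chi> j. x j) = 0"
    by (simp flip: matrix_vector_mul_assoc)
  then show ?thesis using B by (simp add: vec_eq_iff)
qed

text \<open>By symmetry column \<open>i\<close> of \<open>S\<close> has the factor
  \<open>qdim i\<close>, so a zero dimension would make \<open>S\<close> singular.\<close>

lemma qdim_nonzero: "qdim i \<noteq> 0"
proof
  assume "qdim i = 0"
  then have "S_matrix C V $ k $ i = 0" for k
    using S_matrix_character[of i k] S_matrix_symmetric[of k i] by simp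
  then have "(\<Sum>j\<in>UNIV. S_matrix C V $ k $ j * (if j = i then 1 else 0)) = 0" for k
    by (simp add: if_distrib cong: if_cong)
  from S_times_vec_zero[OF this, of i] show False by simp
qed

text \<open>Scaling row \<open>i\<close> of the character matrix by \<open>qdim i\<close> gives
  \<open>S\<close>, so its kernel lies in that of \<open>S\<close>.\<close>

lemma characters_independent:
  assumes "\<And>i. (\<Sum>j\<in>UNIV. character i (V j) * x j) = 0"
  shows "x j = 0"
proof (rule S_times_vec_zero)
  fix i
  have "(\<Sum>j\<in>UNIV. S_matrix C V $ i $ j * x j) = qdim i * (\<Sum>j\<in>UNIV. character i (V j) * x j)"
    by (simp add: S_matrix_character sum_distrib_left mult_ac)
  then show "(\<Sum>j\<in>UNIV. S_matrix C V $ i $ j * x j) = 0" using assms by simp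
qed

section \<open>Multiplicity vectors and their character values\<close>

definition class_value :: "'i \<Rightarrow> ('i \<Rightarrow> nat) \<Rightarrow> 'k" where
  "class_value i n = (\<Sum>l\<in>UNIV. of_nat (n l) * character i (V l))"

text \<open>Independence of characters gives equality in the field, and characteristic zero brings
  it back to natural numbers.\<close>

lemma class_value_inject:
  assumes "\<And>i. class_value i m = class_value i n"
  shows "m = n"
proof
  fix l
  have "(\<Sum>j\<in>UNIV. character i (V j) * (of_nat (m j) - of_nat (n j))) = 0" for i
    using assms[of i] by (simp add: class_value_def algebra_simps sum_subtractf)
  from characters_independent[OF this, of l] show "m l = n l" by simp
qed

definition basis :: "'i \<Rightarrow> 'i \<Rightarrow> nat" where
  "basis l = (\<lambda>j. if j = l then 1 else 0)"

lemma basis_apply [simp]: "basis l j = (if j = l then 1 else 0)"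
  by (simp add: basis_def)

lemma class_value_basis [simp]: "class_value i (basis l) = character i (V l)"
proof -
  have "class_value i (basis l) = (\<Sum>j\<in>UNIV. if j = l then character i (V j) else 0)"
    unfolding class_value_def by (intro sum.cong) auto
  then show ?thesis by simp
qed

text \<open>From \<open>\<one> \<otimes> V j\<close> being isomorphic to \<open>V j\<close>, a value
  \<open>character i (V j)\<close> cancels; a nonzero one exists because row \<open>i\<close> of
  \<open>S\<close> is nonzero.\<close>

lemma character_unit [simp]: "character i \<one> = 1"
proof -
  obtain j where j: "character i (V j) \<noteq> 0"
  proof -
    have "\<exists>j. S_matrix C V $ i $ j \<noteq> 0"
    proof (rule ccontr)
      assume "\<not> ?thesis"
      then have "S_matrix C V $ k $ i = 0" for k using S_matrix_symmetric[of i k] by simp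
      then have "(\<Sum>j\<in>UNIV. S_matrix C V $ k $ j * (if j = i then 1 else 0)) = 0" for k
        by (simp add: if_distrib cong: if_cong)
      from S_times_vec_zero[OF this, of i] show False by simp
    qed
    then show ?thesis using that S_matrix_character by auto
  qed
  have "isomorphic C (\<one> \<otimes> V j) (V j)"
    using lunit_iso[of "V j"] by (auto simp: isomorphic_def)
  then have "character i \<one> * character i (V j) = character i (V j)"
    using character_iso[of "\<one> \<otimes> V j" "V j" i] character_tensor[of \<one> "V j" i] by simp
  then show ?thesis using j by simp
qed

text \<open>A relation, because an object has many decompositions; that they share one multiplicity
  vector follows from \<open>decomposes_character\<close> and
  \<open>class_value_inject\<close>.\<close>

inductive decomposes :: "'o \<Rightarrow> ('i \<Rightarrow> nat) \<Rightarrow> bool" where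
  zero: "zero_object C X \<Longrightarrow> decomposes X (\<lambda>_. 0)"
| add: "\<lbrakk>S \<in> Obj C; simple_object C S; isomorphic C S (V l); X \<in> Obj C; decomposes X n; Y \<in> Obj C; biproduct C S X Y\<rbrakk>
    \<Longrightarrow> decomposes Y (\<lambda>j. n j + basis l j)"

lemma sum_of_simples_decomposes: "sum_of_simples C X \<Longrightarrow> X \<in> Obj C \<and> (\<exists>n. decomposes X n)"
proof (induction rule: sum_of_simples.induct)
  case (empty X)
  then show ?case using decomposes.zero by (auto simp: zero_object_def)
next
  case (add S X Y)
  then obtain n where n: "decomposes X n" by blast
  have S: "S \<in> Obj C" using add by (simp add: simple_object_def)
  obtain l where "isomorphic C S (V l)" using V_representatives add by blast
  from decomposes.add[OF S _ this _ n] add show ?case by blast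
qed

lemma ex_decomposes: "X \<in> Obj C \<Longrightarrow> \<exists>n. decomposes X n"
  using sum_of_simples_decomposes semisimple by blast

lemma class_value_add: "class_value i (\<lambda>j. m j + n j) = class_value i m + class_value i n"
  by (simp add: class_value_def algebra_simps sum.distrib)

lemma decomposes_character: "decomposes X n \<Longrightarrow> character i X = class_value i n"
proof (induction rule: decomposes.induct)
  case (zero X)
  then show ?case by (simp add: character_zero_object class_value_def)
next
  case (add S l X n Y)
  then have "character i Y = class_value i n + character i (V l)"
    using character_biproduct[of S X Y i] character_iso[of S "V l" i] by simp
  then show ?case unfolding class_value_add class_value_basis .
qed

lemma decomposes_zero: "decomposes X n \<Longrightarrow> n = (\<lambda>_. 0) \<Longrightarrow> zero_object C X"
  by (induction rule: decomposes.induct) (auto simp: fun_eq_iff split: if_splits)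

lemma iso_in_iso\<^sub>t: "\<lbrakk>X \<in> Obj C; Y \<in> Obj C\<rbrakk> \<Longrightarrow> iso_in C X Y f \<longleftrightarrow> iso\<^sub>t (Typed X Y f)"
  by (auto simp: iso\<^sub>t_def valid_def iso_in_def inverse_pair_def simp del: valid_obj iso\<^sub>t_inv(1))

lemma isomorphic_trans:
  assumes "X \<in> Obj C" "Y \<in> Obj C" "Z \<in> Obj C" "isomorphic C X Y" "isomorphic C Y Z"
  shows "isomorphic C X Z"
proof -
  obtain f g where "iso\<^sub>t (Typed X Y f)" "iso\<^sub>t (Typed Y Z g)"
    using assms iso_in_iso\<^sub>t by (auto simp: isomorphic_def)
  then have "iso\<^sub>t (Typed Y Z g \<circ>\<^sub>t Typed X Y f)" by simp
  then show ?thesis using assms iso_in_iso\<^sub>t[of X Z] by (auto simp: comp\<^sub>t_def isomorphic_def)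
qed

lemma biproduct_zero_iso:
  assumes "S \<in> Obj C" "X \<in> Obj C" "Y \<in> Obj C" "biproduct C S X Y" "zero_object C X"
  shows "isomorphic C Y S"
proof -
  obtain f g p q where fg: "f \<in> Hom C S Y" "g \<in> Hom C X Y" "p \<in> Hom C Y S" "q \<in> Hom C Y X"
    "p \<cdot> f = ident C S" "(f \<cdot> p) \<oplus> (g \<cdot> q) = ident C Y"
    using assms(4) by (auto simp: biproduct_def)
  have "g \<cdot> q = zeroM C Y Y"
    using zero_object_hom(1)[OF assms(5,3) fg(4)] comp_zeroM_right[OF assms(3,2,3) fg(2)] by simp
  then have "f \<cdot> p = ident C Y"
    using fg addM_zero[of Y Y "f \<cdot> p"] comp_hom[of Y S Y f p] assms by simp
  then show ?thesis using fg by (auto simp: isomorphic_def iso_in_def inverse_pair_def)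
qed

text \<open>A single nonzero entry forces one simple summand over a zero object.\<close>

lemma decomposes_basis: "decomposes X n \<Longrightarrow> n = basis l \<Longrightarrow> isomorphic C X (V l)"
proof (induction rule: decomposes.induct)
  case (zero X)
  from fun_cong[OF zero(2), of l] show ?case by simp
next
  case (add S k X n Y)
  from fun_cong[OF add.prems, of k] have k: "k = l" by (auto split: if_splits)
  have "n = (\<lambda>_. 0)"
  proof
    fix j from fun_cong[OF add.prems, of j] k show "n j = 0" by (auto split: if_splits)
  qed
  then have "zero_object C X" using decomposes_zero add by blast
  then have "isomorphic C Y S" using biproduct_zero_iso add by blast
  then show ?case using isomorphic_trans[of Y S "V l"] add k by simp
qed

lemma isomorphic_unit_iff:
  assumes "X \<in> Obj C"
  shows "isomorphic C X \<one> \<longleftrightarrow> (\<forall>i. character i X = 1)"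
proof
  assume "isomorphic C X \<one>"
  then show "\<forall>i. character i X = 1" using character_iso[OF assms, of \<one>] by simp
next
  assume *: "\<forall>i. character i X = 1"
  obtain n where n: "decomposes X n" using ex_decomposes[OF assms] by blast
  have "n = basis i0"
    using * decomposes_character[OF n] by (intro class_value_inject) (simp add: V_unit del: One_nat_def)
  then show "isomorphic C X \<one>" using decomposes_basis[OF n, of i0] V_unit by simp
qed

section \<open>Morphisms from the unit and the multiplicity of the unit\<close>

lemma unit_hom_zero:
  assumes "decomposes X n" "n i0 = 0" "f \<in> Hom C \<one> X"
  shows "f = zeroM C \<one> X"
  using assms
proof (induction arbitrary: f rule: decomposes.induct)
  case (zero X)
  then show ?case using zero_object_hom(1) unitO_obj by blast
next
  case (add S l X n Y)
  obtain i j p q where b: "i \<in> Hom C S Y" "j \<in> Hom C X Y" "p \<in> Hom C Y S" "q \<in> Hom C Y X"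
    "(i \<cdot> p) \<oplus> (j \<cdot> q) = ident C Y" using add by (auto simp: biproduct_def)
  have U: "\<one> \<in> Obj C" "simple_object C \<one>" using V_simple[of i0] V_unit by auto
  have pf: "p \<cdot> f \<in> Hom C \<one> S" and qf: "q \<cdot> f \<in> Hom C \<one> X"
    using comp_hom[OF U(1) add(6,1) b(3)] comp_hom[OF U(1) add(6,4) b(4)] add.prems by auto
  have "q \<cdot> f = zeroM C \<one> X" using add qf by simp
  moreover have "p \<cdot> f = zeroM C \<one> S"
  proof (rule ccontr)
    assume "p \<cdot> f \<noteq> zeroM C \<one> S"
    then have "isomorphic C \<one> S" using simple_hom_iso[OF U(2) add(2) pf] by (auto simp: isomorphic_def)
    then have "isomorphic C \<one> (V l)" using isomorphic_trans[of \<one> S "V l"] add by simp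
    then have "l = i0"
      using V_representatives[OF U(2)] V_unit iso\<^sub>t_id(1)[OF U(1)] iso_in_iso\<^sub>t[OF U(1) U(1), of "ident C \<one>"]
      by (metis isomorphic_def id\<^sub>t_def)
    then show False using add.prems by simp
  qed
  moreover have "f = (i \<cdot> p \<oplus> j \<cdot> q) \<cdot> f" using b ident_left[OF U(1) add(6)] add.prems by simp
  moreover have "\<dots> = (i \<cdot> p) \<cdot> f \<oplus> (j \<cdot> q) \<cdot> f"
    using comp_addM_left[of \<one> Y Y "i \<cdot> p" "j \<cdot> q" f] comp_hom[of Y S Y i p] comp_hom[of Y X Y j q] U b(1-4) add by simp
  moreover have "\<dots> = i \<cdot> (p \<cdot> f) \<oplus> j \<cdot> (q \<cdot> f)"
    using comp_assoc[of \<one> Y S Y i p f] comp_assoc[of \<one> Y X Y j q f] U b add by simp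
  ultimately show ?case
    using comp_zeroM_right[OF U(1) add(1,6) b(1)] comp_zeroM_right[OF U(1) add(4,6) b(2)] addM_zero[OF U(1) add(6) zeroM_hom[OF U(1) add(6)]]
    by simp
qed

lemma unit_hom_nonzero:
  assumes "decomposes X n" "n i0 > 0"
  shows "X \<in> Obj C \<and> (\<exists>f\<in>Hom C \<one> X. f \<noteq> zeroM C \<one> X)"
  using assms
proof (induction rule: decomposes.induct)
  case (add S l X n Y)
  obtain i j p q where b: "i \<in> Hom C S Y" "j \<in> Hom C X Y" "p \<in> Hom C Y S" "q \<in> Hom C Y X"
    "p \<cdot> i = ident C S" "q \<cdot> j = ident C X" using add by (auto simp: biproduct_def)
  have U: "\<one> \<in> Obj C" by simp
  have lift: "\<exists>f\<in>Hom C \<one> Y. f \<noteq> zeroM C \<one> Y"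
    if "A \<in> Obj C" "a \<in> Hom C A Y" "r \<in> Hom C Y A" "r \<cdot> a = ident C A" "g \<in> Hom C \<one> A" "g \<noteq> zeroM C \<one> A" for A a r g
  proof (rule bexI[of _ "a \<cdot> g"])
    show "a \<cdot> g \<in> Hom C \<one> Y" using comp_hom that add U by blast
    have "r \<cdot> (a \<cdot> g) = g" using comp_assoc[of \<one> A Y A r a g] ident_left[of \<one> A g] that add U by simp
    then show "a \<cdot> g \<noteq> zeroM C \<one> Y" using comp_zeroM_right[of \<one> Y A r] that add U by auto
  qed
  show ?case
  proof (cases "l = i0")
    case True
    then obtain u v where u: "u \<in> Hom C S \<one>" "v \<in> Hom C \<one> S" "v \<cdot> u = ident C S"
      using add V_unit by (auto simp: isomorphic_def iso_in_def inverse_pair_def)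
    have "v \<noteq> zeroM C \<one> S"
    proof
      assume "v = zeroM C \<one> S"
      then have "ident C S = zeroM C S S" using u comp_zeroM_left[OF add(1) U add(1) u(1)] by simp
      then show False using zero_objectI add by (auto simp: simple_object_def)
    qed
    then show ?thesis using lift[OF add(1) b(1,3,5) u(2)] add by blast
  next
    case False
    then show ?thesis using lift[OF add(4) b(2,4,6)] add by auto
  qed
qed simp

text \<open>The test morphism \<open>r\<close>, which kills \<open>f\<close> but not
  \<open>g\<close>, expresses their linear independence without dimensions of hom-sets.\<close>

lemma unit_hom_independent:
  assumes "decomposes X n" "n i0 > 1"
  shows "X \<in> Obj C \<and> (\<exists>f\<in>Hom C \<one> X. \<exists>g\<in>Hom C \<one> X. \<exists>Z\<in>Obj C. \<exists>r\<in>Hom C X Z.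
    f \<noteq> zeroM C \<one> X \<and> r \<cdot> f = zeroM C \<one> Z \<and> r \<cdot> g \<noteq> zeroM C \<one> Z)"
  using assms
proof (induction rule: decomposes.induct)
  case (add S l X n Y)
  obtain i j p q where b: "i \<in> Hom C S Y" "j \<in> Hom C X Y" "p \<in> Hom C Y S" "q \<in> Hom C Y X"
    "p \<cdot> i = ident C S" "q \<cdot> j = ident C X" "q \<cdot> i = zeroM C S X" using add by (auto simp: biproduct_def)
  have U: "\<one> \<in> Obj C" by simp
  show ?case
  proof (cases "l = i0")
    case True
    then obtain u v where u: "u \<in> Hom C S \<one>" "v \<in> Hom C \<one> S" "v \<cdot> u = ident C S"
      using add V_unit by (auto simp: isomorphic_def iso_in_def inverse_pair_def)
    have v: "v \<noteq> zeroM C \<one> S"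
    proof
      assume "v = zeroM C \<one> S"
      then have "ident C S = zeroM C S S" using u comp_zeroM_left[OF add(1) U add(1) u(1)] by simp
      then show False using zero_objectI add by (auto simp: simple_object_def)
    qed
    \<comment> \<open>One of at least two units is split off as \<open>S\<close>, so the complement
      \<open>X\<close> still contains one.\<close>
    obtain g where g: "g \<in> Hom C \<one> X" "g \<noteq> zeroM C \<one> X"
      using unit_hom_nonzero[OF add(5)] True add.prems by auto
    have "p \<cdot> (i \<cdot> v) = v" using comp_assoc[of \<one> S Y S p i v] ident_left[of \<one> S v] b u add U by simp
    then have "i \<cdot> v \<noteq> zeroM C \<one> Y" using comp_zeroM_right[of \<one> Y S p] b v add U by auto
    moreover have "q \<cdot> (i \<cdot> v) = zeroM C \<one> X"
      using comp_assoc[of \<one> S Y X q i v] comp_zeroM_left[of \<one> S X v] b u add U by simp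
    moreover have "q \<cdot> (j \<cdot> g) = g" using comp_assoc[of \<one> X Y X q j g] ident_left[of \<one> X g] b g add U by simp
    moreover have "i \<cdot> v \<in> Hom C \<one> Y" "j \<cdot> g \<in> Hom C \<one> Y"
      using comp_hom[of \<one> S Y i v] comp_hom[of \<one> X Y j g] b u g add U by auto
    ultimately show ?thesis using add g b by metis
  next
    case False
    then obtain f g Z r where f: "f \<in> Hom C \<one> X" "g \<in> Hom C \<one> X" "Z \<in> Obj C" "r \<in> Hom C X Z"
      "f \<noteq> zeroM C \<one> X" "r \<cdot> f = zeroM C \<one> Z" "r \<cdot> g \<noteq> zeroM C \<one> Z" using add by auto
    have qj: "q \<cdot> (j \<cdot> h) = h" if "h \<in> Hom C \<one> X" for h
      using comp_assoc[of \<one> X Y X q j h] ident_left[of \<one> X h] b that add U by simp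
    have h: "j \<cdot> f \<in> Hom C \<one> Y" "j \<cdot> g \<in> Hom C \<one> Y" "r \<cdot> q \<in> Hom C Y Z"
      using comp_hom[of \<one> X Y j] comp_hom[of Y X Z r q] b f add U by auto
    have "(r \<cdot> q) \<cdot> (j \<cdot> f) = zeroM C \<one> Z" "(r \<cdot> q) \<cdot> (j \<cdot> g) \<noteq> zeroM C \<one> Z"
      using comp_assoc[of \<one> Y X Z r q] qj b f h add U by auto
    moreover have "j \<cdot> f \<noteq> zeroM C \<one> Y" using qj[OF f(1)] f(5) comp_zeroM_right[of \<one> Y X q] b add U by auto
    ultimately show ?thesis using add f h by blast
  qed
qed simp

text \<open>With two units present, \<open>r\<close> would kill a nonzero multiple of
  \<open>h\<close>, hence \<open>h\<close>, hence every morphism from the unit, including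
  \<open>g\<close>.\<close>

lemma unit_multiplicity_one:
  assumes "decomposes X n" "X \<in> Obj C" "h \<in> Hom C \<one> X" "h \<noteq> zeroM C \<one> X"
    and span: "\<And>f. f \<in> Hom C \<one> X \<Longrightarrow> \<exists>a. f = a \<odot> h"
  shows "n i0 = 1"
proof -
  have "n i0 \<noteq> 0" using unit_hom_zero[OF assms(1) _ assms(3)] assms(4) by blast
  moreover have "\<not> n i0 > 1"
  proof
    assume "n i0 > 1"
    then obtain f g Z r where f: "f \<in> Hom C \<one> X" "g \<in> Hom C \<one> X" "Z \<in> Obj C" "r \<in> Hom C X Z"
      "f \<noteq> zeroM C \<one> X" "r \<cdot> f = zeroM C \<one> Z" "r \<cdot> g \<noteq> zeroM C \<one> Z"
      using unit_hom_independent[OF assms(1)] by blast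
    obtain a b where ab: "f = a \<odot> h" "g = b \<odot> h" using span f by blast
    have U: "\<one> \<in> Obj C" by simp
    have rh: "r \<cdot> h \<in> Hom C \<one> Z" using comp_hom[OF U assms(2) f(3,4) assms(3)] .
    have "a \<noteq> 0" using ab f(5) assms U by auto
    have "a \<odot> (r \<cdot> h) = zeroM C \<one> Z" using comp_smulM_right[OF U assms(2) f(3,4) assms(3), of a] ab f by simp
    then have "inverse a \<odot> (a \<odot> (r \<cdot> h)) = zeroM C \<one> Z" using f U by simp
    then have "r \<cdot> h = zeroM C \<one> Z"
      using smulM_times[OF U f(3) rh, of "inverse a" a] \<open>a \<noteq> 0\<close> smulM_one[OF U f(3) rh] by simp
    then show False using comp_smulM_right[OF U assms(2) f(3,4) assms(3), of b] ab f U by simp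
  qed
  ultimately show ?thesis by simp
qed

text \<open>The trace of the identity factors through \<open>coev\<close>, and it is the nonzero
  \<open>qdim i\<close>.\<close>

lemma coev_nonzero: "coev C (V i) \<noteq> zeroM C \<one> (V i \<otimes> dual C (V i))"
proof
  let ?X = "V i" and ?d = "dual C (V i)"
  assume z: "coev C ?X = zeroM C \<one> (?X \<otimes> ?d)"
  have d: "?d \<in> Obj C" using dual_obj by simp
  have tw: "twist C ?X \<in> Hom C ?X ?X" using iso\<^sub>t_inv(1)[OF iso_twist\<^sub>t[OF V_obj]] by (simp add: valid_def del: valid_obj)
  have br: "braid C ?X ?d \<in> Hom C (?X \<otimes> ?d) (?d \<otimes> ?X)"
    using iso\<^sub>t_inv(1)[OF iso_braid\<^sub>t[OF V_obj d]] by (simp add: valid_def del: valid_obj)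
  have g: "(twist C ?X \<cdot> ident C ?X) \<otimes>\<^sub>m ident C ?d \<in> Hom C (?X \<otimes> ?d) (?X \<otimes> ?d)"
    using tw d ident_hom[of ?d] ident_right[of ?X ?X "twist C ?X"] by (intro tensorM_hom) auto
  have "ssmul (qdim i) (sid []) = lift [] [] (zeroM C \<one> \<one>)"
    using trace_lift[OF V_obj ident_hom[OF V_obj], of i] trace_scalar[OF V_obj ident_hom[OF V_obj], of i]
      comp_zeroM_right[OF _ _ _ g, of \<one>] comp_zeroM_right[OF _ _ _ br, of \<one>] comp_zeroM_right[OF _ _ _ ev_hom[OF V_obj], of \<one> i] d z
    by simp
  then have "qdim i \<odot> ident C \<one> = 0 \<odot> ident C \<one>"
    using smul_zero[OF unitO_obj unitO_obj ident_hom[OF unitO_obj]] by (simp add: ssmul_sid)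
  then show False using unit_scalar_inj qdim_nonzero by blast
qed

text \<open>Bending one leg turns \<open>f\<close> into an endomorphism of a simple object, hence a
  scalar; bending it back gives that multiple of \<open>coev\<close>.\<close>

lemma hom_unit_tensor_dual:
  assumes "f \<in> Hom C \<one> (V i \<otimes> dual C (V i))"
  shows "\<exists>a. f = a \<odot> coev C (V i)"
proof -
  let ?X = "V i" and ?d = "dual C (V i)"
  have d: "?d \<in> Obj C" using dual_obj by simp
  note D = S.dual_pairD(1-8)[OF dual_pair_single[OF V_obj[of i]]]
  let ?f = "lift [] [?X, ?d] f"
  have f: "sarr ?f" using assms d by (intro sarr_lift) auto
  let ?g = "scomp (stensor (sid [?X]) (sev ?X)) (stensor ?f (sid [?X]))"
  obtain a where a: "?g = ssmul a (sid [?X])"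
    using strict_simple_end_scalar[of ?g i] D f by auto
  have "scomp (stensor ?g (sid [?d])) (scoev ?X) = ?f"
    by (rule S.unit_to_dual[OF dual_pair_single[OF V_obj] f]) simp_all
  then have "?f = scomp (stensor (ssmul a (sid [?X])) (sid [?d])) (scoev ?X)"
    unfolding a by (rule sym)
  also have "\<dots> = ssmul a (scoev ?X)"
    using D by (simp add: S.smul_tns S.smul_cmp)
  finally have "f = a \<odot> coev C ?X" by (simp add: scoev_def lift_smul)
  then show ?thesis by blast
qed

section \<open>Fusion coefficients and the two implications\<close>

definition fusion :: "'i \<Rightarrow> 'i \<Rightarrow> 'i \<Rightarrow> nat" where
  "fusion j k = (SOME n. decomposes (V j \<otimes> V k) n)"

lemma decomposes_fusion: "decomposes (V j \<otimes> V k) (fusion j k)"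
  unfolding fusion_def using ex_decomposes[of "V j \<otimes> V k"] by (simp add: someI_ex)

lemma class_value_fusion: "class_value i (fusion j k) = character i (V j) * character i (V k)"
  using decomposes_character[OF decomposes_fusion, of i j k] character_tensor[of "V j" "V k" i] by simp

text \<open>The product of the Grothendieck ring in the basis of simple classes.\<close>

definition class_mult :: "('i \<Rightarrow> nat) \<Rightarrow> ('i \<Rightarrow> nat) \<Rightarrow> 'i \<Rightarrow> nat" where
  "class_mult m n = (\<lambda>l. \<Sum>a\<in>UNIV. \<Sum>b\<in>UNIV. m a * n b * fusion a b l)"

lemma class_value_mult: "class_value i (class_mult m n) = class_value i m * class_value i n"
proof -
  have "class_value i (class_mult m n)
     = (\<Sum>l\<in>UNIV. \<Sum>a\<in>UNIV. \<Sum>b\<in>UNIV. of_nat (m a) * of_nat (n b) * (of_nat (fusion a b l) * character i (V l)))"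
    by (simp add: class_value_def class_mult_def sum_distrib_left sum_distrib_right mult_ac)
  also have "\<dots> = (\<Sum>a\<in>UNIV. \<Sum>b\<in>UNIV. \<Sum>l\<in>UNIV. of_nat (m a) * of_nat (n b) * (of_nat (fusion a b l) * character i (V l)))"
    by (subst sum.swap, rule sum.cong[OF refl], subst sum.swap) simp
  also have "\<dots> = (\<Sum>a\<in>UNIV. \<Sum>b\<in>UNIV. of_nat (m a) * of_nat (n b) * (character i (V a) * character i (V b)))"
    by (simp flip: sum_distrib_left class_value_fusion add: class_value_def)
  also have "\<dots> = class_value i m * class_value i n"
    by (simp add: class_value_def sum_product mult_ac)
  finally show ?thesis .
qed

lemma class_mult_basis: "class_mult (basis j) n l = (\<Sum>b\<in>UNIV. n b * fusion j b l)"
proof -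
  have "class_mult (basis j) n l = (\<Sum>a\<in>UNIV. if a = j then \<Sum>b\<in>UNIV. n b * fusion a b l else 0)"
    unfolding class_mult_def by (intro sum.cong) auto
  then show ?thesis by simp
qed

text \<open>The unit occurs once in \<open>V j \<otimes> dual C (V j)\<close>. Decomposing the dual
  writes this 1 as a sum of the natural numbers \<open>m k * fusion j k i0\<close>, so one term is 1
  and so is its fusion factor.\<close>

lemma ex_dual_index: "\<exists>k. fusion j k i0 = 1"
proof -
  let ?X = "V j \<otimes> dual C (V j)"
  have d: "dual C (V j) \<in> Obj C" using dual_obj by simp
  then have X: "?X \<in> Obj C" by simp
  obtain n where n: "decomposes ?X n" using ex_decomposes[OF X] by blast
  obtain m where m: "decomposes (dual C (V j)) m" using ex_decomposes[OF d] by blast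
  have "n i0 = 1"
    using unit_multiplicity_one[OF n X coev_hom[OF V_obj] coev_nonzero hom_unit_tensor_dual] .
  moreover have "n = class_mult (basis j) m"
    using decomposes_character[OF n] decomposes_character[OF m] character_tensor[OF V_obj d]
    by (intro class_value_inject) (simp add: class_value_mult)
  ultimately have "(\<Sum>k\<in>UNIV. m k * fusion j k i0) = 1"
    by (simp add: class_mult_basis)
  then obtain k where "m k * fusion j k i0 = 1"
    by (metis (no_types, lifting) finite sum_eq_1_iff UNIV_I)
  then show ?thesis by auto
qed

text \<open>Multiplication by \<open>x\<close> dominates multiplication by its unit summand, so a
  class that lies above \<open>x\<close> stays above it.\<close>

lemma class_power:
  assumes "x i0 = 1"
  shows "\<exists>y. (\<forall>l. x l \<le> y l) \<and> (\<forall>i. class_value i y = class_value i x ^ Suc r)"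
proof (induction r)
  case 0
  then show ?case by auto
next
  case (Suc r)
  then obtain y where y: "\<forall>l. x l \<le> y l" "\<forall>i. class_value i y = class_value i x ^ Suc r" by blast
  have unit: "fusion i0 l = basis l" for l
    by (rule class_value_inject) (simp add: class_value_fusion V_unit)
  have f: "fusion i0 l k = (if k = l then 1 else 0)" for k l by (simp add: unit)
  have "y l \<le> class_mult x y l" for l
  proof -
    \<comment> \<open>Only the term \<open>a = i0\<close> of the product is kept.\<close>
    have "y l = (\<Sum>b\<in>UNIV. x i0 * y b * fusion i0 b l)"
      using assms by (simp add: f if_distrib cong: if_cong)
    also have "\<dots> \<le> class_mult x y l"
      unfolding class_mult_def by (rule member_le_sum) auto
    finally show ?thesis .
  qed
  then show ?case using y
    by (intro exI[of _ "class_mult x y"]) (auto simp: class_value_mult intro: order_trans)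
qed

lemma invertible_if_fusion_unit:
  assumes "\<And>j. \<exists>k. \<forall>i. character i (V j) * character i (V k) = 1"
  shows "pointed C"
  unfolding pointed_def
proof (intro allI impI)
  fix X assume X: "simple_object C X"
  then have o: "X \<in> Obj C" by (simp add: simple_object_def)
  obtain j where "isomorphic C X (V j)" using V_representatives[OF X] by blast
  then have j: "character i X = character i (V j)" for i using character_iso o by simp
  obtain k where "\<forall>i. character i (V j) * character i (V k) = 1" using assms by blast
  then have "isomorphic C (X \<otimes> V k) \<one>" "isomorphic C (V k \<otimes> X) \<one>"
    using o by (simp_all add: isomorphic_unit_iff character_tensor j mult.commute)
  then show "invertible_object C X" using o by (auto simp: invertible_object_def)
qed

lemma A_matrix_character: "A_matrix C V i0 $ i $ j = character i (V j) / qdim j"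
proof -
  have q: "quantum_dim C V i0 j = qdim j" for j
    using S_matrix_character[of j i0] S_matrix_symmetric[of j i0] V_unit by (simp add: quantum_dim_def)
  show ?thesis using qdim_nonzero by (simp add: A_matrix_def q S_matrix_character)
qed

lemma qdim_character: "qdim j = character i0 (V j) * qdim i0"
  using S_matrix_character[of j i0] S_matrix_symmetric[of j i0] V_unit S_matrix_character[of i0 j] by simp

lemma pointed_if_block_rank_one:
  assumes "multiplicative_block_rank_one (A_matrix C V i0)"
  shows "pointed C"
proof -
  obtain r where r: "r \<ge> 1" "block_rank_one (hadamard_power (A_matrix C V i0) r)"
    using assms by (auto simp: multiplicative_block_rank_one_def)
  let ?M = "hadamard_power (A_matrix C V i0) r" and ?c = "(1 / qdim i0) ^ r"
  have M: "?M $ i $ j = (character i (V j) / qdim j) ^ r" for i j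
    by (simp add: hadamard_power_def A_matrix_character)
  have c0: "character i0 (V j) \<noteq> 0" for j using qdim_character[of j] qdim_nonzero[of j] by auto
  \<comment> \<open>Row and column \<open>i0\<close> have the same value: \<open>qdim j\<close> is
    \<open>qdim i0\<close> times \<open>character i0 (V j)\<close>, and characters of the unit are
    1.\<close>
  have "?M $ i $ j = ?c" for i j
  proof (rule block_rank_oneD_const[OF r(2), of _ i0])
    show "?c \<noteq> 0" using qdim_nonzero by simp
    show "?M $ i0 $ j = ?c" for j using c0[of j] by (simp add: M qdim_character[of j])
    show "?M $ i $ i0 = ?c" for i by (simp add: M V_unit)
  qed
  then have *: "(character i (V j) / qdim j) ^ r = ?c" for i j
    unfolding M .
  have e: "character i (V j) ^ r = (qdim j / qdim i0) ^ r" for i j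
  proof -
    have "character i (V j) ^ r = (character i (V j) / qdim j) ^ r * qdim j ^ r"
      using qdim_nonzero[of j] by (simp add: power_divide)
    then show ?thesis unfolding * by (simp add: power_divide)
  qed
  show ?thesis
  proof (rule invertible_if_fusion_unit)
    fix j
    obtain k where k: "fusion j k i0 = 1" using ex_dual_index by blast
    let ?x = "fusion j k"
    \<comment> \<open>Since \<open>r\<close> is at least 1, the exponent \<open>Suc (r - 1)\<close>
      is \<open>r\<close> itself.\<close>
    obtain y where y: "\<forall>l. ?x l \<le> y l" "\<forall>i. class_value i y = class_value i ?x ^ Suc (r - 1)"
      using class_power[of ?x "r - 1"] k by blast
    \<comment> \<open>The value common to all characters of the \<open>r\<close>-th power. It is
      only a field element, so the power is compared with \<open>d\<close> times the unit by
      independence over the field.\<close>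
    define d where "d = (qdim j / qdim i0) ^ r * (qdim k / qdim i0) ^ r"
    have y2: "class_value i y = d" for i
      using y(2) r(1) by (simp add: class_value_fusion power_mult_distrib e d_def)
    have "y l = 0" if "l \<noteq> i0" for l
    proof -
      have "(\<Sum>j\<in>UNIV. character i (V j) * (of_nat (y j) - (if j = i0 then d else 0))) = 0" for i
      proof -
        have "(\<Sum>j\<in>UNIV. character i (V j) * (if j = i0 then d else 0)) = (\<Sum>j\<in>UNIV. if j = i0 then d else 0)"
          by (intro sum.cong) (auto simp: V_unit)
        then show ?thesis
          using y2[of i] by (simp add: class_value_def right_diff_distrib sum_subtractf mult.commute)
      qed
      from characters_independent[OF this, of l] that show ?thesis by simp
    qed
    then have "?x l = 0" if "l \<noteq> i0" for l using y(1) that by (metis le_zero_eq)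
    then have "?x = basis i0" using k by auto
    then show "\<exists>k. \<forall>i. character i (V j) * character i (V k) = 1"
      using class_value_fusion[of _ j k] V_unit class_value_basis[of _ i0] by (metis character_unit)
  qed
qed

text \<open>Each product of two simples has at least one constituent, so the number of constituents
  is supermultiplicative.\<close>

lemma class_size_mult_le:
  assumes "\<And>a b. fusion a b \<noteq> (\<lambda>_. 0)"
  shows "(\<Sum>a\<in>UNIV. m a) * (\<Sum>b\<in>UNIV. n b) \<le> (\<Sum>l\<in>UNIV. class_mult m n l)"
proof -
  have f: "1 \<le> (\<Sum>l\<in>UNIV. fusion a b l)" for a b
  proof -
    obtain l where "fusion a b l \<noteq> 0" using assms[of a b] by auto
    then show ?thesis by (metis (no_types, lifting) finite UNIV_I le_numeral_extra(4) less_one not_le sum_eq_0_iff)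
  qed
  have "(\<Sum>a\<in>UNIV. m a) * (\<Sum>b\<in>UNIV. n b) = (\<Sum>a\<in>UNIV. \<Sum>b\<in>UNIV. m a * n b * 1)"
    by (simp add: sum_product)
  also have "\<dots> \<le> (\<Sum>a\<in>UNIV. \<Sum>b\<in>UNIV. m a * n b * (\<Sum>l\<in>UNIV. fusion a b l))"
    using f by (intro sum_mono mult_left_mono) auto
  also have "\<dots> = (\<Sum>a\<in>UNIV. \<Sum>b\<in>UNIV. \<Sum>l\<in>UNIV. m a * n b * fusion a b l)"
    by (simp add: sum_distrib_left)
  also have "\<dots> = (\<Sum>l\<in>UNIV. class_mult m n l)"
    unfolding class_mult_def by (subst (2) sum.swap, rule sum.cong[OF refl], rule sum.swap)
  finally show ?thesis .
qed

lemma block_rank_one_if_pointed: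
  assumes "pointed C"
  shows "multiplicative_block_rank_one (A_matrix C V i0)"
proof -
  have ex_inv: "\<exists>Y\<in>Obj C. \<forall>i. character i (V j) * character i Y = 1" for j
  proof -
    obtain Y where Y: "Y \<in> Obj C" "isomorphic C (V j \<otimes> Y) \<one>"
      using assms V_simple[of j] by (auto simp: pointed_def invertible_object_def)
    then show ?thesis using isomorphic_unit_iff[of "V j \<otimes> Y"] character_tensor[of "V j" Y] by auto
  qed
  have nz: "character i (V j) \<noteq> 0" for i j using ex_inv[of j] by (metis mult_zero_left zero_neq_one)
  have fus: "fusion a b \<noteq> (\<lambda>_. 0)" for a b
  proof
    assume "fusion a b = (\<lambda>_. 0)"
    then show False using class_value_fusion[of i0 a b] nz by (simp add: class_value_def)
  qed
  \<comment> \<open>Multiplying \<open>V j \<otimes> V l\<close> by an inverse of \<open>V j\<close>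
    gives the class of \<open>V l\<close>, which has one constituent. By supermultiplicativity
    \<open>V j \<otimes> V l\<close> has only one as well.\<close>
  have closed: "\<exists>p. \<forall>i. character i (V j) * character i (V l) = character i (V p)" for j l
  proof -
    obtain Y where Y: "Y \<in> Obj C" "\<And>i. character i (V j) * character i Y = 1" using ex_inv by blast
    obtain y where y: "decomposes Y y" using ex_decomposes Y by blast
    let ?s = "\<lambda>n. \<Sum>l\<in>UNIV. n l :: nat"
    have "class_mult (fusion j l) y = basis l"
    proof (rule class_value_inject)
      fix i
      have "character i (V j) * character i (V l) * character i Y = character i (V l)"
        using Y(2)[of i] by (metis mult.commute mult.left_commute mult.right_neutral)
      then show "class_value i (class_mult (fusion j l) y) = class_value i (basis l)"
        by (simp add: class_value_mult class_value_fusion flip: decomposes_character[OF y])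
    qed
    then have "?s (fusion j l) * ?s y \<le> 1" using class_size_mult_le[OF fus, of "fusion j l" y] by simp
    moreover have "?s y \<noteq> 0"
    proof
      assume "?s y = 0"
      then have "class_value i0 y = 0" by (simp add: class_value_def)
      then show False using Y(2)[of i0] decomposes_character[OF y] by simp
    qed
    moreover have "?s (fusion j l) \<noteq> 0" using fus[of j l] by auto
    ultimately have "?s (fusion j l) = 1" by (metis One_nat_def le_antisym less_one linorder_not_le mult_eq_0_iff nat_mult_eq_1_iff)
    then obtain p where "fusion j l p = 1" "\<forall>q. q \<noteq> p \<longrightarrow> fusion j l q = 0"
      by (metis (no_types, lifting) finite sum_eq_1_iff UNIV_I)
    then have "fusion j l = basis p" by auto
    then show ?thesis using class_value_fusion[of _ j l] class_value_basis[of _ p] by metis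
  qed
  have pow: "\<exists>p. \<forall>i. character i (V j) ^ n = character i (V p)" for j n
  proof (induction n)
    case 0
    then show ?case using V_unit by (intro exI[of _ i0]) simp
  next
    case (Suc n)
    then show ?case using closed by (metis power_Suc)
  qed
  have "\<exists>n>0. \<forall>i. character i (V j) ^ n = 1" for j
  proof -
    \<comment> \<open>Infinitely many powers of \<open>V j\<close> fall into finitely many simple
      classes. Two of them coincide, and nonzero values can be cancelled.\<close>
    obtain s where s: "\<And>n i. character i (V j) ^ n = character i (V (s n))" using pow[of j] by metis
    have "\<not> inj s" using finite_imageD[of s UNIV] infinite_UNIV_nat finite_subset[OF subset_UNIV finite] by blast
    then obtain a b where ab: "s a = s b" "a < b" by (metis injI linorder_neqE_nat)
    have "character i (V j) ^ (b - a) = 1" for i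
    proof -
      have "character i (V j) ^ b = character i (V j) ^ a"
        unfolding s ab(1) ..
      moreover have "character i (V j) ^ b = character i (V j) ^ a * character i (V j) ^ (b - a)"
        using ab(2) by (simp flip: power_add)
      ultimately show ?thesis using nz[of i j] by simp
    qed
    then show ?thesis using ab(2) by (intro exI[of _ "b - a"]) auto
  qed
  then obtain ex where ex: "\<And>j. ex j > (0 :: nat)" "\<And>i j. character i (V j) ^ ex j = 1" by metis
  \<comment> \<open>A common exponent for all simple classes.\<close>
  define r where "r = (\<Prod>j\<in>UNIV. ex j)"
  have "r \<noteq> 0" using ex(1) by (auto simp: r_def)
  have one: "character i (V j) ^ r = 1" for i j
  proof -
    have "ex j dvd r" unfolding r_def by (rule dvd_prodI) auto
    then obtain k where "r = ex j * k" by (rule dvdE)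
    then show ?thesis by (simp add: power_mult ex(2))
  qed
  have "block_rank_one (hadamard_power (A_matrix C V i0) r)"
  proof (rule block_rank_one_constI)
    show "(1 / qdim i0) ^ r \<noteq> 0" using qdim_nonzero by simp
    \<comment> \<open>In the \<open>r\<close>-th power both the numerator and the factor
      \<open>character i0 (V j)\<close> of \<open>qdim j\<close> become 1.\<close>
    show "hadamard_power (A_matrix C V i0) r $ i $ j = (1 / qdim i0) ^ r" for i j
      using one[of i j] one[of i0 j]
      by (simp add: hadamard_power_def A_matrix_character qdim_character[of j] power_divide power_mult_distrib)
  qed
  then show ?thesis using \<open>r \<noteq> 0\<close> by (auto simp: multiplicative_block_rank_one_def intro!: exI[of _ r])
qed

end

theorem theorem6p1:
  fixes C :: "('o, 'm, 'k::{alg_closed_field, field_char_0}) ribbon_data"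
    and V :: "'i::finite \<Rightarrow> 'o"
    and i0 :: 'i
  assumes "modular_category C V i0"
  shows "multiplicative_block_rank_one (A_matrix C V i0) \<longleftrightarrow> pointed C"
proof -
  interpret modular_alg_closed C V i0
    using assms by (simp add: modular_alg_closed_def)
  show ?thesis using pointed_if_block_rank_one block_rank_one_if_pointed by blast
qed

end
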